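(* Let $f=f(\theta,a,t)$ be a solution of the Fokker–Planck equation $$\frac{\partial f}{\partial t}+\nabla^\Omega_\theta\cdot(v_\theta f)+\nabla_a\cdot(v_a f)=\frac{\beta_\theta^2}{2}\Delta^\Omega_\theta f+\frac{\beta_a^2}{2}\Delta_a f$$ on $\Omega\times\Omega_{\mathrm{TJ}}$, with the natural boundary conditions $$f\,\nabla^\Omega_\theta\Bigl(\log f+\frac{6\gamma}{\beta_\theta^2}E\Bigr)\cdot\nu_\theta\Big|_{\partial\Omega\times\Omega_{\mathrm{TJ}}}=0,\qquad f\,\nabla_a\Bigl(\log f+\frac{2\eta}{\beta_a^2}E\Bigr)\cdot\nu_a\Big|_{\Omega\times\partial\Omega_{\mathrm{TJ}}}=0,$$ and with velocities $v_\theta=-3\gamma\nabla^\Omega_\theta E$, $v_a=-\eta\nabla_a E$. If in addition the relaxation time scales $\gamma,\eta$ and the fluctuation parameters $\beta_\theta,\beta_a$ satisfy the relation $$\frac{6\gamma}{\beta_\theta^2}=\frac{2\eta}{\beta_a^2},$$ which in turn determines the parameter $D$ as $$D:=\frac{\beta_\theta^2}{6\gamma}=\frac{\beta_a^2}{2\eta},$$ then the Fokker–Planck equation with these boundary conditions satisfies the energy law $$\frac{d}{dt}\iint_{\Omega\times\Omega_{\mathrm{TJ}}}(Df\log f+fE)\,d\theta\,da=-\frac{\beta_\theta^2}{2D}\iint_{\Omega\times\Omega_{\mathrm{TJ}}}f\,\bigl|\nabla^\Omega_\theta(D\log f+E)\bigr|^2\,d\theta\,da-\frac{\beta_a^2}{2D}\iint_{\Omega\times\Omega_{\mathrm{TJ}}}f\,\bigl|\nabla_a(D\log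 f+E)\bigr|^2\,d\theta\,da.$$ Here $\iint_{\Omega\times\Omega_{\mathrm{TJ}}}(Df\log f+fE)\,d\theta\,da$ represents the (scaled) free energy of the Fokker–Planck system.
   Context: $\gamma,\eta,\beta_\theta,\beta_a>0$ are constants. $\theta=(\theta_1,\theta_2,\theta_3)$ is the misorientation variable (the misorientations $\Delta^{(j)}\alpha$), ranging over $\Omega=\{\theta\in(-\frac{\pi}{4},\frac{\pi}{4})^3:\theta_1+\theta_2+\theta_3=0\}$, a subset of a 2-dimensional plane in $\mathbb{R}^3$; $d\theta$ is the 2-dimensional measure on this plane. $a$ is the triple junction position, ranging over a bounded domain $\Omega_{\mathrm{TJ}}\subset\mathbb{R}^2$. The function $f$ represents the joint probability density function of misorientations and triple junction positions. $\nabla^\Omega_\theta$ is the tangential gradient on the plane of $\Omega$, i.e. $\nabla^\Omega_\theta\phi=(I-\frac13 J)(\partial_{\theta_1}\phi,\partial_{\theta_2}\phi,\partial_{\theta_3}\phi)^{T}$ with $I$ the $3\times3$ identity and $J$ the $3\times3$ all-ones matrix; $\nabla^\Omega_\theta\cdot$ is the corresponding divergence, $\Delta^\Omega_\theta=\nabla^\Omega_\theta\cdot\nabla^\Omega_\theta$; $\nabla_a,\Delta_a$ are the standard gradient and Laplacian in $a$. $\nu_\theta$ and $\nu_a$ are the outer unit normals to $\partial\Omega$ and $\partial\Omega_{\mathrm{TJ}}$, respectively. The energy is $E(\theta,a)=\sum_{j=1}^3\sigma(\theta_j)\,|a-x^{(j)}|$, where $\sigma:\mathbb{R}\to\mathbb{R}$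 is a given $C^1$ function (the grain boundary energy density) and $x^{(1)},x^{(2)},x^{(3)}\in\mathbb{R}^2$ are fixed points. *)

theory Defs
  imports "HOL-Analysis.Analysis"
begin

text \<open>Differential operators.\<close>

definition partial_deriv :: "'n::finite \<Rightarrow> (real^'n \<Rightarrow> real) \<Rightarrow> real^'n \<Rightarrow> real" where
  "partial_deriv i \<phi> p = deriv (\<lambda>s. \<phi> (p + s *\<^sub>R axis i 1)) 0"

definition grad :: "(real^'n \<Rightarrow> real) \<Rightarrow> real^'n \<Rightarrow> real^'n::finite" where
  "grad \<phi> p = (\<chi> i. partial_deriv i \<phi> p)"

definition diverg :: "(real^'n \<Rightarrow> real^'n) \<Rightarrow> real^'n::finite \<Rightarrow> real" where
  "diverg F p = (\<Sum>i\<in>UNIV. grad (\<lambda>q. F q $ i) p $ i)"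

definition laplace :: "(real^'n \<Rightarrow> real) \<Rightarrow> real^'n::finite \<Rightarrow> real" where
  "laplace \<phi> = diverg (grad \<phi>)"

definition ones_matrix :: "real^3^3" where
  "ones_matrix = (\<chi> i j. 1)"

definition tgrad :: "(real^3 \<Rightarrow> real) \<Rightarrow> real^3 \<Rightarrow> real^3" where
  "tgrad \<phi> p = (mat 1 - (1/3) *\<^sub>R ones_matrix) *v grad \<phi> p"

definition tdiverg :: "(real^3 \<Rightarrow> real^3) \<Rightarrow> real^3 \<Rightarrow> real" where
  "tdiverg F p = (\<Sum>i\<in>UNIV. tgrad (\<lambda>q. F q $ i) p $ i)"

definition tlaplace :: "(real^3 \<Rightarrow> real) \<Rightarrow> real^3 \<Rightarrow> real" where
  "tlaplace \<phi> = tdiverg (tgrad \<phi>)"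

definition C1_on :: "'a::real_normed_vector set \<Rightarrow> ('a \<Rightarrow> 'b::real_normed_vector) \<Rightarrow> bool" where
  "C1_on G \<phi> \<longleftrightarrow> (\<exists>\<phi>' :: 'a \<Rightarrow> 'a \<Rightarrow>\<^sub>L 'b.
     (\<forall>z\<in>G. (\<phi> has_derivative blinfun_apply (\<phi>' z)) (at z)) \<and> continuous_on G \<phi>')"

text \<open>The domains and their normals.\<close>

definition misor_plane :: "(real^3) set" where
  "misor_plane = {\<theta>. \<theta>$1 + \<theta>$2 + \<theta>$3 = 0}"

definition misor_domain :: "(real^3) set" where
  "misor_domain = {\<theta>. (\<forall>i. \<theta>$i \<in> {-(pi/4)<..<pi/4}) \<and> \<theta>$1 + \<theta>$2 + \<theta>$3 = 0}"

text \<open>\<open>\<nu>\<close> is the outer unit normal at the boundary point \<open>p\<close> of a set \<open>S\<close> that is open relative to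
  the linear subspace \<open>V\<close>: near \<open>p\<close>, outside any cone around the hyperplane orthogonal to \<open>\<nu>\<close>, the set lies on
  the side of \<open>-\<nu>\<close> and its complement on the side of \<open>\<nu>\<close>.  At a corner there is no such \<open>\<nu>\<close>.\<close>

definition outer_unit_normal ::
    "'a::euclidean_space set \<Rightarrow> 'a set \<Rightarrow> 'a \<Rightarrow> 'a \<Rightarrow> bool" where
  "outer_unit_normal V S p \<nu> \<longleftrightarrow> p \<in> V \<and> \<nu> \<in> V \<and> norm \<nu> = 1 \<and>
     (\<forall>e>0. \<exists>d>0. \<forall>y\<in>V. norm (y - p) < d \<longrightarrow>
        (\<nu> \<bullet> (y - p) > e * norm (y - p) \<longrightarrow> y \<notin> S) \<and>
        (\<nu> \<bullet> (y - p) < - e * norm (y - p) \<longrightarrow> y \<in> S))"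

definition lipschitz_boundary :: "(real^2) set \<Rightarrow> bool" where
  "lipschitz_boundary W \<longleftrightarrow> (\<forall>p\<in>frontier W. \<exists>(R :: real^2 \<Rightarrow> real^2) (g :: real \<Rightarrow> real) L r.
     orthogonal_transformation R \<and> L-lipschitz_on UNIV g \<and> r > 0 \<and>
     (\<forall>y\<in>ball p r. y \<in> W \<longleftrightarrow> R y $ 2 < g (R y $ 1)))"

text \<open>Bounded planar domains whose boundary carries an outer normal; corners are allowed,
  so polygonal and piecewise smooth Lipschitz domains are included.\<close>

definition regular_domain :: "(real^2) set \<Rightarrow> bool" where
  "regular_domain W \<longleftrightarrow> open W \<and> connected W \<and> W \<noteq> {} \<and> bounded W \<and> lipschitz_boundary W \<and>
     countable {p \<in> frontier W. \<nexists>\<nu>. outer_unit_normal UNIV W p \<nu>}"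

text \<open>The two-dimensional measure \<open>d\<theta>\<close> on the plane is the image of Lebesgue measure under the
  linear isometry onto the plane given by an orthonormal basis.\<close>

definition plane_iso :: "real^2 \<Rightarrow> real^3" where
  "plane_iso u = (u$1 / sqrt 2) *\<^sub>R vector [1, -1, 0] + (u$2 / sqrt 6) *\<^sub>R vector [1, 1, -2]"

lemma plane_iso_linear: "linear plane_iso"
  by (rule linearI) (simp_all add: plane_iso_def algebra_simps add_divide_distrib)

lemma plane_iso_norm: "norm (plane_iso u) = norm u"
proof -
  have s: "sqrt 2 * sqrt 2 = 2" "sqrt 6 * sqrt 6 = 6" by simp_all
  have "(u$1/sqrt 2 + u$2/sqrt 6)^2 + (- u$1/sqrt 2 + u$2/sqrt 6)^2 + (- 2*u$2/sqrt 6)^2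
        = (u$1)^2 + (u$2)^2"
    by (simp add: power2_eq_square field_simps s)
  then show ?thesis
    by (simp add: plane_iso_def norm_vec_def L2_set_def sum_3 sum_2 vector_3 algebra_simps)
qed

lemma plane_iso_range: "range plane_iso = misor_plane"
proof (intro equalityI subsetI)
  fix \<theta> assume "\<theta> \<in> range plane_iso"
  then show "\<theta> \<in> misor_plane"
    by (auto simp: plane_iso_def misor_plane_def vector_3 algebra_simps)
next
  fix \<theta> assume a: "\<theta> \<in> misor_plane"
  define u :: "real^2" where "u = vector [sqrt 2 * ((\<theta>$1 - \<theta>$2)/2), sqrt 6 * (- (\<theta>$3)/2)]"
  have "\<theta>$3 = - (\<theta>$1) - \<theta>$2"
    using a by (simp add: misor_plane_def)
  then have "plane_iso u = \<theta>"
    by (simp add: vec_eq_iff forall_3 plane_iso_def u_def vector_3) (simp add: field_simps)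
  then show "\<theta> \<in> range plane_iso" by (metis rangeI)
qed

definition plane_measure :: "(real^3) measure" where
  "plane_measure = distr lborel borel plane_iso"

text \<open>\<open>d\<theta> da\<close>, completed like Lebesgue measure: the gradients below are not controlled on the null
  set where \<open>a\<close> is one of the points \<open>x j\<close>.\<close>

definition state_measure :: "((real^3) \<times> (real^2)) measure" where
  "state_measure = completion (plane_measure \<Otimes>\<^sub>M lborel)"

text \<open>Energy and velocities.\<close>

definition energy :: "(real \<Rightarrow> real) \<Rightarrow> (3 \<Rightarrow> real^2) \<Rightarrow> real^3 \<Rightarrow> real^2 \<Rightarrow> real" where
  "energy \<sigma> x \<theta> a = (\<Sum>j\<in>UNIV. \<sigma> (\<theta>$j) * norm (a - x j))"

definition vel_misor ::
    "real \<Rightarrow> (real^3 \<Rightarrow> real^2 \<Rightarrow> real) \<Rightarrow> real^3 \<Rightarrow> real^2 \<Rightarrow> real^3" where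
  "vel_misor \<gamma> E \<theta> a = (- 3 * \<gamma>) *\<^sub>R tgrad (\<lambda>\<theta>'. E \<theta>' a) \<theta>"

definition vel_junction ::
    "real \<Rightarrow> (real^3 \<Rightarrow> real^2 \<Rightarrow> real) \<Rightarrow> real^3 \<Rightarrow> real^2 \<Rightarrow> real^2" where
  "vel_junction \<eta> E \<theta> a = (- \<eta>) *\<^sub>R grad (\<lambda>a'. E \<theta> a') a"

text \<open>Classical positive solutions on \<open>misor_domain \<times> W\<close> for times in \<open>T\<close>.  The set \<open>X\<close> contains the
  points \<open>x j\<close>, where \<open>E\<close> has no gradient in \<open>a\<close>; spatial derivatives are taken off \<open>X\<close> and only
  assumed bounded near it.  The operators in \<open>\<theta>\<close> use ambient partial derivatives, hence
  differentiability on a neighbourhood \<open>G\<close> in \<open>real^3 \<times> real^2\<close>; any smooth function on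
  the plane has such an extension and its tangential derivatives do not depend on it.
  With \<open>\<sigma>\<close> merely \<open>C\<^sup>1\<close>, differentiability of \<open>f v\<^sub>\<theta>\<close> is part of what it means for the term
  \<open>\<nabla>\<^sub>\<theta> \<cdot> (v\<^sub>\<theta> f)\<close> to exist, whereas \<open>f v\<^sub>a\<close> is automatically \<open>C\<^sup>1\<close> off \<open>X\<close>.\<close>

definition positive_classical ::
    "real \<Rightarrow> (real^3 \<Rightarrow> real^2 \<Rightarrow> real) \<Rightarrow> (real^2) set \<Rightarrow> (real^2) set \<Rightarrow> real set \<Rightarrow>
     (real^3 \<Rightarrow> real^2 \<Rightarrow> real \<Rightarrow> real) \<Rightarrow> bool" where
  "positive_classical \<gamma> E X W T f \<longleftrightarrow>
     (\<forall>\<theta>\<in>closure misor_domain. \<forall>a\<in>closure W. \<forall>t\<in>T.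
        f \<theta> a t > 0 \<and> (\<lambda>s. f \<theta> a s) differentiable (at t)) \<and>
     continuous_on (closure misor_domain \<times> closure W \<times> T) (\<lambda>(\<theta>, a, t). f \<theta> a t) \<and>
     continuous_on (closure misor_domain \<times> closure W \<times> T)
        (\<lambda>(\<theta>, a, t). deriv (\<lambda>s. f \<theta> a s) t) \<and>
     (\<forall>t\<in>T.
        (\<exists>G. open G \<and> misor_domain \<times> (W - X) \<subseteq> G \<and>
           C1_on G (\<lambda>(\<theta>, a). f \<theta> a t) \<and>
           C1_on G (\<lambda>(\<theta>, a). tgrad (\<lambda>\<theta>'. f \<theta>' a t) \<theta>) \<and>
           C1_on G (\<lambda>(\<theta>, a). grad (\<lambda>a'. f \<theta> a' t) a) \<and>
           C1_on G (\<lambda>(\<theta>, a). f \<theta> a t *\<^sub>R vel_misor \<gamma> E \<theta> a)) \<and>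
        bounded ((\<lambda>(\<theta>, a). tgrad (\<lambda>\<theta>'. f \<theta>' a t) \<theta>) ` (misor_domain \<times> (W - X))) \<and>
        bounded ((\<lambda>(\<theta>, a). grad (\<lambda>a'. f \<theta> a' t) a) ` (misor_domain \<times> (W - X))))"

definition fokker_planck_eq ::
    "real \<Rightarrow> real \<Rightarrow> real \<Rightarrow> real \<Rightarrow> (real^3 \<Rightarrow> real^2 \<Rightarrow> real) \<Rightarrow>
     (real^3 \<Rightarrow> real^2 \<Rightarrow> real \<Rightarrow> real) \<Rightarrow> real^3 \<Rightarrow> real^2 \<Rightarrow> real \<Rightarrow> bool" where
  "fokker_planck_eq \<gamma> \<eta> \<beta>\<theta> \<beta>a E f \<theta> a t \<longleftrightarrow>
     deriv (\<lambda>s. f \<theta> a s) t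
       + tdiverg (\<lambda>\<theta>'. f \<theta>' a t *\<^sub>R vel_misor \<gamma> E \<theta>' a) \<theta>
       + diverg (\<lambda>a'. f \<theta> a' t *\<^sub>R vel_junction \<eta> E \<theta> a') a
     = \<beta>\<theta>\<^sup>2 / 2 * tlaplace (\<lambda>\<theta>'. f \<theta>' a t) \<theta> + \<beta>a\<^sup>2 / 2 * laplace (\<lambda>a'. f \<theta> a' t) a"

text \<open>Boundary values of the fluxes are limits from inside the domain.\<close>

definition natural_bc_misor ::
    "real \<Rightarrow> real \<Rightarrow> (real^3 \<Rightarrow> real^2 \<Rightarrow> real) \<Rightarrow> (real^3 \<Rightarrow> real^2 \<Rightarrow> real \<Rightarrow> real) \<Rightarrow>
     real^2 \<Rightarrow> real \<Rightarrow> bool" where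
  "natural_bc_misor \<gamma> \<beta>\<theta> E f a t \<longleftrightarrow>
     (\<forall>\<theta>0\<in>rel_frontier misor_domain. \<forall>\<nu>. outer_unit_normal misor_plane misor_domain \<theta>0 \<nu> \<longrightarrow>
        ((\<lambda>\<theta>. f \<theta> a t *
            (tgrad (\<lambda>\<theta>'. ln (f \<theta>' a t) + 6 * \<gamma> / \<beta>\<theta>\<^sup>2 * E \<theta>' a) \<theta> \<bullet> \<nu>)) \<longlongrightarrow> 0)
          (at \<theta>0 within misor_domain))"

definition natural_bc_junction ::
    "real \<Rightarrow> real \<Rightarrow> (real^3 \<Rightarrow> real^2 \<Rightarrow> real) \<Rightarrow> (real^2) set \<Rightarrow> (real^2) set \<Rightarrow>
     (real^3 \<Rightarrow> real^2 \<Rightarrow> real \<Rightarrow> real) \<Rightarrow> real^3 \<Rightarrow> real \<Rightarrow> bool" where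
  "natural_bc_junction \<eta> \<beta>a E X W f \<theta> t \<longleftrightarrow>
     (\<forall>a0\<in>frontier W - X. \<forall>\<nu>. outer_unit_normal UNIV W a0 \<nu> \<longrightarrow>
        ((\<lambda>a. f \<theta> a t *
            (grad (\<lambda>a'. ln (f \<theta> a' t) + 2 * \<eta> / \<beta>a\<^sup>2 * E \<theta> a') a \<bullet> \<nu>)) \<longlongrightarrow> 0)
          (at a0 within W))"

end

theory Submission
  imports Defs
begin

text \<open>The Fokker--Planck equation is \<open>\<partial>\<^sub>t f = \<nabla> \<cdot> G\<close> with flux
  \<open>G = (3 \<gamma> f \<nabla>\<^sub>\<theta> \<mu>, \<eta> f \<nabla>\<^sub>a \<mu>)\<close>, where \<open>\<mu> = D ln f + E\<close>. Since the free energy density has time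
  derivative \<open>(\<mu> + D) \<partial>\<^sub>t f\<close>, the energy law says that the divergence of \<open>H = (\<mu> + D) G\<close> has
  integral \<open>0\<close>. The field \<open>H\<close> is bounded with bounded divergence, but it need not extend to the boundary,
  and the divergences of its two components need not be integrable separately. So \<open>div H\<close>
  is tested against Lipschitz cutoffs \<open>k\<^sub>n(\<theta>) l\<^sub>n(a)\<close>, and it remains to see that
  \<open>H \<bullet> \<nabla>(k\<^sub>n l\<^sub>n)\<close> tends to \<open>0\<close> in the mean: \<open>\<nabla>k\<^sub>n\<close> lives in a layer of
  width \<open>1/n\<close> along the graph representing the boundary, has size \<open>n\<close>, and is asymptotically
  parallel to the normal wherever a normal exists, so that dominated convergence applies after
  rescaling the layer. The points \<open>x j\<close> are removed by cutoffs whose gradients tend to \<open>0\<close> in the mean.\<close>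


subsection \<open>Integration by parts against a compactly supported Lipschitz function\<close>

text \<open>By the equation, the divergence of \<open>H\<close> is \<open>(\<mu> + D)\<close> times
  the time derivative of \<open>f\<close> plus \<open>f\<close> times the two squared gradients of
  \<open>\<mu>\<close> with weights \<open>3 * \<gamma>\<close> and \<open>\<eta>\<close>. No second
  derivatives are left, so the total is bounded although nothing controls the second derivatives in
  either variable alone. Hence both variables are cut off at once, and only the total divergence
  passes to the limit. The summand \<open>D\<close> comes from differentiating
  \<open>D * f * ln f\<close>; keeping it in \<open>H\<close> lets one identity cover the
  conservation of mass too. The boundary conditions are limits for one frozen value of the other
  variable, without uniformity. Each flux term is therefore integrated first over its own variable,
  and a bound on the \<open>L^1\<close> norm of the cutoff gradients, uniform in \<open>n\<close>,
  supplies the majorant for the outer integral. Boundary points without a normal are countable, so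
  in graph coordinates they occupy a null set of abscissas. The isometry \<open>plane_iso\<close>
  turns the misorientation domain into a planar hexagon, and one construction serves both
  factors.\<close>

definition c1_with :: "'a::real_normed_vector set \<Rightarrow> ('a \<Rightarrow> 'b::real_normed_vector) \<Rightarrow> ('a \<Rightarrow> 'a \<Rightarrow> 'b) \<Rightarrow> bool" where
  "c1_with G \<phi> \<phi>' \<longleftrightarrow> (\<forall>z\<in>G. (\<phi> has_derivative \<phi>' z) (at z)) \<and> (\<forall>v. continuous_on G (\<lambda>z. \<phi>' z v))"

text \<open>By translation invariance all difference quotients of \<open>K\<close> along
  \<open>v\<close> have integral 0. The Lipschitz bound and the bounded support give an integrable
  majorant, so the integral of their limit \<open>K'\<close> is 0 as well; differentiability almost
  everywhere is enough for this.\<close>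

lemma integral_directional_derivative_eq_0:
  fixes K :: "'a::euclidean_space \<Rightarrow> real"
  assumes K: "K \<in> borel_measurable borel" and S: "bounded S" "\<And>z. z \<notin> S \<Longrightarrow> K z = 0"
    and r: "r > 0" and lip: "\<And>z h. \<bar>h\<bar> \<le> r \<Longrightarrow> \<bar>K (z + h *\<^sub>R v) - K z\<bar> \<le> C * \<bar>h\<bar>"
    and bd: "\<And>z. \<bar>K z\<bar> \<le> B"
    and K': "K' \<in> borel_measurable borel"
    and deriv: "AE z in lborel. ((\<lambda>s. K (z + s *\<^sub>R v)) has_real_derivative K' z) (at 0)"
  shows "integrable lborel K'" and "(\<integral>z. K' z \<partial>lborel) = 0"
proof -
  obtain \<rho> where \<rho>: "\<And>z. z \<in> S \<Longrightarrow> norm z \<le> \<rho>" using S(1) by (auto simp: bounded_iff)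
  \<comment> \<open>Inflating by \<open>r * norm v\<close> puts the supports of \<open>K\<close> and
    of all its translates by \<open>h *\<^sub>R v\<close> with \<open>\<bar>h\<bar> \<le> r\<close>
    inside one ball.\<close>
  define A where "A = cball (0::'a) (\<rho> + r * norm v)"
  have [measurable]: "A \<in> sets borel" by (simp add: A_def)
  have Afin: "emeasure lborel A < \<infinity>" unfolding A_def by (rule emeasure_lborel_cball_finite)
  have intA: "integrable lborel (\<lambda>z. c * indicator A z :: real)" for c
    using Afin by (intro integrable_mult_right) (auto simp: integrable_indicator_iff)
  note [measurable] = K K'
  have SA: "z \<in> A" if "z + h *\<^sub>R v \<in> S" "\<bar>h\<bar> \<le> r" for z h
  proof -
    have "norm z \<le> norm (z + h *\<^sub>R v) + norm (h *\<^sub>R v)"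
      by (metis add_diff_cancel_right' norm_triangle_ineq4)
    also have "\<dots> \<le> \<rho> + r * norm v" using \<rho>[OF that(1)] that(2) by (auto intro!: add_mono mult_right_mono)
    finally show ?thesis by (simp add: A_def)
  qed
  have intK: "integrable lborel K"
  proof (rule Bochner_Integration.integrable_bound[OF intA[of B]])
    have "0 \<le> B" using bd[of 0] by linarith
    show "AE z in lborel. norm (K z) \<le> norm (B * indicator A z :: real)"
    proof (rule AE_I2)
      fix z show "norm (K z) \<le> norm (B * indicator A z :: real)"
        using SA[of z 0] r S(2)[of z] bd[of z] \<open>0 \<le> B\<close> by (cases "z \<in> S") (auto simp: indicator_def)
    qed
  qed simp
  define h where "h n = r / real (Suc n)" for n
  have h: "0 < h n" "h n \<le> r" for n using r by (auto simp: h_def field_simps)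
  have h0: "h \<longlonglongrightarrow> 0"
    unfolding h_def divide_inverse by (rule tendsto_mult_right_zero[OF LIMSEQ_inverse_real_of_nat])
  define Q where "Q n z = (K (z + h n *\<^sub>R v) - K z) / h n" for n z
  have shift: "integrable lborel (\<lambda>z. K (z + c))" "(\<integral>z. K (z + c) \<partial>lborel) = (\<integral>z. K z \<partial>lborel)" for c
  proof -
    have e: "lborel = distr lborel borel ((+) c)" by (simp add: lborel_distr_plus)
    show "integrable lborel (\<lambda>z. K (z + c))"
      using intK by (subst (asm) e, subst (asm) integrable_distr_eq) (auto simp: add.commute)
    show "(\<integral>z. K (z + c) \<partial>lborel) = (\<integral>z. K z \<partial>lborel)"
      by (subst (2) e, subst integral_distr) (auto simp: add.commute)
  qed
  have Q0: "(\<integral>z. Q n z \<partial>lborel) = 0" for n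
    unfolding Q_def using shift[of "h n *\<^sub>R v"] intK by simp
  have mQ[measurable]: "Q n \<in> borel_measurable lborel" for n unfolding Q_def by measurable
  have C0: "0 \<le> C" using lip[of r 0] r by (smt (verit) zero_le_mult_iff)
  have bQ: "AE z in lborel. norm (Q n z) \<le> C * indicator A z" for n
  proof (rule AE_I2)
    fix z show "norm (Q n z) \<le> C * indicator A z"
    proof (cases "z \<in> A")
      case True
      have "\<bar>K (z + h n *\<^sub>R v) - K z\<bar> \<le> C * h n" using lip[of "h n" z] h[of n] by simp
      then show ?thesis using True h[of n] by (simp add: Q_def field_simps)
    next
      case False
      then have "z \<notin> S" "z + h n *\<^sub>R v \<notin> S" using SA[of z 0] SA[of z "h n"] h[of n] r by auto
      then show ?thesis using S(2) False by (simp add: Q_def)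
    qed
  qed
  have lQ: "AE z in lborel. (\<lambda>n. Q n z) \<longlonglongrightarrow> K' z"
    using deriv
  proof eventually_elim
    case (elim z)
    then have "((\<lambda>s. (K (z + s *\<^sub>R v) - K z) / s) \<longlongrightarrow> K' z) (at 0)"
      by (simp add: has_field_derivative_iff)
    moreover have "filterlim h (at 0) sequentially"
      using h0 h(1) by (auto simp: filterlim_at intro!: always_eventually) (metis less_irrefl)
    ultimately show ?case unfolding Q_def by (rule filterlim_compose)
  qed
  show "integrable lborel K'"
    by (rule integrable_dominated_convergence[OF _ mQ intA lQ bQ]) simp
  have "(\<lambda>n. \<integral>z. Q n z \<partial>lborel) \<longlonglongrightarrow> (\<integral>z. K' z \<partial>lborel)"
    by (rule integral_dominated_convergence[OF _ mQ intA lQ bQ]) simp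
  then show "(\<integral>z. K' z \<partial>lborel) = 0" by (simp add: Q0 LIMSEQ_const_iff)
qed

text \<open>\<open>c1_with\<close> asks for continuity of the derivative only direction by
  direction, so that derivatives stay plain functions. In finite dimension this still bounds the
  operator norm on compact sets: bound the images of the finitely many basis vectors and expand
  \<open>v\<close>.\<close>

lemma c1_with_bounded_on_compact:
  fixes \<phi>' :: "'a::euclidean_space \<Rightarrow> 'a \<Rightarrow> 'b::real_normed_vector"
  assumes c1: "c1_with G \<phi> \<phi>'" and S: "compact S" "S \<subseteq> G"
  obtains B where "\<And>z v. z \<in> S \<Longrightarrow> norm (\<phi>' z v) \<le> B * norm v"
proof -
  have "\<exists>B. \<forall>z\<in>S. norm (\<phi>' z b) \<le> B" for b
  proof -
    have "continuous_on S (\<lambda>z. \<phi>' z b)" using c1 S by (auto simp: c1_with_def intro: continuous_on_subset)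
    then have "bounded ((\<lambda>z. \<phi>' z b) ` S)" using S(1) by (intro compact_imp_bounded compact_continuous_image)
    then show ?thesis by (auto simp: bounded_iff)
  qed
  then obtain \<beta> where \<beta>: "\<And>b z. z \<in> S \<Longrightarrow> norm (\<phi>' z b) \<le> \<beta> b" by metis
  have "norm (\<phi>' z v) \<le> (\<Sum>b\<in>Basis. \<beta> b) * norm v" if z: "z \<in> S" for z v
  proof -
    have lin: "linear (\<phi>' z)" using c1 z S by (auto simp: c1_with_def dest!: bspec has_derivative_linear)
    have "norm (\<phi>' z v) = norm (\<Sum>b\<in>Basis. (v \<bullet> b) *\<^sub>R \<phi>' z b)"
      by (subst euclidean_representation[of v, symmetric]) (simp add: linear_sum[OF lin] linear_cmul[OF lin])
    also have "\<dots> \<le> (\<Sum>b\<in>Basis. norm v * \<beta> b)"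
      by (intro sum_norm_le) (auto simp: Basis_le_norm intro!: mult_mono \<beta> z)
    finally show ?thesis by (simp add: sum_distrib_left mult.commute)
  qed
  then show ?thesis by (rule that)
qed

text \<open>For each basis vector \<open>b\<close> the function
  \<open>\<Psi> z * (H z \<bullet> b)\<close>, extended by 0, has a derivative along
  \<open>b\<close> of integral 0; summing over \<open>b\<close> gives the claim.
  \<open>\<Psi>\<close> is only Lipschitz, because the cutoffs used later are built from a Lipschitz
  graph; \<open>g\<close> stands for its gradient almost everywhere.\<close>

lemma integration_by_parts_compact:
  fixes H :: "'a::euclidean_space \<Rightarrow> 'a" and \<Psi> :: "'a \<Rightarrow> real"
  assumes O: "open Om" and S: "compact S" "S \<subseteq> Om" and \<Psi>0: "\<And>z. z \<in> Om - S \<Longrightarrow> \<Psi> z = 0"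
    and lip: "L-lipschitz_on UNIV \<Psi>"
    and d\<Psi>: "AE z in lborel. (\<Psi> has_derivative (\<lambda>v. g z \<bullet> v)) (at z)"
    and g[measurable]: "g \<in> borel_measurable borel"
    and H: "c1_with Om H H'"
  shows "integrable lborel (\<lambda>z. indicator Om z * (\<Psi> z * (\<Sum>b\<in>Basis. H' z b \<bullet> b) + g z \<bullet> H z))" (is ?int)
    and "(\<integral>z. indicator Om z * (\<Psi> z * (\<Sum>b\<in>Basis. H' z b \<bullet> b) + g z \<bullet> H z) \<partial>lborel) = 0" (is ?eq)
proof -
  \<comment> \<open>The margin \<open>r\<close> keeps every segment of length at most
    \<open>r\<close> that starts in \<open>S\<close> inside the compact set
    \<open>Sr \<subseteq> Om\<close>, where \<open>H\<close> and its derivative are bounded.\<close>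
  obtain r where r: "r > 0" and rO: "(\<Union>z\<in>S. cball z r) \<subseteq> Om"
    using compact_subset_open_imp_cball_epsilon_subset[OF S(1) O S(2)] by auto
  define Sr where "Sr = (\<Union>z\<in>S. cball z r)"
  have Sr: "compact Sr" "Sr \<subseteq> Om" "S \<subseteq> Sr"
    using compact_minkowski_sum_cball[OF S(1), of r] r rO by (auto simp: Sr_def)
  obtain B1 where B1: "\<And>z v. z \<in> Sr \<Longrightarrow> norm (H' z v) \<le> B1 * norm v"
    using c1_with_bounded_on_compact[OF H Sr(1,2)] by blast
  have contH: "continuous_on Om H"
    using H unfolding c1_with_def by (meson has_derivative_continuous continuous_at_imp_continuous_on)
  have cont\<Psi>: "continuous_on UNIV \<Psi>" using lip by (rule lipschitz_on_continuous_on)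
  have "bounded (H ` Sr)" using contH Sr
    by (intro compact_imp_bounded compact_continuous_image) (auto intro: continuous_on_subset)
  then obtain B2 where B2: "\<And>z. z \<in> Sr \<Longrightarrow> norm (H z) \<le> B2" by (auto simp: bounded_iff)
  have "bounded (\<Psi> ` Sr)" using cont\<Psi> Sr
    by (intro compact_imp_bounded compact_continuous_image) (auto intro: continuous_on_subset)
  then obtain B3 where B3: "\<And>z. z \<in> Sr \<Longrightarrow> \<bar>\<Psi> z\<bar> \<le> B3" by (auto simp: bounded_iff)
  have [measurable]: "Om \<in> sets borel" using O by simp
  have L0: "L \<ge> 0" using lip by (rule lipschitz_on_nonneg)
  define K where "K b z = (if z \<in> Om then \<Psi> z * (H z \<bullet> b) else 0)" for b z
  define K' where "K' b z = indicator Om z * (\<Psi> z * (H' z b \<bullet> b) + (g z \<bullet> b) * (H z \<bullet> b))" for b z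
  have K0: "K b z = 0" if "z \<notin> S" for b z using that \<Psi>0 by (auto simp: K_def)
  have "integrable lborel (K' b) \<and> (\<integral>z. K' b z \<partial>lborel) = 0" if b: "b \<in> Basis" for b
  proof -
    have nb: "norm b = 1" using b by simp
    have ob: "\<bar>w \<bullet> b\<bar> \<le> norm w" for w using Basis_le_norm[OF b, of w] by simp
    have est: "\<bar>K b (z + h *\<^sub>R b) - K b z\<bar> \<le> (B3 * B1 + L * B2) * \<bar>h\<bar>" if h: "\<bar>h\<bar> \<le> r" and zS: "z \<in> S" for z h
    proof -
      have seg: "closed_segment z (z + h *\<^sub>R b) \<subseteq> cball z r"
        using h r nb by (intro closed_segment_subset) (auto simp: dist_norm)
      then have segS: "closed_segment z (z + h *\<^sub>R b) \<subseteq> Sr" using zS by (auto simp: Sr_def)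
      have "norm (H (z + h *\<^sub>R b) - H z) \<le> B1 * norm (z + h *\<^sub>R b - z)"
      proof (rule differentiable_bound[OF convex_closed_segment[of z "z + h *\<^sub>R b"]])
        fix x assume "x \<in> closed_segment z (z + h *\<^sub>R b)"
        then have x: "x \<in> Sr" using segS by auto
        then show "(H has_derivative H' x) (at x within closed_segment z (z + h *\<^sub>R b))"
          using H Sr by (auto simp: c1_with_def intro: has_derivative_at_withinI)
        show "onorm (H' x) \<le> B1" using B1[OF x] by (intro onorm_le) 
      qed auto
      then have 1: "norm (H (z + h *\<^sub>R b) - H z) \<le> B1 * \<bar>h\<bar>" using nb by simp
      have 2: "\<bar>\<Psi> (z + h *\<^sub>R b) - \<Psi> z\<bar> \<le> L * \<bar>h\<bar>"
        using lipschitz_onD[OF lip, of "z + h *\<^sub>R b" z] nb by (simp add: dist_norm)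
      have zin: "z \<in> Sr" "z + h *\<^sub>R b \<in> Sr" using segS by auto
      then have "K b (z + h *\<^sub>R b) - K b z
          = \<Psi> z * ((H (z + h *\<^sub>R b) - H z) \<bullet> b) + (\<Psi> (z + h *\<^sub>R b) - \<Psi> z) * (H (z + h *\<^sub>R b) \<bullet> b)"
        using Sr by (auto simp: K_def algebra_simps inner_diff_left)
      also have "\<bar>\<dots>\<bar> \<le> B3 * (B1 * \<bar>h\<bar>) + (L * \<bar>h\<bar>) * B2"
        using ob[of "H (z + h *\<^sub>R b) - H z"] ob[of "H (z + h *\<^sub>R b)"] 1 2 B2[OF zin(2)] B3[OF zin(1)] L0
        by (intro order_trans[OF abs_triangle_ineq] add_mono) (auto simp: abs_mult intro!: mult_mono)
      finally show ?thesis by (simp add: algebra_simps)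
    qed
    \<comment> \<open>A pair with neither end in \<open>S\<close> gives 0; if the shifted point lies
      in \<open>S\<close>, the estimate is applied from there with \<open>-h\<close>. Extension by 0
      thus creates no jump at the boundary of \<open>Om\<close>.\<close>
    have lipK: "\<bar>K b (z + h *\<^sub>R b) - K b z\<bar> \<le> \<bar>B3 * B1 + L * B2\<bar> * \<bar>h\<bar>" if h: "\<bar>h\<bar> \<le> r" for z h
    proof -
      consider "z \<in> S" | "z + h *\<^sub>R b \<in> S" | "z \<notin> S" "z + h *\<^sub>R b \<notin> S" by blast
      then have "\<bar>K b (z + h *\<^sub>R b) - K b z\<bar> \<le> max 0 ((B3 * B1 + L * B2) * \<bar>h\<bar>)"
      proof cases
        case 1 then show ?thesis using est[OF h 1] by simp
      next
        case 2
        then show ?thesis using est[of "-h" "z + h *\<^sub>R b"] h by (simp add: abs_minus_commute)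
      qed (simp add: K0)
      also have "\<dots> \<le> \<bar>B3 * B1 + L * B2\<bar> * \<bar>h\<bar>" by (auto intro: mult_right_mono)
      finally show ?thesis .
    qed
    have bdK: "\<bar>K b z\<bar> \<le> \<bar>B3 * B2\<bar>" for z
    proof (cases "z \<in> S")
      case True
      then have "z \<in> Sr" using Sr by auto
      then have "\<bar>\<Psi> z * (H z \<bullet> b)\<bar> \<le> B3 * B2"
        using ob[of "H z"] B2[of z] B3[of z] by (auto simp: abs_mult intro!: mult_mono)
      then show ?thesis by (auto simp: K_def)
    qed (simp add: K0)
    have mK: "K b \<in> borel_measurable borel" unfolding K_def
      using contH cont\<Psi> by (intro borel_measurable_continuous_on_if) (auto intro!: continuous_intros intro: continuous_on_subset)
    have mH: "(\<lambda>z. indicator Om z *\<^sub>R H z) \<in> borel_measurable borel"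
      using contH by (intro borel_measurable_continuous_on_indicator) auto
    have mH': "(\<lambda>z. indicator Om z *\<^sub>R H' z b) \<in> borel_measurable borel"
      using H by (intro borel_measurable_continuous_on_indicator) (auto simp: c1_with_def)
    have m\<Psi>[measurable]: "\<Psi> \<in> borel_measurable borel" using cont\<Psi> by (rule borel_measurable_continuous_onI)
    have K'eq: "K' b = (\<lambda>z. \<Psi> z * ((indicator Om z *\<^sub>R H' z b) \<bullet> b) + (g z \<bullet> b) * ((indicator Om z *\<^sub>R H z) \<bullet> b))"
      by (auto simp: K'_def fun_eq_iff algebra_simps)
    have mK': "K' b \<in> borel_measurable borel" unfolding K'eq using mH mH' by measurable
    have dK: "AE z in lborel. ((\<lambda>s. K b (z + s *\<^sub>R b)) has_real_derivative K' b z) (at 0)"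
      using d\<Psi>
    proof eventually_elim
      case (elim z)
      have line: "((\<lambda>s. z + s *\<^sub>R b) has_derivative (\<lambda>s. s *\<^sub>R b)) (at 0)"
        by (auto intro!: derivative_eq_intros)
      show ?case
      proof (cases "z \<in> Om")
        case True
        have dH: "(H has_derivative H' z) (at z)" using H True by (auto simp: c1_with_def)
        have lin: "linear (H' z)" using dH by (rule has_derivative_linear)
        have "((\<lambda>s. \<Psi> (z + s *\<^sub>R b) * (H (z + s *\<^sub>R b) \<bullet> b)) has_derivative
             (\<lambda>s. \<Psi> z * (H' z (s *\<^sub>R b) \<bullet> b) + (g z \<bullet> (s *\<^sub>R b)) * (H z \<bullet> b))) (at 0)"
          using has_derivative_compose[OF line, of \<Psi>] has_derivative_compose[OF line, of H] elim dH
          by (auto intro!: derivative_eq_intros)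
        then have d: "((\<lambda>s. \<Psi> (z + s *\<^sub>R b) * (H (z + s *\<^sub>R b) \<bullet> b)) has_real_derivative K' b z) (at 0)"
          unfolding has_field_derivative_def
          by (rule has_derivative_eq_rhs) (use True in \<open>auto simp: K'_def fun_eq_iff linear_cmul[OF lin] algebra_simps\<close>)
        have "\<forall>\<^sub>F s in nhds 0. z + s *\<^sub>R b \<in> Om"
          using O True by (intro topological_tendstoD[of "\<lambda>s. z + s *\<^sub>R b" z]) (auto intro!: tendsto_eq_intros filterlim_ident)
        then have "\<forall>\<^sub>F s in nhds 0. K b (z + s *\<^sub>R b) = \<Psi> (z + s *\<^sub>R b) * (H (z + s *\<^sub>R b) \<bullet> b)"
          by eventually_elim (simp add: K_def)
        from DERIV_cong_ev[OF refl this refl] d show ?thesis by simp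
      next
        case False
        then have "z \<in> - S" using S by auto
        then have "\<forall>\<^sub>F s in nhds 0. z + s *\<^sub>R b \<in> - S"
          using compact_imp_closed[OF S(1)] by (intro topological_tendstoD[of "\<lambda>s. z + s *\<^sub>R b" z]) (auto intro!: tendsto_eq_intros filterlim_ident)
        then have "\<forall>\<^sub>F s in nhds 0. K b (z + s *\<^sub>R b) = 0" by eventually_elim (simp add: K0)
        moreover have "K' b z = 0" using False by (simp add: K'_def)
        ultimately show ?thesis
          by (simp add: DERIV_cong_ev[where g="\<lambda>_. 0" and y=0])
      qed
    qed
    show ?thesis
      using integral_directional_derivative_eq_0[OF mK compact_imp_bounded[OF S(1)] _ r lipK bdK mK' dK] K0 by blast
  qed
  note int = this
  have "indicator Om z * (\<Psi> z * (\<Sum>b\<in>Basis. H' z b \<bullet> b) + g z \<bullet> H z) = (\<Sum>b\<in>Basis. K' b z)" for z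
    by (simp add: K'_def sum_distrib_left sum.distrib euclidean_inner[of "g z" "H z"] distrib_left)
  then show ?int ?eq using int by (simp_all add: Bochner_Integration.integral_sum)
qed


subsection \<open>Cutoff sequences\<close>

text \<open>The squared positive part is a simple one-sided C1 cutoff; composing two of them yields
  \<open>step\<close> without gluing formulas.\<close>

definition pos_sq :: "real \<Rightarrow> real" where "pos_sq x = (max 0 x)\<^sup>2"

lemma pos_sq_has_derivative: "(pos_sq has_real_derivative 2 * max 0 x) (at x)"
proof (cases "x = 0")
  case True
  have "((\<lambda>h. pos_sq h / h) \<longlongrightarrow> 0) (at 0)"
  proof (rule Lim_null_comparison)
    show "\<forall>\<^sub>F h in at 0. norm (pos_sq h / h) \<le> \<bar>h\<bar>"
      by (intro always_eventually allI) (auto simp: pos_sq_def max_def power2_eq_square)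
  qed (auto intro!: tendsto_eq_intros)
  then show ?thesis using True by (simp add: has_field_derivative_iff pos_sq_def)
next
  case False
  show ?thesis
  proof (cases "x > 0")
    case True
    have "((\<lambda>x. x\<^sup>2) has_real_derivative 2 * max 0 x) (at x)"
      using True by (auto intro!: derivative_eq_intros)
    then show ?thesis
      by (rule has_field_derivative_transform_within_open[where S="{0<..}"]) (use True in \<open>auto simp: pos_sq_def\<close>)
  next
    case False
    have "((\<lambda>x. 0) has_real_derivative 2 * max 0 x) (at x)"
      using False by (auto intro!: derivative_eq_intros)
    then show ?thesis
      by (rule has_field_derivative_transform_within_open[where S="{..<0}"])
        (use False \<open>x \<noteq> 0\<close> in \<open>auto simp: pos_sq_def\<close>)
  qed
qed

text \<open>A C1 transition from 0 for \<open>s \<le> 1\<close> to 1 for \<open>s \<ge> 2\<close>.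
  It vanishes on all of \<open>s \<le> 1\<close>, not only for \<open>s \<le> 0\<close>, so that the
  cutoffs vanish on whole neighbourhoods of the set to be removed.\<close>

definition step :: "real \<Rightarrow> real" where "step s = pos_sq (1 - pos_sq (2 - s))"

definition step' :: "real \<Rightarrow> real" where "step' s = 4 * max 0 (1 - pos_sq (2 - s)) * max 0 (2 - s)"

lemma step_has_derivative: "(step has_real_derivative step' s) (at s)"
proof -
  have 1: "((\<lambda>s. 1 - pos_sq (2 - s)) has_real_derivative 2 * max 0 (2 - s)) (at s)"
    by (auto intro!: derivative_eq_intros DERIV_chain2[OF pos_sq_has_derivative])
  show ?thesis
    unfolding step_def[abs_def] step'_def using DERIV_chain2[OF pos_sq_has_derivative 1] by (simp add: mult.assoc)
qed

lemma pos_sq_ge: "pos_sq x \<ge> 0" by (simp add: pos_sq_def)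

lemma pos_sq_ge_1: "x \<ge> 1 \<Longrightarrow> pos_sq x \<ge> 1"
  by (simp add: pos_sq_def max_def)

lemma step_bounds: "0 \<le> step s" "step s \<le> 1"
proof -
  have "max 0 (1 - pos_sq (2 - s)) \<le> 1" using pos_sq_ge[of "2 - s"] by simp
  then show "step s \<le> 1" unfolding step_def by (subst pos_sq_def) (rule power_le_one, auto)
qed (simp add: step_def pos_sq_ge)

lemma step_eq_0: "s \<le> 1 \<Longrightarrow> step s = 0" and step_eq_1: "s \<ge> 2 \<Longrightarrow> step s = 1"
proof -
  assume "s \<le> 1"
  then have "1 - pos_sq (2 - s) \<le> 0" using pos_sq_ge_1[of "2 - s"] by simp
  then show "step s = 0" unfolding step_def by (subst pos_sq_def) simp
next
  assume "s \<ge> 2"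
  then show "step s = 1" by (simp add: step_def pos_sq_def)
qed

lemma step'_eq_0: "s \<le> 1 \<or> s \<ge> 2 \<Longrightarrow> step' s = 0"
  using pos_sq_ge_1[of "2 - s"] by (auto simp: step'_def)

text \<open>For \<open>s \<le> 1\<close> the derivative is 0, and for \<open>s > 1\<close> both
  positive parts in \<open>step'\<close> are at most 1, which leaves the factor 4.\<close>

lemma step'_bounds: "0 \<le> step' s" "step' s \<le> 4"
proof -
  show "0 \<le> step' s" by (simp add: step'_def)
  show "step' s \<le> 4"
  proof (cases "s \<le> 1")
    case False
    have "max 0 (1 - pos_sq (2 - s)) * max 0 (2 - s) \<le> 1 * 1"
      using False pos_sq_ge[of "2 - s"] by (intro mult_mono) auto
    then show ?thesis by (simp add: step'_def)
  qed (simp add: step'_eq_0)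
qed

lemma isCont_step: "isCont step s"
  by (rule DERIV_isCont[OF step_has_derivative])

lemma isCont_step': "isCont step' s"
  unfolding step'_def by (intro continuous_intros isCont_o2[OF _ DERIV_isCont[OF pos_sq_has_derivative]])

lemma continuous_on_step [continuous_intros]: "continuous_on A f \<Longrightarrow> continuous_on A (\<lambda>x. step (f x))"
  by (rule continuous_on_compose2[of UNIV step]) (auto intro!: continuous_at_imp_continuous_on isCont_step)

lemma continuous_on_step' [continuous_intros]: "continuous_on A f \<Longrightarrow> continuous_on A (\<lambda>x. step' (f x))"
  by (rule continuous_on_compose2[of UNIV step']) (auto intro!: continuous_at_imp_continuous_on isCont_step')

lemma borel_measurable_step [measurable]: "step \<in> borel_measurable borel" "step' \<in> borel_measurable borel"
  by (auto intro!: borel_measurable_continuous_onI continuous_intros)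

lemma step_lipschitz: "\<bar>step s - step t\<bar> \<le> 4 * \<bar>s - t\<bar>"
proof -
  have "norm (step s - step t) \<le> 4 * norm (s - t)"
    by (rule field_differentiable_bound[of UNIV step step'])
      (use step'_bounds in \<open>auto intro: has_field_derivative_at_within step_has_derivative\<close>)
  then show ?thesis by simp
qed

text \<open>Models one component of the field with the other variable frozen. The relation
  \<open>N\<close> selects the boundary points and normals at which the flux is known to vanish, so
  that points without a normal and points of an exceptional set can be left out.\<close>

definition vanishing_flux :: "(real^2) set \<Rightarrow> (real^2 \<Rightarrow> real^2 \<Rightarrow> bool) \<Rightarrow> (real^2 \<Rightarrow> real^2) \<Rightarrow> bool" where
  "vanishing_flux V N H \<longleftrightarrow> continuous_on V H \<and> bounded (H ` V) \<and>
     (\<forall>p \<nu>. N p \<nu> \<longrightarrow> ((\<lambda>a. H a \<bullet> \<nu>) \<longlongrightarrow> 0) (at p within V))"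

text \<open>\<open>G\<close> is the gradient of \<open>k\<close> almost everywhere. The uniform
  bound on its \<open>L^1\<close> norm later dominates the flux term when it is integrated over the
  other variable, and the last clause is the vanishing of that term while the other variable is
  frozen. The indicator of \<open>V\<close> makes the field measurable on the whole plane.\<close>

definition cutoff :: "(real^2) set \<Rightarrow> (real^2 \<Rightarrow> real^2 \<Rightarrow> bool) \<Rightarrow>
    (nat \<Rightarrow> real^2 \<Rightarrow> real) \<Rightarrow> (nat \<Rightarrow> real^2 \<Rightarrow> real^2) \<Rightarrow> bool" where
  "cutoff V N k G \<longleftrightarrow>
     (\<forall>n y. 0 \<le> k n y \<and> k n y \<le> 1) \<and> (\<forall>n. \<exists>L. L-lipschitz_on UNIV (k n)) \<and>
     (\<forall>n. AE y in lborel. (k n has_derivative (\<lambda>v. G n y \<bullet> v)) (at y)) \<and>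
     (\<forall>n. G n \<in> borel_measurable borel) \<and>
     (\<exists>C. \<forall>n. (\<integral>\<^sup>+y. ennreal (indicator V y * norm (G n y)) \<partial>lborel) \<le> ennreal C) \<and>
     (\<forall>y\<in>V. (\<lambda>n. k n y) \<longlonglongrightarrow> 1) \<and>
     (\<forall>H. vanishing_flux V N H \<longrightarrow>
        (\<lambda>n. \<integral>\<^sup>+y. ennreal \<bar>(indicator V y *\<^sub>R H y) \<bullet> G n y\<bar> \<partial>lborel) \<longlonglongrightarrow> 0)"

text \<open>The neighbourhood of \<open>A\<close> on which \<open>k n\<close> vanishes depends on
  \<open>n\<close>, which is compatible with convergence to 1 at the points of \<open>V\<close>
  close to \<open>A\<close>.\<close>

definition cutoff_near :: "(real^2) set \<Rightarrow> (real^2 \<Rightarrow> real^2 \<Rightarrow> bool) \<Rightarrow> (real^2) set \<Rightarrow> bool" where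
  "cutoff_near V N A \<longleftrightarrow> (\<exists>k G. cutoff V N k G \<and> (\<forall>n. \<exists>Z. open Z \<and> A \<subseteq> Z \<and> (\<forall>y\<in>Z. k n y = 0)))"

lemma vanishing_flux_measurable:
  "vanishing_flux V N H \<Longrightarrow> open V \<Longrightarrow> (\<lambda>y. indicator V y *\<^sub>R H y) \<in> borel_measurable borel"
  by (auto simp: vanishing_flux_def intro!: borel_measurable_continuous_on_indicator)

lemma cutoff_near_empty: "cutoff_near V N {}"
  unfolding cutoff_near_def cutoff_def
  by (rule exI[of _ "\<lambda>_ _. 1"], rule exI[of _ "\<lambda>_ _. 0"]) (auto intro!: exI[of _ "0::real"] exI[of _ "{}"] lipschitz_onI simp: inner_zero_left[abs_def])

lemma lipschitz_on_mult_unit: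
  fixes k l :: "'a::metric_space \<Rightarrow> real"
  assumes k: "L-lipschitz_on A k" "\<And>y. y \<in> A \<Longrightarrow> \<bar>k y\<bar> \<le> 1" and l: "M-lipschitz_on A l" "\<And>y. y \<in> A \<Longrightarrow> \<bar>l y\<bar> \<le> 1"
  shows "(L + M)-lipschitz_on A (\<lambda>y. k y * l y)"
proof (rule lipschitz_onI)
  show "0 \<le> L + M" using lipschitz_on_nonneg[OF k(1)] lipschitz_on_nonneg[OF l(1)] by simp
  fix x y assume x: "x \<in> A" "y \<in> A"
  have "k x * l x - k y * l y = (k x - k y) * l x + k y * (l x - l y)" by (simp add: algebra_simps)
  also have "\<bar>\<dots>\<bar> \<le> \<bar>k x - k y\<bar> * 1 + 1 * \<bar>l x - l y\<bar>"
    unfolding abs_mult using k(2)[of y] l(2)[of x] x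
    by (intro order_trans[OF abs_triangle_ineq] add_mono; unfold abs_mult; intro mult_mono) auto
  also have "\<dots> \<le> L * dist x y + M * dist x y"
    using lipschitz_onD[OF k(1) x] lipschitz_onD[OF l(1) x] by (simp add: dist_real_def)
  finally show "dist (k x * l x) (k y * l y) \<le> (L + M) * dist x y" by (simp add: dist_real_def algebra_simps)
qed

text \<open>Since both factors lie between 0 and 1, the product rule bounds the gradient, and its
  inner product with a field, by the sum of the two separate contributions. Hence the
  \<open>L^1\<close> bound and the vanishing flux are inherited, and cutoffs for several sets can be
  multiplied.\<close>

lemma cutoff_mult:
  assumes V: "open V" and k: "cutoff V N k G" and l: "cutoff V N l M"
  shows "cutoff V N (\<lambda>n y. k n y * l n y) (\<lambda>n y. k n y *\<^sub>R M n y + l n y *\<^sub>R G n y)"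
proof -
  have b: "0 \<le> k n y" "k n y \<le> 1" "0 \<le> l n y" "l n y \<le> 1" for n y using k l by (auto simp: cutoff_def)
  have [measurable]: "G n \<in> borel_measurable borel" "M n \<in> borel_measurable borel" for n
    using k l by (auto simp: cutoff_def)
  have [measurable]: "k n \<in> borel_measurable borel" "l n \<in> borel_measurable borel" for n
    using k l by (auto simp: cutoff_def intro!: borel_measurable_continuous_onI intro: lipschitz_on_continuous_on)
  have [measurable]: "V \<in> sets borel" using V by simp
  have comb: "norm (k n y *\<^sub>R M n y + l n y *\<^sub>R G n y) \<le> norm (M n y) + norm (G n y)" for n y
    using b[of n y] by (intro order_trans[OF norm_triangle_ineq] add_mono) (auto intro: mult_left_le_one_le)
  have comb2: "\<bar>h \<bullet> (k n y *\<^sub>R M n y + l n y *\<^sub>R G n y)\<bar> \<le> \<bar>h \<bullet> M n y\<bar> + \<bar>h \<bullet> G n y\<bar>" for n y h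
    using b[of n y] unfolding inner_add_right inner_scaleR_right
    by (intro order_trans[OF abs_triangle_ineq] add_mono) (auto simp: abs_mult intro: mult_left_le_one_le)
  obtain C1 where C1: "\<And>n. (\<integral>\<^sup>+y. ennreal (indicator V y * norm (G n y)) \<partial>lborel) \<le> ennreal C1"
    using k by (auto simp: cutoff_def)
  obtain C2 where C2: "\<And>n. (\<integral>\<^sup>+y. ennreal (indicator V y * norm (M n y)) \<partial>lborel) \<le> ennreal C2"
    using l by (auto simp: cutoff_def)
  show ?thesis
    unfolding cutoff_def
  proof (intro conjI allI ballI impI)
    fix n y
    show "0 \<le> k n y * l n y" "k n y * l n y \<le> 1" using b[of n y] by (auto intro: mult_le_one)
  next
    fix n
    obtain L1 L2 where "L1-lipschitz_on UNIV (k n)" "L2-lipschitz_on UNIV (l n)" using k l unfolding cutoff_def by blast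
    then show "\<exists>L. L-lipschitz_on UNIV (\<lambda>y. k n y * l n y)"
      using b by (intro exI[of _ "L1 + L2"] lipschitz_on_mult_unit) auto
    have "AE y in lborel. (k n has_derivative (\<lambda>v. G n y \<bullet> v)) (at y)"
      "AE y in lborel. (l n has_derivative (\<lambda>v. M n y \<bullet> v)) (at y)" using k l by (auto simp: cutoff_def)
    then show "AE y in lborel. ((\<lambda>y. k n y * l n y) has_derivative (\<lambda>v. (k n y *\<^sub>R M n y + l n y *\<^sub>R G n y) \<bullet> v)) (at y)"
    proof eventually_elim
      case (elim y)
      then show ?case by (auto intro!: derivative_eq_intros simp: inner_add_left algebra_simps)
    qed
    show "(\<lambda>y. k n y *\<^sub>R M n y + l n y *\<^sub>R G n y) \<in> borel_measurable borel" by measurable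
  next
    show "\<exists>C. \<forall>n. (\<integral>\<^sup>+y. ennreal (indicator V y * norm (k n y *\<^sub>R M n y + l n y *\<^sub>R G n y)) \<partial>lborel) \<le> ennreal C"
    proof (intro exI allI)
      fix n
      have "(\<integral>\<^sup>+y. ennreal (indicator V y * norm (k n y *\<^sub>R M n y + l n y *\<^sub>R G n y)) \<partial>lborel)
         \<le> (\<integral>\<^sup>+y. ennreal (indicator V y * norm (M n y)) + ennreal (indicator V y * norm (G n y)) \<partial>lborel)"
        using comb by (intro nn_integral_mono) (auto simp: indicator_def simp flip: ennreal_plus)
      also have "\<dots> \<le> ennreal C2 + ennreal C1"
        by (subst nn_integral_add) (auto intro!: add_mono C1 C2)
      also have "\<dots> \<le> ennreal (\<bar>C2\<bar> + \<bar>C1\<bar>)" by (subst ennreal_plus) (auto intro!: add_mono ennreal_leI)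
      finally show "(\<integral>\<^sup>+y. ennreal (indicator V y * norm (k n y *\<^sub>R M n y + l n y *\<^sub>R G n y)) \<partial>lborel) \<le> ennreal (\<bar>C2\<bar> + \<bar>C1\<bar>)" .
    qed
  next
    fix y assume "y \<in> V"
    then have "(\<lambda>n. k n y) \<longlonglongrightarrow> 1" "(\<lambda>n. l n y) \<longlonglongrightarrow> 1" using k l by (auto simp: cutoff_def)
    then show "(\<lambda>n. k n y * l n y) \<longlonglongrightarrow> 1" by (auto intro: tendsto_eq_intros)
  next
    fix H assume H: "vanishing_flux V N H"
    note [measurable] = vanishing_flux_measurable[OF H V]
    have lim: "(\<lambda>n. \<integral>\<^sup>+y. ennreal \<bar>(indicator V y *\<^sub>R H y) \<bullet> G n y\<bar> \<partial>lborel) \<longlonglongrightarrow> 0"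
      "(\<lambda>n. \<integral>\<^sup>+y. ennreal \<bar>(indicator V y *\<^sub>R H y) \<bullet> M n y\<bar> \<partial>lborel) \<longlonglongrightarrow> 0"
      using k l H by (auto simp: cutoff_def)
    have le: "(\<integral>\<^sup>+y. ennreal \<bar>(indicator V y *\<^sub>R H y) \<bullet> (k n y *\<^sub>R M n y + l n y *\<^sub>R G n y)\<bar> \<partial>lborel)
       \<le> (\<integral>\<^sup>+y. ennreal \<bar>(indicator V y *\<^sub>R H y) \<bullet> M n y\<bar> \<partial>lborel) + (\<integral>\<^sup>+y. ennreal \<bar>(indicator V y *\<^sub>R H y) \<bullet> G n y\<bar> \<partial>lborel)" for n
    proof -
      define F where "F y = indicator V y *\<^sub>R H y" for y
      have [measurable]: "F \<in> borel_measurable borel" using vanishing_flux_measurable[OF H V] by (simp add: F_def[abs_def])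
      have "(\<integral>\<^sup>+y. ennreal \<bar>F y \<bullet> (k n y *\<^sub>R M n y + l n y *\<^sub>R G n y)\<bar> \<partial>lborel)
         \<le> (\<integral>\<^sup>+y. ennreal \<bar>F y \<bullet> M n y\<bar> + ennreal \<bar>F y \<bullet> G n y\<bar> \<partial>lborel)"
      proof (rule nn_integral_mono)
        fix y
        have "ennreal \<bar>F y \<bullet> (k n y *\<^sub>R M n y + l n y *\<^sub>R G n y)\<bar> \<le> ennreal (\<bar>F y \<bullet> M n y\<bar> + \<bar>F y \<bullet> G n y\<bar>)"
          by (rule ennreal_leI, rule comb2)
        then show "ennreal \<bar>F y \<bullet> (k n y *\<^sub>R M n y + l n y *\<^sub>R G n y)\<bar> \<le> ennreal \<bar>F y \<bullet> M n y\<bar> + ennreal \<bar>F y \<bullet> G n y\<bar>"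
          by (simp only: ennreal_plus[OF abs_ge_zero abs_ge_zero])
      qed
      also have "\<dots> = (\<integral>\<^sup>+y. ennreal \<bar>F y \<bullet> M n y\<bar> \<partial>lborel) + (\<integral>\<^sup>+y. ennreal \<bar>F y \<bullet> G n y\<bar> \<partial>lborel)"
        by (rule nn_integral_add) measurable
      finally show ?thesis unfolding F_def .
    qed
    show "(\<lambda>n. \<integral>\<^sup>+y. ennreal \<bar>(indicator V y *\<^sub>R H y) \<bullet> (k n y *\<^sub>R M n y + l n y *\<^sub>R G n y)\<bar> \<partial>lborel) \<longlonglongrightarrow> 0"
      using tendsto_sandwich[OF always_eventually[OF allI[OF zero_le]] always_eventually[OF allI[OF le]] tendsto_const
        tendsto_add[OF lim(2) lim(1), unfolded add_0]] .
  qed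
qed

lemma cutoff_near_Un:
  assumes V: "open V" and A: "cutoff_near V N A" and B: "cutoff_near V N B"
  shows "cutoff_near V N (A \<union> B)"
proof -
  obtain k G l M where k: "cutoff V N k G" "\<And>n. \<exists>Z. open Z \<and> A \<subseteq> Z \<and> (\<forall>y\<in>Z. k n y = 0)"
    and l: "cutoff V N l M" "\<And>n. \<exists>Z. open Z \<and> B \<subseteq> Z \<and> (\<forall>y\<in>Z. l n y = 0)"
    using A B by (auto simp: cutoff_near_def)
  have "\<exists>Z. open Z \<and> A \<union> B \<subseteq> Z \<and> (\<forall>y\<in>Z. k n y * l n y = 0)" for n
  proof -
    obtain Z1 Z2 where "open Z1" "A \<subseteq> Z1" "\<forall>y\<in>Z1. k n y = 0" "open Z2" "B \<subseteq> Z2" "\<forall>y\<in>Z2. l n y = 0"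
      using k(2)[of n] l(2)[of n] by auto
    then show ?thesis by (intro exI[of _ "Z1 \<union> Z2"]) auto
  qed
  then show ?thesis unfolding cutoff_near_def using cutoff_mult[OF V k(1) l(1)] by blast
qed

lemma cutoff_near_Union:
  assumes "open V" "finite \<A>" "\<And>A. A \<in> \<A> \<Longrightarrow> cutoff_near V N A"
  shows "cutoff_near V N (\<Union>\<A>)"
  using assms(2,3) by (induction rule: finite_induct) (auto simp: cutoff_near_empty intro!: cutoff_near_Un[OF assms(1)])

text \<open>A gradient of size \<open>m\<close> on a disc of radius of order \<open>1 / m\<close>
  has an \<open>L^1\<close> norm of order \<open>1 / m\<close> in two dimensions. For bounded fields
  the flux term therefore tends to 0 without any condition at \<open>x\<close>.\<close>

lemma cutoff_near_point:
  assumes V: "open V" and x: "x \<notin> V"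
  shows "cutoff_near V N {x}"
proof -
  define m where "m n = real (Suc n)" for n
  have m: "m n > 0" "m n \<ge> 1" for n by (auto simp: m_def)
  \<comment> \<open>The squared distance is differentiable at \<open>x\<close> too. The gradient
    lives where \<open>(m n * norm (y - x))\<^sup>2\<close> is between 1 and 2, inside the disc of
    radius \<open>2 / m n\<close>.\<close>
  define k where "k n y = step ((m n)\<^sup>2 * (norm (y - x))\<^sup>2)" for n and y :: "real^2"
  define G where "G n y = (step' ((m n)\<^sup>2 * (norm (y - x))\<^sup>2) * (m n)\<^sup>2 * 2) *\<^sub>R (y - x)" for n and y :: "real^2"
  have d: "(k n has_derivative (\<lambda>v. G n y \<bullet> v)) (at y)" for n y
  proof -
    have "((\<lambda>y. (m n)\<^sup>2 * ((y - x) \<bullet> (y - x))) has_derivative (\<lambda>v. (m n)\<^sup>2 * (2 * ((y - x) \<bullet> v)))) (at y)"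
      by (auto intro!: derivative_eq_intros simp: inner_commute algebra_simps)
    from has_derivative_compose[OF this step_has_derivative[unfolded has_field_derivative_def]]
    show ?thesis unfolding k_def G_def power2_norm_eq_inner by (simp add: algebra_simps)
  qed
  have Gb: "norm (G n y) \<le> 16 * m n * indicator (ball x (2 / m n)) y" for n y
  proof (cases "m n * norm (y - x) < 2")
    case True
    have "norm (G n y) = step' ((m n)\<^sup>2 * (norm (y - x))\<^sup>2) * (m n * (m n * norm (y - x)) * 2)"
      using step'_bounds(1) by (simp add: G_def abs_mult power2_eq_square)
    also have "\<dots> \<le> 4 * (m n * 2 * 2)"
      using step'_bounds True m[of n] by (intro mult_mono) auto
    finally show ?thesis using True m(1)[of n] by (auto simp: indicator_def field_simps dist_norm norm_minus_commute)
  next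
    case False
    then have "(m n * norm (y - x))\<^sup>2 \<ge> 2\<^sup>2" by (intro power_mono) auto
    then have "step' ((m n)\<^sup>2 * (norm (y - x))\<^sup>2) = 0" by (intro step'_eq_0) (simp add: power_mult_distrib)
    then show ?thesis using m(1)[of n] by (simp add: G_def)
  qed
  then have Gb': "norm (G n y) \<le> 16 * m n" for n y
    by (rule order_trans) (use m(1)[of n] in \<open>auto simp: indicator_def\<close>)
  have [measurable]: "G n \<in> borel_measurable borel" for n
    unfolding G_def by (intro borel_measurable_continuous_onI continuous_intros)
  define c where "c = unit_ball_vol 2"
  have c: "c \<ge> 0" by (simp add: c_def)
  have iG: "(\<integral>\<^sup>+y. ennreal (norm (G n y)) \<partial>lborel) \<le> ennreal (64 * c / m n)" for n
  proof -
    have "(\<integral>\<^sup>+y. ennreal (norm (G n y)) \<partial>lborel) \<le> (\<integral>\<^sup>+y. ennreal (16 * m n) * indicator (ball x (2 / m n)) y \<partial>lborel)"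
    proof (intro nn_integral_mono)
      fix y show "ennreal (norm (G n y)) \<le> ennreal (16 * m n) * indicator (ball x (2 / m n)) y"
        using Gb[of n y] by (cases "y \<in> ball x (2 / m n)") (auto intro: ennreal_leI)
    qed
    also have "\<dots> = ennreal (16 * m n) * ennreal (c * (2 / m n)\<^sup>2)"
      using m(1)[of n] by (simp add: nn_integral_cmult_indicator emeasure_ball c_def)
    also have "\<dots> = ennreal (64 * c / m n)"
      using m(1)[of n] c by (subst ennreal_mult[symmetric]) (auto simp: power2_eq_square field_simps)
    finally show ?thesis .
  qed
  have lim0: "(\<lambda>n. c / m n) \<longlonglongrightarrow> 0" for c
    unfolding m_def divide_inverse by (rule tendsto_mult_right_zero[OF LIMSEQ_inverse_real_of_nat])
  have "cutoff V N k G"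
    unfolding cutoff_def
  proof (intro conjI allI ballI impI)
    fix n y show "0 \<le> k n y" "k n y \<le> 1" by (auto simp: k_def step_bounds)
  next
    fix n
    have "(16 * m n)-lipschitz_on UNIV (k n)"
    proof (rule lipschitz_onI)
      fix y z :: "real^2"
      have "norm (k n y - k n z) \<le> 16 * m n * norm (y - z)"
      proof (rule differentiable_bound[of UNIV])
        fix w show "onorm (\<lambda>v. G n w \<bullet> v) \<le> 16 * m n"
          using Gb'[of n w] by (intro onorm_le order_trans[OF Cauchy_Schwarz_ineq2[folded real_norm_def]] mult_right_mono) auto
      qed (use d in auto)
      then show "dist (k n y) (k n z) \<le> 16 * m n * dist y z" by (simp add: dist_norm)
    qed (use m(1)[of n] in simp)
    then show "\<exists>L. L-lipschitz_on UNIV (k n)" ..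
    show "AE y in lborel. (k n has_derivative (\<lambda>v. G n y \<bullet> v)) (at y)" using d by simp
    show "G n \<in> borel_measurable borel" by measurable
  next
    show "\<exists>C. \<forall>n. (\<integral>\<^sup>+y. ennreal (indicator V y * norm (G n y)) \<partial>lborel) \<le> ennreal C"
    proof (intro exI allI)
      fix n
      have "(\<integral>\<^sup>+y. ennreal (indicator V y * norm (G n y)) \<partial>lborel) \<le> (\<integral>\<^sup>+y. ennreal (norm (G n y)) \<partial>lborel)"
        by (intro nn_integral_mono) (auto simp: indicator_def)
      also note iG[of n]
      also have "ennreal (64 * c / m n) \<le> ennreal (64 * c)"
      proof (rule ennreal_leI)
        have "64 * c * 1 \<le> 64 * c * m n" using m(2)[of n] c by (intro mult_left_mono) auto
        then show "64 * c / m n \<le> 64 * c" using m(1)[of n] by (simp add: pos_divide_le_eq)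
      qed
      finally show "(\<integral>\<^sup>+y. ennreal (indicator V y * norm (G n y)) \<partial>lborel) \<le> ennreal (64 * c)" .
    qed
  next
    fix y assume "y \<in> V"
    then have y: "norm (y - x) > 0" using x by auto
    show "(\<lambda>n. k n y) \<longlonglongrightarrow> 1"
    proof (rule tendsto_eventually)
      have "\<forall>\<^sub>F n in sequentially. 2 / m n < norm (y - x)" using lim0[of 2] y by (rule order_tendstoD)
      then show "\<forall>\<^sub>F n in sequentially. k n y = 1"
      proof eventually_elim
        case (elim n)
        then have "2 \<le> m n * norm (y - x)" using m(1)[of n] by (simp add: field_simps)
        then have "(m n * norm (y - x))\<^sup>2 \<ge> 2\<^sup>2" by (intro power_mono) auto
        then show ?case unfolding k_def by (intro step_eq_1) (simp add: power_mult_distrib)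
      qed
    qed
  next
    fix H assume H: "vanishing_flux V N H"
    then obtain B where B: "\<And>y. y \<in> V \<Longrightarrow> norm (H y) \<le> B" by (auto simp: vanishing_flux_def bounded_iff)
    have le: "(\<integral>\<^sup>+y. ennreal \<bar>(indicator V y *\<^sub>R H y) \<bullet> G n y\<bar> \<partial>lborel) \<le> ennreal (\<bar>B\<bar> * (64 * c) / m n)" for n
    proof -
      have "(\<integral>\<^sup>+y. ennreal \<bar>(indicator V y *\<^sub>R H y) \<bullet> G n y\<bar> \<partial>lborel) \<le> (\<integral>\<^sup>+y. ennreal \<bar>B\<bar> * ennreal (norm (G n y)) \<partial>lborel)"
      proof (intro nn_integral_mono)
        fix y
        have "\<bar>(indicator V y *\<^sub>R H y) \<bullet> G n y\<bar> \<le> norm (indicator V y *\<^sub>R H y) * norm (G n y)" by (rule Cauchy_Schwarz_ineq2) 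
        also have "\<dots> \<le> \<bar>B\<bar> * norm (G n y)" using B[of y] by (intro mult_right_mono) (auto simp: indicator_def)
        finally show "ennreal \<bar>(indicator V y *\<^sub>R H y) \<bullet> G n y\<bar> \<le> ennreal \<bar>B\<bar> * ennreal (norm (G n y))"
          by (simp add: ennreal_mult[symmetric] ennreal_leI)
      qed
      also have "\<dots> = ennreal \<bar>B\<bar> * (\<integral>\<^sup>+y. ennreal (norm (G n y)) \<partial>lborel)" by (rule nn_integral_cmult) measurable
      also have "\<dots> \<le> ennreal \<bar>B\<bar> * ennreal (64 * c / m n)" by (intro mult_left_mono iG) auto
      also have "\<dots> = ennreal (\<bar>B\<bar> * (64 * c) / m n)" using c m(1)[of n] by (subst ennreal_mult[symmetric]) auto
      finally show ?thesis .
    qed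
    have "(\<lambda>n. ennreal (\<bar>B\<bar> * (64 * c) / m n)) \<longlonglongrightarrow> ennreal 0" by (intro tendsto_ennrealI lim0)
    then show "(\<lambda>n. \<integral>\<^sup>+y. ennreal \<bar>(indicator V y *\<^sub>R H y) \<bullet> G n y\<bar> \<partial>lborel) \<longlonglongrightarrow> 0"
      unfolding ennreal_0
      by (rule tendsto_sandwich[OF always_eventually[OF allI[OF zero_le]] always_eventually[OF allI[OF le]] tendsto_const])
  qed
  moreover have "\<exists>Z. open Z \<and> {x} \<subseteq> Z \<and> (\<forall>y\<in>Z. k n y = 0)" for n
  proof (intro exI conjI ballI)
    fix y assume "y \<in> ball x (1 / m n)"
    then have "m n * norm (y - x) \<le> 1" using m(1)[of n] by (simp add: dist_norm norm_minus_commute field_simps)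
    then have "(m n * norm (y - x))\<^sup>2 \<le> 1" using m(1)[of n] by (intro power_le_one) auto
    then show "k n y = 0" unfolding k_def by (intro step_eq_0) (simp add: power_mult_distrib)
  qed (use m(1)[of n] in auto)
  ultimately show ?thesis unfolding cutoff_near_def by blast
qed


subsection \<open>Graph coordinates near a Lipschitz boundary\<close>

lemma orthogonal_transformation_inverseE:
  fixes R :: "'a::euclidean_space \<Rightarrow> 'a"
  assumes "orthogonal_transformation R"
  obtains S :: "'a \<Rightarrow> 'a" where "orthogonal_transformation S" "\<And>v. R (S v) = v" "\<And>v. S (R v) = v" "\<And>u v. S u \<bullet> v = u \<bullet> R v"
proof -
  have bij: "bij R" using assms by (rule orthogonal_transformation_bij)
  have 1: "R (inv R v) = v" "inv R (R v) = v" for v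
    using bij by (simp_all add: bij_def surj_f_inv_f)
  show ?thesis
    by (rule that[of "inv R"]) (use assms 1 orthogonal_transformation_inv[OF assms] in \<open>auto simp: orthogonal_transformation_def, metis\<close>)
qed

text \<open>Checked on open boxes: the preimage under \<open>S\<close> is the image under the
  inverse orthogonal map, and such images keep Lebesgue measure.\<close>

lemma lborel_distr_orthogonal:
  fixes S :: "real^2 \<Rightarrow> real^2"
  assumes "orthogonal_transformation S"
  shows "distr lborel borel S = lborel"
proof (rule lborel_eqI[symmetric])
  obtain R where R: "orthogonal_transformation R" "\<And>v. S (R v) = v" "\<And>v. R (S v) = v"
    using orthogonal_transformation_inverseE[OF assms] by metis
  have [measurable]: "S \<in> borel_measurable borel" "R \<in> borel_measurable borel"
    using assms R(1) by (auto intro!: borel_measurable_continuous_onI linear_continuous_on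
      simp: linear_conv_bounded_linear[symmetric] orthogonal_transformation_linear)
  fix l u :: "real^2" assume lu: "\<And>b. b \<in> Basis \<Longrightarrow> l \<bullet> b \<le> u \<bullet> b"
  have im: "S -` box l u = R ` box l u" using R(2,3) by (auto simp: image_iff) metis
  have m: "R ` box l u \<in> sets borel" unfolding im[symmetric] by (rule measurable_sets_borel[of S borel]) auto
  have lm: "R ` box l u \<in> lmeasurable" by (rule measurable_orthogonal_image) (use R in auto)
  have "emeasure (distr lborel borel S) (box l u) = emeasure lborel (R ` box l u)"
    by (simp add: emeasure_distr im)
  also have "\<dots> = emeasure lebesgue (R ` box l u)" using m by simp
  also have "\<dots> = ennreal (measure lebesgue (R ` box l u))"
    using lm by (simp add: emeasure_eq_measure2)
  also have "measure lebesgue (R ` box l u) = measure lebesgue (box l u)"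
    by (rule measure_orthogonal_image) (use R in auto)
  also have "ennreal \<dots> = emeasure lborel (box l u)"
    using emeasure_eq_measure2[of "box l u" lebesgue] by simp
  finally show "emeasure (distr lborel borel S) (box l u) = (\<Prod>b\<in>Basis. (u - l) \<bullet> b)"
    using lu by (simp add: emeasure_lborel_box_eq)
qed simp

lemma vec2_measurable [measurable]:
  "(\<lambda>z. vector [fst z, snd z] :: real^2) \<in> borel_measurable (borel :: (real \<times> real) measure)"
proof -
  have eq: "vector [a, b] = a *\<^sub>R axis 1 1 + b *\<^sub>R (axis 2 1 :: real^2)" for a b
    by (simp add: vec_eq_iff forall_2 axis_def)
  show ?thesis unfolding eq by (intro borel_measurable_continuous_onI continuous_intros)
qed

lemma lborel_distr_vec2: "distr (lborel :: (real \<times> real) measure) borel (\<lambda>z. vector [fst z, snd z] :: real^2) = lborel"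
proof (rule lborel_eqI[symmetric])
  fix l u :: "real^2" assume lu: "\<And>b. b \<in> Basis \<Longrightarrow> l \<bullet> b \<le> u \<bullet> b"
  have B: "(Basis :: (real^2) set) = {axis 1 1, axis 2 1}"
    by (auto simp: Basis_vec_def) (metis exhaust_2)
  have ne: "axis 1 1 \<noteq> (axis 2 1 :: real^2)" by (simp add: axis_eq_axis)
  have le: "l $ 1 \<le> u $ 1" "l $ 2 \<le> u $ 2" using lu[of "axis 1 1"] lu[of "axis 2 1"] by (auto simp: B inner_axis)
  have "(\<lambda>z. vector [fst z, snd z] :: real^2) -` box l u = box (l$1, l$2) (u$1, u$2)"
    by (auto simp: box_def B inner_axis Basis_prod_def)
  moreover have "emeasure lborel (box (l$1, l$2) (u$1, u$2)) = ennreal ((u$1 - l$1) * (u$2 - l$2))"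
    using le by (subst emeasure_lborel_box) (auto simp: Basis_prod_def)
  ultimately show "emeasure (distr (lborel :: (real \<times> real) measure) borel (\<lambda>z. vector [fst z, snd z] :: real^2)) (box l u)
      = (\<Prod>b\<in>Basis. (u - l) \<bullet> b)"
    by (simp add: emeasure_distr B inner_axis ne)
qed simp

lemma borel_measurable_vector2:
  assumes [measurable]: "f \<in> borel_measurable M" "h \<in> borel_measurable M"
  shows "(\<lambda>z. vector [f z, h z] :: real^2) \<in> borel_measurable M"
proof -
  have [measurable]: "(\<lambda>z. vector [fst z, snd z] :: real^2) \<in> borel_measurable (borel \<Otimes>\<^sub>M borel)"
    using vec2_measurable by (simp add: borel_prod)
  have "(\<lambda>z. (\<lambda>z. vector [fst z, snd z] :: real^2) (f z, h z)) \<in> borel_measurable M" by measurable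
  then show ?thesis by simp
qed

text \<open>Rotate, split the plane by Tonelli, and for a fixed abscissa \<open>t\<close> substitute
  \<open>g t - s / m\<close> for the ordinate. This last step is one-dimensional and affine with
  Jacobian \<open>1 / m\<close>, so measurability of \<open>g\<close> suffices. With
  \<open>m\<close> the inverse width of a layer below the graph, the layer becomes a strip of fixed
  height.\<close>

lemma nn_integral_graph_coordinates:
  fixes F :: "real^2 \<Rightarrow> ennreal"
  assumes [measurable]: "F \<in> borel_measurable borel" and S: "orthogonal_transformation (S :: real^2 \<Rightarrow> real^2)"
    and [measurable]: "g \<in> borel_measurable borel" and m: "m > 0"
  shows "(\<integral>\<^sup>+y. F y \<partial>lborel) =
    (\<integral>\<^sup>+z. ennreal (1 / m) * F (S (vector [fst z, g (fst z) - snd z / m])) \<partial>(lborel \<Otimes>\<^sub>M lborel))"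
proof -
  have [measurable]: "S \<in> borel_measurable borel"
    using S by (auto intro!: borel_measurable_continuous_onI linear_continuous_on
      simp: linear_conv_bounded_linear[symmetric] orthogonal_transformation_linear)
  note [measurable] = borel_measurable_vector2
  have "(\<integral>\<^sup>+y. F y \<partial>lborel) = (\<integral>\<^sup>+y. F y \<partial>distr lborel borel S)"
    using lborel_distr_orthogonal[OF S] by simp
  also have "\<dots> = (\<integral>\<^sup>+y. F (S y) \<partial>lborel)" by (subst nn_integral_distr) auto
  also have "\<dots> = (\<integral>\<^sup>+y. F (S y) \<partial>distr (lborel :: (real \<times> real) measure) borel (\<lambda>z. vector [fst z, snd z]))"
    using lborel_distr_vec2 by simp
  also have "\<dots> = (\<integral>\<^sup>+z. F (S (vector [fst z, snd z])) \<partial>(lborel :: (real \<times> real) measure))"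
    by (subst nn_integral_distr) auto
  also have "\<dots> = (\<integral>\<^sup>+z. F (S (vector [fst z, snd z])) \<partial>(lborel \<Otimes>\<^sub>M lborel))"
    by (simp add: lborel_prod)
  also have "\<dots> = (\<integral>\<^sup>+t. \<integral>\<^sup>+s. F (S (vector [t, s])) \<partial>lborel \<partial>lborel)"
    by (subst lborel.nn_integral_fst[symmetric]) auto
  also have "\<dots> = (\<integral>\<^sup>+t. \<integral>\<^sup>+s. ennreal (1 / m) * F (S (vector [t, g t - s / m])) \<partial>lborel \<partial>lborel)"
  proof (rule nn_integral_cong)
    fix t
    show "(\<integral>\<^sup>+s. F (S (vector [t, s])) \<partial>lborel) = (\<integral>\<^sup>+s. ennreal (1 / m) * F (S (vector [t, g t - s / m])) \<partial>lborel)"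
      using m by (subst nn_integral_real_affine[where c="- (1/m)" and t="g t"]) (auto simp: nn_integral_cmult)
  qed
  also have "\<dots> = (\<integral>\<^sup>+z. ennreal (1 / m) * F (S (vector [fst z, g (fst z) - snd z / m])) \<partial>(lborel \<Otimes>\<^sub>M lborel))"
    by (subst lborel.nn_integral_fst[symmetric]) auto
  finally show ?thesis .
qed

text \<open>The two cone conditions squeeze the graph near \<open>q\<close> between arbitrarily thin
  double cones around the line orthogonal to \<open>\<nu>\<close>, so this line is its tangent. The
  Lipschitz bound excludes a vertical tangent, which is the positivity of the second
  component.\<close>

lemma outer_unit_normal_graph:
  fixes W :: "(real^2) set"
  assumes R: "orthogonal_transformation (R :: real^2 \<Rightarrow> real^2)" and g: "L-lipschitz_on UNIV g" and q: "q \<in> ball p r"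
    and chart: "\<And>y. y \<in> ball p r \<Longrightarrow> y \<in> W \<longleftrightarrow> R y $ 2 < g (R y $ 1)"
    and qg: "R q $ 2 = g (R q $ 1)" and \<nu>: "outer_unit_normal UNIV W q \<nu>"
  shows "R \<nu> $ 2 > 0" and "(g has_real_derivative - (R \<nu> $ 1 / R \<nu> $ 2)) (at (R q $ 1))"
proof -
  obtain S where S: "orthogonal_transformation S" "\<And>v. R (S v) = v" "\<And>v. S (R v) = v" "\<And>u v. S u \<bullet> v = u \<bullet> R v"
    using orthogonal_transformation_inverseE[OF R] by blast
  define t where "t = R q $ 1"
  define n where "n = R \<nu>"
  have nn: "norm n = 1" using \<nu> R by (simp add: n_def outer_unit_normal_def orthogonal_transformation_norm)
  have q_eq: "q = S (vector [t, g t])"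
  proof -
    have "R q = vector [t, g t]" using qg by (simp add: vec_eq_iff forall_2 t_def)
    then show ?thesis using S(3)[of q] by simp
  qed
  have linS: "linear S" using S(1) by (rule orthogonal_transformation_linear)
  \<comment> \<open>Points near \<open>q\<close> in graph coordinates with \<open>q\<close> as
    origin: \<open>PW\<close> expresses membership in \<open>W\<close> by \<open>g\<close>, and
    \<open>Pi\<close> gives the pairing of the offset with the normal.\<close>
  define P where "P a b = S (vector [t + a, g t + b])" for a b
  have Pd: "P a b - q = S (vector [a, b])" for a b
  proof -
    have "vector [t + a, g t + b] - vector [t, g t] = (vector [a, b] :: real^2)" by (simp add: vec_eq_iff forall_2)
    then show ?thesis unfolding P_def q_eq by (simp add: linear_diff[OF linS, symmetric])
  qed
  have Pn: "norm (P a b - q) = norm (vector [a, b] :: real^2)" for a b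
    unfolding Pd using S(1) by (simp add: orthogonal_transformation_norm)
  have vn: "norm (vector [a, b] :: real^2) \<le> \<bar>a\<bar> + \<bar>b\<bar>" for a b
    using norm_le_l1_cart[of "vector [a, b] :: real^2"] by (simp add: sum_2)
  have Pi: "\<nu> \<bullet> (P a b - q) = n $ 1 * a + n $ 2 * b" for a b
    unfolding Pd inner_commute[of \<nu>] S(4) by (simp add: n_def inner_vec_def sum_2)
  define \<rho> where "\<rho> = r - dist p q"
  have \<rho>: "\<rho> > 0" using q by (simp add: \<rho>_def)
  have PW: "P a b \<in> W \<longleftrightarrow> g t + b < g (t + a)" if "\<bar>a\<bar> + \<bar>b\<bar> < \<rho>" for a b
  proof -
    have "dist p (P a b) \<le> dist p q + norm (P a b - q)" by (metis dist_norm dist_triangle norm_minus_commute)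
    then have "P a b \<in> ball p r" using that Pn[of a b] vn[of a b] by (simp add: \<rho>_def)
    from chart[OF this] show ?thesis by (simp add: P_def S(2))
  qed
  have gl: "\<bar>g (t + a) - g t\<bar> \<le> L * \<bar>a\<bar>" for a
    using lipschitz_onD[OF g, of "t + a" t] by (simp add: dist_real_def)
  have L: "L \<ge> 0" using g by (rule lipschitz_on_nonneg)
  \<comment> \<open>Both cone conditions in contraposed form, with the \<open>l^1\<close> norm of
    the offset, which is at least the Euclidean norm.\<close>
  have cone: "\<exists>d>0. d \<le> \<rho> \<and> (\<forall>a b. \<bar>a\<bar> + \<bar>b\<bar> < d \<longrightarrow>
      (P a b \<in> W \<longrightarrow> n $ 1 * a + n $ 2 * b \<le> e * (\<bar>a\<bar> + \<bar>b\<bar>)) \<and>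
      (P a b \<notin> W \<longrightarrow> n $ 1 * a + n $ 2 * b \<ge> - e * (\<bar>a\<bar> + \<bar>b\<bar>)))" if e: "e > 0" for e
  proof -
    obtain d where d: "d > 0" "\<And>y. norm (y - q) < d \<Longrightarrow>
        (\<nu> \<bullet> (y - q) > e * norm (y - q) \<longrightarrow> y \<notin> W) \<and> (\<nu> \<bullet> (y - q) < - e * norm (y - q) \<longrightarrow> y \<in> W)"
      using \<nu> e unfolding outer_unit_normal_def by blast
    show ?thesis
    proof (intro exI[of _ "min d \<rho>"] conjI allI impI)
      fix a b :: real assume ab: "\<bar>a\<bar> + \<bar>b\<bar> < min d \<rho>"
      have nd: "norm (P a b - q) < d" using ab Pn[of a b] vn[of a b] by simp
      have le: "e * norm (P a b - q) \<le> e * (\<bar>a\<bar> + \<bar>b\<bar>)" using e Pn[of a b] vn[of a b] by simp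
      show "n $ 1 * a + n $ 2 * b \<le> e * (\<bar>a\<bar> + \<bar>b\<bar>)" if "P a b \<in> W"
        using d(2)[OF nd] that le unfolding Pi by linarith
      show "n $ 1 * a + n $ 2 * b \<ge> - e * (\<bar>a\<bar> + \<bar>b\<bar>)" if "P a b \<notin> W"
        using d(2)[OF nd] that le unfolding Pi by linarith
    qed (use d(1) \<rho> in auto)
  qed
  \<comment> \<open>The direction \<open>(v, -1)\<close> descends more steeply than the Lipschitz
    slope allows the graph to, so it enters \<open>W\<close>; it cannot point outwards along the
    normal.\<close>
  have dir: "n $ 1 * v \<le> n $ 2" if v: "L * \<bar>v\<bar> < 1" for v
  proof (rule ccontr)
    assume "\<not> n $ 1 * v \<le> n $ 2"
    then have pos: "n $ 1 * v - n $ 2 > 0" by simp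
    define e where "e = (n $ 1 * v - n $ 2) / (2 * (\<bar>v\<bar> + 1))"
    have e: "e > 0" "e * (\<bar>v\<bar> + 1) < n $ 1 * v - n $ 2"
    proof -
      have v1: "\<bar>v\<bar> + 1 > 0" by simp
      show "e > 0" using pos v1 by (simp add: e_def)
      have "e * (\<bar>v\<bar> + 1) = (n $ 1 * v - n $ 2) / 2" using v1 by (simp add: e_def divide_simps)
      then show "e * (\<bar>v\<bar> + 1) < n $ 1 * v - n $ 2" using pos by simp
    qed
    obtain d where d: "d > 0" "d \<le> \<rho>" "\<And>a b. \<bar>a\<bar> + \<bar>b\<bar> < d \<Longrightarrow> P a b \<in> W \<Longrightarrow> n $ 1 * a + n $ 2 * b \<le> e * (\<bar>a\<bar> + \<bar>b\<bar>)"
      using cone[OF e(1)] by blast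
    define s where "s = d / (2 * (\<bar>v\<bar> + 1))"
    have s: "s > 0" "s * (\<bar>v\<bar> + 1) < d"
    proof -
      have v1: "\<bar>v\<bar> + 1 > 0" by simp
      show "s > 0" using d(1) v1 by (simp add: s_def)
      have "s * (\<bar>v\<bar> + 1) = d / 2" using v1 by (simp add: s_def divide_simps)
      then show "s * (\<bar>v\<bar> + 1) < d" using d(1) by simp
    qed
    have abs: "\<bar>s * v\<bar> + \<bar>- s\<bar> = s * (\<bar>v\<bar> + 1)" using s(1) by (simp add: abs_mult algebra_simps)
    have "L * \<bar>s * v\<bar> < s" using v s(1) by (simp add: abs_mult)
    then have "P (s * v) (- s) \<in> W" using PW[of "s * v" "-s"] abs s d gl[of "s * v"] by linarith
    then have "n $ 1 * (s * v) + n $ 2 * (- s) \<le> e * (s * (\<bar>v\<bar> + 1))" using d(3)[of "s * v" "-s"] abs s by metis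
    then have "s * (n $ 1 * v - n $ 2) \<le> s * (e * (\<bar>v\<bar> + 1))" by (simp add: algebra_simps)
    then show False using s(1) e(2) by simp
  qed
  have n2: "n $ 2 > 0"
  proof (rule ccontr)
    assume neg: "\<not> n $ 2 > 0"
    \<comment> \<open>Using both signs of \<open>v\<close> gives
      \<open>\<bar>n $ 1\<bar> * v \<le> n $ 2\<close>, so \<open>n $ 2 \<le> 0\<close> would force
      \<open>n = 0\<close>.\<close>
    define v where "v = 1 / (L + 1)"
    have v: "v > 0" "L * \<bar>v\<bar> < 1" "L * \<bar>- v\<bar> < 1" using L by (auto simp: v_def field_simps)
    have "n $ 1 * v \<le> n $ 2" "- (n $ 1 * v) \<le> n $ 2" using dir[OF v(2)] dir[OF v(3)] by auto
    then have "n $ 2 = 0" "n $ 1 * v = 0" using neg by linarith+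
    then have "n = 0" using v(1) by (simp add: vec_eq_iff forall_2)
    then show False using nn by simp
  qed
  then show "R \<nu> $ 2 > 0" by (simp add: n_def)
  have "((\<lambda>h. (g (t + h) - g t) / h) \<longlongrightarrow> - (n $ 1 / n $ 2)) (at 0)"
  proof (rule LIM_I)
    fix c :: real assume c: "c > 0"
    \<comment> \<open>The offset of a graph point satisfies
      \<open>\<bar>h\<bar> + \<bar>b\<bar> \<le> (1 + L) * \<bar>h\<bar>\<close>; this
      \<open>e\<close> makes the cone error less than \<open>c\<close> after division by
      \<open>n $ 2 * h\<close>.\<close>
    define e where "e = c * n $ 2 / (2 * (1 + L))"
    have e: "e > 0" "e * (1 + L) < c * n $ 2"
    proof -
      show "e > 0" using c n2 L by (simp add: e_def)
      have "e * (1 + L) = c * n $ 2 / 2" using L by (simp add: e_def divide_simps)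
      moreover have "c * n $ 2 > 0" using c n2 by simp
      ultimately show "e * (1 + L) < c * n $ 2" by linarith
    qed
    obtain d where d: "d > 0" "d \<le> \<rho>"
        "\<And>a b. \<bar>a\<bar> + \<bar>b\<bar> < d \<Longrightarrow> P a b \<in> W \<Longrightarrow> n $ 1 * a + n $ 2 * b \<le> e * (\<bar>a\<bar> + \<bar>b\<bar>)"
        "\<And>a b. \<bar>a\<bar> + \<bar>b\<bar> < d \<Longrightarrow> P a b \<notin> W \<Longrightarrow> n $ 1 * a + n $ 2 * b \<ge> - e * (\<bar>a\<bar> + \<bar>b\<bar>)"
      using cone[OF e(1)] by blast
    show "\<exists>s>0. \<forall>h. h \<noteq> 0 \<and> norm (h - 0) < s \<longrightarrow> norm ((g (t + h) - g t) / h - - (n $ 1 / n $ 2)) < c"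
    proof (intro exI[of _ "d / (1 + L)"] conjI allI impI)
      fix h :: real assume h: "h \<noteq> 0 \<and> norm (h - 0) < d / (1 + L)"
      define b where "b = g (t + h) - g t"
      have "\<bar>h\<bar> + \<bar>b\<bar> \<le> (1 + L) * \<bar>h\<bar>" using gl[of h] by (simp add: b_def algebra_simps)
      moreover have "(1 + L) * \<bar>h\<bar> < d" using h L by (simp add: field_simps)
      ultimately have hb: "\<bar>h\<bar> + \<bar>b\<bar> < d" "\<bar>h\<bar> + \<bar>b\<bar> \<le> (1 + L) * \<bar>h\<bar>" by auto
      have "P h b \<notin> W" using PW[of h b] hb d by (simp add: b_def)
      then have lo: "n $ 1 * h + n $ 2 * b \<ge> - e * (\<bar>h\<bar> + \<bar>b\<bar>)" using d(4) hb by blast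
      \<comment> \<open>The graph point itself is not in \<open>W\<close>, so the upper bound is
        obtained as a limit of points slightly below the graph.\<close>
      have hi: "n $ 1 * h + n $ 2 * b \<le> e * (\<bar>h\<bar> + \<bar>b\<bar>)"
      proof (rule tendsto_le[of "at_right 0"])
        show "((\<lambda>s. n $ 1 * h + n $ 2 * (b - s)) \<longlongrightarrow> n $ 1 * h + n $ 2 * b) (at_right 0)"
          "((\<lambda>s. e * (\<bar>h\<bar> + \<bar>b - s\<bar>)) \<longlongrightarrow> e * (\<bar>h\<bar> + \<bar>b\<bar>)) (at_right 0)"
          by (auto intro!: tendsto_eq_intros)
        show "\<forall>\<^sub>F s in at_right 0. n $ 1 * h + n $ 2 * (b - s) \<le> e * (\<bar>h\<bar> + \<bar>b - s\<bar>)"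
          unfolding eventually_at_right_field
        proof (intro exI[of _ "d - (\<bar>h\<bar> + \<bar>b\<bar>)"] conjI allI impI)
          fix s assume s: "0 < s" "s < d - (\<bar>h\<bar> + \<bar>b\<bar>)"
          then have "\<bar>h\<bar> + \<bar>b - s\<bar> < d" by linarith
          moreover from this have "P h (b - s) \<in> W" using PW[of h "b - s"] d(2) s by (simp add: b_def)
          ultimately show "n $ 1 * h + n $ 2 * (b - s) \<le> e * (\<bar>h\<bar> + \<bar>b - s\<bar>)" using d(3) by blast
        qed (use hb in auto)
      qed simp
      have "\<bar>n $ 1 * h + n $ 2 * b\<bar> \<le> e * (\<bar>h\<bar> + \<bar>b\<bar>)" using lo hi by (simp add: abs_le_iff)
      also have "\<dots> \<le> e * ((1 + L) * \<bar>h\<bar>)" using hb e by simp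
      also have "\<dots> < c * n $ 2 * \<bar>h\<bar>" using e(2) h by (simp add: mult.assoc[symmetric])
      finally have "\<bar>n $ 1 * h + n $ 2 * b\<bar> < c * n $ 2 * \<bar>h\<bar>" .
      moreover have "b / h - - (n $ 1 / n $ 2) = (n $ 1 * h + n $ 2 * b) / (n $ 2 * h)"
        using h n2 by (simp add: field_simps)
      ultimately show "norm ((g (t + h) - g t) / h - - (n $ 1 / n $ 2)) < c"
        using h n2 by (simp add: b_def[symmetric] abs_mult divide_less_eq mult.assoc)
    qed (use d L in auto)
  qed
  then show "(g has_real_derivative - (R \<nu> $ 1 / R \<nu> $ 2)) (at (R q $ 1))"
    by (simp add: DERIV_def n_def t_def)
qed

text \<open>Points vertically below \<open>q\<close> lie in \<open>W\<close> and converge to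
  \<open>q\<close>, while \<open>q\<close> itself is outside.\<close>

lemma frontier_graph:
  fixes W :: "(real^2) set"
  assumes W: "open W" and R: "orthogonal_transformation (R :: real^2 \<Rightarrow> real^2)" and q: "q \<in> ball p r"
    and chart: "\<And>y. y \<in> ball p r \<Longrightarrow> y \<in> W \<longleftrightarrow> R y $ 2 < g (R y $ 1)"
    and qg: "R q $ 2 = g (R q $ 1)"
  shows "q \<in> frontier W"
proof -
  obtain S :: "real^2 \<Rightarrow> real^2" where S: "orthogonal_transformation S" "\<And>v. R (S v) = v" "\<And>v. S (R v) = v"
      "\<And>u v. S u \<bullet> v = u \<bullet> R v"
    using orthogonal_transformation_inverseE[OF R] by blast
  have linR: "linear R" using R by (rule orthogonal_transformation_linear)
  define f where "f i = q - (1 / real (Suc i)) *\<^sub>R S (axis 2 1)" for i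
  have lim: "f \<longlonglongrightarrow> q"
  proof -
    have "(\<lambda>i. q - inverse (real (Suc i)) *\<^sub>R S (axis 2 1)) \<longlonglongrightarrow> q - 0 *\<^sub>R S (axis 2 1)"
      by (intro tendsto_intros LIMSEQ_inverse_real_of_nat)
    then show ?thesis by (simp add: f_def[abs_def] inverse_eq_divide)
  qed
  have Rf: "R (f i) = R q - (1 / real (Suc i)) *\<^sub>R axis 2 1" for i
    unfolding f_def by (simp add: linear_diff[OF linR] linear_cmul[OF linR] S(2))
  have "\<forall>\<^sub>F i in sequentially. f i \<in> ball p r"
    using lim q by (intro topological_tendstoD) auto
  then have "\<forall>\<^sub>F i in sequentially. f i \<in> W"
  proof eventually_elim
    case (elim i)
    then show ?case by (subst chart[OF elim]) (simp add: Rf qg axis_def)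
  qed
  then have "q \<in> closure W"
    by (intro Lim_in_closed_set[OF closed_closure _ _ lim]) (auto elim: eventually_mono intro: closure_subset[THEN subsetD])
  moreover have "q \<notin> W" using chart[OF q] qg by simp
  ultimately show ?thesis using W by (simp add: frontier_def interior_open)
qed

lemma AE_lborel_fst:
  assumes "AE x in (lborel :: 'a::euclidean_space measure). P x"
  shows "AE z in lborel \<Otimes>\<^sub>M (lborel :: 'b::euclidean_space measure). P (fst z)"
proof -
  obtain Z where Z: "{x \<in> space lborel. \<not> P x} \<subseteq> Z" "Z \<in> null_sets lborel"
    using assms by (auto simp: eventually_ae_filter)
  then have "emeasure (lborel \<Otimes>\<^sub>M lborel) (Z \<times> (UNIV :: 'b set)) = emeasure lborel Z * emeasure lborel (UNIV :: 'b set)"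
    by (intro lborel.emeasure_pair_measure_Times) (auto simp: null_sets_def)
  then have "Z \<times> (UNIV :: 'b set) \<in> null_sets (lborel \<Otimes>\<^sub>M lborel)"
    using Z(2) by (auto simp: null_sets_def)
  then show ?thesis by (rule AE_I') (use Z(1) in auto)
qed

lemma AE_lborel_snd:
  assumes "AE x in (lborel :: 'b::euclidean_space measure). P x"
  shows "AE z in (lborel :: 'a::euclidean_space measure) \<Otimes>\<^sub>M lborel. P (snd z)"
proof -
  obtain Z where Z: "{x \<in> space lborel. \<not> P x} \<subseteq> Z" "Z \<in> null_sets lborel"
    using assms by (auto simp: eventually_ae_filter)
  then have "emeasure (lborel \<Otimes>\<^sub>M lborel) ((UNIV :: 'a set) \<times> Z) = emeasure lborel (UNIV :: 'a set) * emeasure lborel Z"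
    by (intro lborel.emeasure_pair_measure_Times) (auto simp: null_sets_def)
  then have "(UNIV :: 'a set) \<times> Z \<in> null_sets (lborel \<Otimes>\<^sub>M lborel)"
    using Z(2) by (auto simp: null_sets_def)
  then show ?thesis by (rule AE_I') (use Z(1) in auto)
qed

text \<open>The exceptional set is a countable union of parallel lines; rotating it gives the
  product of a countable set with a line. The graph coordinates are used with \<open>g = 0\<close>
  and \<open>m = 1\<close>.\<close>

lemma AE_first_coordinate_notin_countable:
  fixes R :: "real^2 \<Rightarrow> real^2"
  assumes R: "orthogonal_transformation R" and T0: "countable T0"
  shows "AE y in lborel. R y $ 1 \<notin> T0"
proof -
  obtain S :: "real^2 \<Rightarrow> real^2" where S: "orthogonal_transformation S" "\<And>v. R (S v) = v" "\<And>v. S (R v) = v"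
      "\<And>u v. S u \<bullet> v = u \<bullet> R v"
    using orthogonal_transformation_inverseE[OF R] by blast
  have T0m: "T0 \<in> sets borel" using T0 by (rule sets.countable[rotated]) simp
  have "continuous_on UNIV R"
    using R by (auto intro!: linear_continuous_on simp: linear_conv_bounded_linear[symmetric] orthogonal_transformation_linear)
  then have R1: "(\<lambda>y. R y $ 1) \<in> borel_measurable borel"
    by (intro borel_measurable_continuous_onI continuous_intros)
  have im: "(\<lambda>y. indicator T0 (R y $ 1) :: ennreal) \<in> borel_measurable borel"
    by (rule measurable_compose[OF R1 borel_measurable_indicator[OF T0m]])
  have "(\<integral>\<^sup>+y. indicator T0 (R y $ 1) \<partial>lborel) =
     (\<integral>\<^sup>+z. ennreal (1 / 1) * indicator T0 (R (S (vector [fst z, 0 - snd z / 1])) $ 1) \<partial>(lborel \<Otimes>\<^sub>M lborel))"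
    by (rule nn_integral_graph_coordinates[OF im S(1)]) simp_all
  also have "\<dots> = (\<integral>\<^sup>+z. indicator (T0 \<times> (UNIV :: real set)) z \<partial>(lborel \<Otimes>\<^sub>M lborel))"
    by (intro nn_integral_cong) (auto simp: S(2) indicator_def)
  also have "\<dots> = emeasure (lborel \<Otimes>\<^sub>M lborel) (T0 \<times> (UNIV :: real set))"
    using T0m by (intro nn_integral_indicator pair_measureI) simp_all
  also have "\<dots> = emeasure lborel T0 * emeasure lborel (UNIV :: real set)"
    using T0m by (intro lborel.emeasure_pair_measure_Times) simp_all
  also have "\<dots> = 0"
    using countable_imp_null_set_lborel[OF T0] by (simp add: null_sets_def)
  finally have "AE y in lborel. (indicator T0 (R y $ 1) :: ennreal) = 0"
    using im by (subst (asm) nn_integral_0_iff_AE) simp_all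
  then show ?thesis by (rule eventually_mono) (auto simp: indicator_def split: if_splits)
qed

text \<open>With \<open>d\<close> the vertical depth below the graph, \<open>k n\<close> is 0 for
  \<open>m n * d < 1\<close> close to \<open>p\<close>, and 1 at depth at least
  \<open>2 / m n\<close> or away from \<open>p\<close>. Its gradient has a bounded part, which
  inside \<open>W\<close> survives only in the shrinking layer, and a part of size
  \<open>m n\<close> along the gradient of \<open>d\<close>. In layer coordinates the factor
  \<open>m n\<close> is cancelled by the Jacobian; at a regular boundary point the gradient of
  \<open>d\<close> is a multiple of the normal, so the flux condition makes the second part vanish
  in the limit.\<close>

lemma cutoff_near_chart:
  fixes W X V :: "(real^2) set" and R :: "real^2 \<Rightarrow> real^2"
  assumes W: "open W" "bounded W" and X: "countable X" and V: "V = W - X" "open V"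
    and N: "N = (\<lambda>q \<nu>. q \<in> frontier W - X \<and> outer_unit_normal UNIV W q \<nu>)"
    and R: "orthogonal_transformation R" and g: "L-lipschitz_on UNIV g" and r: "r > 0"
    and chart: "\<And>y. y \<in> ball p r \<Longrightarrow> y \<in> W \<longleftrightarrow> R y $ 2 < g (R y $ 1)"
    and cn: "countable {q \<in> frontier W. \<nexists>\<nu>. outer_unit_normal UNIV W q \<nu>}"
  shows "cutoff_near V N (frontier W \<inter> ball p (r/2))"
proof -
  obtain S :: "real^2 \<Rightarrow> real^2" where S: "orthogonal_transformation S" "\<And>v. R (S v) = v" "\<And>v. S (R v) = v"
      "\<And>u v. S u \<bullet> v = u \<bullet> R v"
    using orthogonal_transformation_inverseE[OF R] by blast
  have linR: "linear R" and linS: "linear S" using R S(1) by (auto intro: orthogonal_transformation_linear)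
  have contR: "continuous_on UNIV R" and contS: "continuous_on UNIV S"
    using linR linS by (auto intro!: linear_continuous_on simp: linear_conv_bounded_linear[symmetric])
  have normS: "norm (S v) = norm v" and normR: "norm (R v) = norm v" for v
    using R S(1) by (auto simp: orthogonal_transformation_norm)
  have L: "L \<ge> 0" using g by (rule lipschitz_on_nonneg)
  have contg: "continuous_on A g" for A
    using lipschitz_on_continuous_on[OF g] continuous_on_subset by blast
  have [measurable]: "R \<in> borel_measurable borel" "S \<in> borel_measurable borel" and gm[measurable]: "g \<in> borel_measurable borel"
    using contR contS contg by (auto intro: borel_measurable_continuous_onI)
  have gl: "\<bar>g s - g t\<bar> \<le> L * \<bar>s - t\<bar>" for s t
    using lipschitz_onD[OF g, of s t] by (simp add: dist_real_def)
  have vn: "norm (vector [a, b] :: real^2) \<le> \<bar>a\<bar> + \<bar>b\<bar>" for a b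
    using norm_le_l1_cart[of "vector [a, b] :: real^2"] by (simp add: sum_2)
  text \<open>The offset \<open>8 / r\<close> makes the layer \<open>1 \<le> m n * d y \<le> 2\<close> so thin that the graph points above it
    stay in the chart.\<close>
  define m where "m n = 8 / r + real n" for n
  have m: "m n > 0" "2 / m n \<le> r / 4" for n
  proof -
    show m0: "m n > 0" using r by (simp add: m_def add_pos_nonneg)
    have "r * m n = 8 + r * real n" using r by (simp add: m_def distrib_left)
    moreover have "r * real n \<ge> 0" using r by simp
    ultimately show "2 / m n \<le> r / 4" using m0 by (simp add: pos_divide_le_eq)
  qed
  have mlim: "(\<lambda>n. c / m n) \<longlonglongrightarrow> 0" for c
    unfolding m_def
    by (intro tendsto_divide_0[OF tendsto_const] filterlim_at_top_imp_at_infinity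
        filterlim_tendsto_add_at_top[OF tendsto_const filterlim_real_sequentially])
  define d where "d y = g (R y $ 1) - R y $ 2" for y
  have contd: "continuous_on A d" for A
    unfolding d_def by (intro continuous_intros continuous_on_compose2[OF contg[of UNIV]] continuous_on_subset[OF contR]) auto
  \<comment> \<open>With this scale \<open>c\<close> passes from 0 to 1 between the radii
    \<open>r / 2\<close> and \<open>r / sqrt 2\<close>, and the latter is less than
    \<open>3 / 4 * r\<close>.\<close>
  define A where "A = 4 / r\<^sup>2"
  have A: "A > 0" "A * r = 4 / r" using r by (simp_all add: A_def power2_eq_square)
  define c where "c y = step ((norm (y - p))\<^sup>2 * A)" for y
  define c' where "c' y = (step' ((norm (y - p))\<^sup>2 * A) * A * 2) *\<^sub>R (y - p)" for y
  text \<open>\<open>gd\<close> is \<open>g'\<close>, kept measurable and bounded where \<open>g\<close> is not differentiable.\<close>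
  define gd where "gd t = max (- L) (min L (lim (\<lambda>i. (g (t + 1 / real (Suc i)) - g t) * real (Suc i))))" for t
  \<comment> \<open>Where \<open>g\<close> is differentiable this is the gradient of
    \<open>d\<close>, by the adjointness \<open>S u \<bullet> v = u \<bullet> R v\<close>. It points
    into \<open>W\<close>, opposite to the outer normal.\<close>
  define nd where "nd t = S (vector [gd t, -1])" for t
  define J where "J n y = (1 - c y) * step' (m n * d y) * m n" for n y
  define k where "k n y = 1 - (1 - c y) * (1 - step (m n * d y))" for n y
  define G where "G n y = (1 - step (m n * d y)) *\<^sub>R c' y + J n y *\<^sub>R nd (R y $ 1)" for n y
  \<comment> \<open>Abscissas of boundary points without a normal and of points of \<open>X\<close>.
    Over every other abscissa, a graph point in the chart has a normal and carries the flux
    condition.\<close>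
  define T0 where "T0 = (\<lambda>q. R q $ 1) ` ({q \<in> frontier W. \<nexists>\<nu>. outer_unit_normal UNIV W q \<nu>} \<union> X)"
  define P where "P t = S (vector [t, g t])" for t

  have T0: "countable T0" unfolding T0_def using cn X by auto
  have cb: "0 \<le> c y" "c y \<le> 1" for y by (auto simp: c_def step_bounds)
  have J0: "J n y \<ge> 0" for n y unfolding J_def using cb[of y] step'_bounds(1) m(1)[of n] by (auto intro!: mult_nonneg_nonneg)
  have gdL: "\<bar>gd t\<bar> \<le> L" for t unfolding gd_def using L by auto
  have nd: "norm (nd t) \<le> L + 1" for t
    unfolding nd_def normS using vn[of "gd t" "-1"] gdL[of t] by simp
  \<comment> \<open>Difference quotients of an \<open>L\<close>-Lipschitz function are bounded by
    \<open>L\<close>, so the truncation in \<open>gd\<close> does not change a genuine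
    derivative.\<close>
  have gd: "gd t = D" if D: "(g has_real_derivative D) (at t)" for t D
  proof -
    have q: "((\<lambda>h. (g (t + h) - g t) / h) \<longlongrightarrow> D) (at 0)" using D by (simp add: DERIV_def)
    have f0: "filterlim (\<lambda>i. 1 / real (Suc i)) (at 0) sequentially"
      using LIMSEQ_inverse_real_of_nat by (auto simp: filterlim_at divide_inverse)
    from filterlim_compose[OF q f0] have lim: "(\<lambda>i. (g (t + 1 / real (Suc i)) - g t) * real (Suc i)) \<longlonglongrightarrow> D" by simp
    have "\<bar>(g (t + 1 / real (Suc i)) - g t) * real (Suc i)\<bar> \<le> L" for i
    proof -
      have "\<bar>g (t + 1 / real (Suc i)) - g t\<bar> * real (Suc i) \<le> (L * \<bar>t + 1 / real (Suc i) - t\<bar>) * real (Suc i)"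
        by (intro mult_right_mono gl) simp
      also have "\<dots> = L" by (simp add: divide_simps)
      finally show ?thesis by (simp add: abs_mult)
    qed
    then have "\<bar>D\<bar> \<le> L"
      by (intro tendsto_upperbound[OF tendsto_rabs[OF lim]] always_eventually) simp_all
    then show ?thesis using limI[OF lim] by (simp add: gd_def)
  qed
  have near: "norm (y - p) < 3 / 4 * r" if "(norm (y - p))\<^sup>2 * A \<le> 2" for y
  proof (rule power2_less_imp_less)
    have "(norm (y - p))\<^sup>2 \<le> r\<^sup>2 / 2" using that r by (simp add: A_def field_simps)
    also have "\<dots> < (3 / 4 * r)\<^sup>2" using r by (simp add: power_mult_distrib power_divide)
    finally show "(norm (y - p))\<^sup>2 < (3 / 4 * r)\<^sup>2" .
  qed (use r in simp)
  have far: "1 - c y = 0 \<and> c' y = 0" if "norm (y - p) \<ge> 3 / 4 * r" for y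
  proof -
    have "2 \<le> (norm (y - p))\<^sup>2 * A" using near[of y] that by linarith
    then show ?thesis by (simp add: c_def c'_def step_eq_1 step'_eq_0)
  qed
  have c'b: "norm (c' y) \<le> 32 / r" for y
  proof (cases "norm (y - p) \<ge> 3 / 4 * r")
    case False
    then have ny: "norm (y - p) \<le> r" using r by linarith
    have "norm (c' y) = step' ((norm (y - p))\<^sup>2 * A) * (A * 2 * norm (y - p))"
      using step'_bounds(1)[of "(norm (y - p))\<^sup>2 * A"] A(1) by (simp add: c'_def abs_mult)
    also have "\<dots> \<le> 4 * (A * 2 * r)"
      by (rule mult_mono[OF step'_bounds(2) mult_left_mono[OF ny]]) (use A(1) in simp_all)
    also have "\<dots> = 32 / r" using A(2) by simp
    finally show ?thesis .
  next
    case True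
    then show ?thesis using far[OF True] r by simp
  qed
  have dc: "(c has_derivative (\<lambda>v. c' y \<bullet> v)) (at y)" for y
  proof -
    have "((\<lambda>y. ((y - p) \<bullet> (y - p)) * A) has_derivative (\<lambda>v. 2 * ((y - p) \<bullet> v) * A)) (at y)"
      by (auto intro!: derivative_eq_intros simp: inner_commute algebra_simps)
    from has_derivative_compose[OF this step_has_derivative[unfolded has_field_derivative_def]]
    show ?thesis unfolding c_def c'_def power2_norm_eq_inner by (simp add: algebra_simps)
  qed
  have contc: "continuous_on A c" and contc': "continuous_on A c'" for A
    unfolding c_def c'_def by (intro continuous_intros)+
  have [measurable]: "c \<in> borel_measurable borel" "c' \<in> borel_measurable borel" "d \<in> borel_measurable borel"
    using contc contc' contd by (auto intro: borel_measurable_continuous_onI)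
  have [measurable]: "gd \<in> borel_measurable borel" unfolding gd_def by measurable
  have ndm[measurable]: "nd \<in> borel_measurable borel"
  proof -
    have "(\<lambda>t. vector [gd t, -1] :: real^2) \<in> borel_measurable borel" by (rule borel_measurable_vector2) measurable
    then show ?thesis unfolding nd_def by measurable
  qed
  have R1[measurable]: "(\<lambda>y. R y $ 1) \<in> borel_measurable borel"
    by (intro borel_measurable_continuous_onI continuous_intros contR)
  have [measurable]: "G n \<in> borel_measurable borel" "J n \<in> borel_measurable borel" for n
    unfolding G_def J_def by measurable
  have Vm[measurable]: "V \<in> sets borel" using V by simp
  have bV: "bounded V" using W(2) V(1) by (auto intro: bounded_subset)

  \<comment> \<open>Regular boundary points and differentiability of the cutoff\<close>
  have RP: "R (P t) $ 1 = t" "R (P t) $ 2 = g t" for t by (simp_all add: P_def S(2))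
  have regular: "\<exists>\<nu>. outer_unit_normal UNIV W (P t) \<nu> \<and> P t \<notin> X \<and> P t \<in> frontier W"
    if t: "t \<notin> T0" and P: "P t \<in> ball p r" for t
  proof -
    have fr: "P t \<in> frontier W" using frontier_graph[OF W(1) R P chart] RP by simp
    have "t \<in> T0" if "P t \<in> {q \<in> frontier W. \<nexists>\<nu>. outer_unit_normal UNIV W q \<nu>} \<union> X"
      unfolding T0_def using that RP(1)[of t] by (metis (no_types, lifting) image_eqI)
    then show ?thesis using t fr by blast
  qed
  have dd: "(d has_derivative (\<lambda>v. nd (R y $ 1) \<bullet> v)) (at y)" if "(g has_real_derivative D) (at (R y $ 1))" for y D
  proof -
    have dR: "(R has_derivative R) (at y)" using linR by (simp add: linear_imp_has_derivative)
    have d1: "((\<lambda>y. R y $ i) has_derivative (\<lambda>v. R v $ i)) (at y)" for i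
      by (rule bounded_linear.has_derivative[OF bounded_linear_vec_nth dR])
    have "(d has_derivative (\<lambda>v. D * (R v $ 1) - R v $ 2)) (at y)"
      unfolding d_def[abs_def]
      using has_derivative_compose[OF d1[of 1] that[unfolded has_field_derivative_def]]
      by (intro has_derivative_diff d1) 
    then show ?thesis
      unfolding nd_def S(4) gd[OF that] by (simp add: inner_vec_def sum_2)
  qed
  have AEd: "AE y in lborel. R y $ 1 \<notin> T0"
    using AE_first_coordinate_notin_countable[OF R T0] .
  \<comment> \<open>Outside the layer \<open>step\<close> is locally constant. Inside it the depth
    is at most \<open>r / 4\<close> and \<open>y\<close> is within \<open>3 / 4 * r\<close> of
    \<open>p\<close>, so the graph point above \<open>y\<close> lies in the chart, has a normal, and
    \<open>g\<close> is differentiable at its abscissa.\<close>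
  have d_step: "((\<lambda>y. step (m n * d y)) has_derivative (\<lambda>v. (step' (m n * d y) * m n) * (nd (R y $ 1) \<bullet> v))) (at y)"
    if t: "R y $ 1 \<notin> T0" and y: "(norm (y - p))\<^sup>2 * A \<le> 2" for n y
  proof -
    consider "m n * d y < 1" | "m n * d y > 2" | "1 \<le> m n * d y" "m n * d y \<le> 2" by linarith
    then show ?thesis
    proof cases
      case 1
      have o: "open {y. m n * d y < 1}" using contd by (intro open_Collect_less continuous_intros)
      have "((\<lambda>y. 0) has_derivative (\<lambda>v. (step' (m n * d y) * m n) * (nd (R y $ 1) \<bullet> v))) (at y)"
        using 1 by (simp add: step'_eq_0)
      then show ?thesis
        by (rule has_derivative_transform_within_open[OF _ o]) (use 1 in \<open>auto simp: step_eq_0\<close>)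
    next
      case 2
      have o: "open {y. 2 < m n * d y}" using contd by (intro open_Collect_less continuous_intros)
      have "((\<lambda>y. 1) has_derivative (\<lambda>v. (step' (m n * d y) * m n) * (nd (R y $ 1) \<bullet> v))) (at y)"
        using 2 by (simp add: step'_eq_0)
      then show ?thesis
        by (rule has_derivative_transform_within_open[OF _ o]) (use 2 in \<open>auto simp: step_eq_1\<close>)
    next
      case 3
      define t where "t = R y $ 1"
      have dy: "0 \<le> d y" "d y \<le> r / 4"
        using 3 m[of n] by (smt (verit) mult_neg_pos mult.commute, metis (no_types, opaque_lifting) mult.commute order_trans pos_le_divide_eq)
      have "P t - y = S (vector [t, g t] - R y)" unfolding P_def linear_diff[OF linS] S(3) ..
      also have "vector [t, g t] - R y = vector [0, d y]" by (simp add: vec_eq_iff forall_2 t_def d_def)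
      finally have "norm (P t - y) \<le> r / 4" using vn[of 0 "d y"] dy by (simp add: normS)
      then have "P t \<in> ball p r" using near[OF y] norm_triangle_ineq[of "P t - y" "y - p"]
        by (simp add: dist_norm norm_minus_commute)
      then obtain \<nu> where \<nu>: "outer_unit_normal UNIV W (P t) \<nu>" using regular[OF t[folded t_def]] by blast
      note D = outer_unit_normal_graph(2)[OF R g \<open>P t \<in> ball p r\<close> chart _ \<nu>]
      have "(g has_real_derivative - (R \<nu> $ 1 / R \<nu> $ 2)) (at t)" using D RP by simp
      from dd[OF this[unfolded t_def]]
      have "((\<lambda>y. m n * d y) has_derivative (\<lambda>v. m n * (nd (R y $ 1) \<bullet> v))) (at y)"
        by (rule has_derivative_mult_right)
      from has_derivative_compose[OF this step_has_derivative[unfolded has_field_derivative_def]]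
      show ?thesis by (simp add: mult.assoc)
    qed
  qed
  \<comment> \<open>Beyond the reach of \<open>d_step\<close> the function \<open>c\<close> is
    locally 1, so \<open>k n\<close> is locally constant.\<close>
  have dk: "(k n has_derivative (\<lambda>v. G n y \<bullet> v)) (at y)" if t: "R y $ 1 \<notin> T0" for n y
  proof (cases "(norm (y - p))\<^sup>2 * A \<le> 2")
    case True
    have 1: "((\<lambda>y. 1 - c y) has_derivative (\<lambda>v. 0 - c' y \<bullet> v)) (at y)"
      by (intro has_derivative_diff has_derivative_const dc)
    have 2: "((\<lambda>y. 1 - step (m n * d y)) has_derivative
        (\<lambda>v. 0 - (step' (m n * d y) * m n) * (nd (R y $ 1) \<bullet> v))) (at y)"
      by (intro has_derivative_diff has_derivative_const d_step[OF t True])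
    have "(k n has_derivative (\<lambda>v. 0 - ((1 - c y) * (0 - (step' (m n * d y) * m n) * (nd (R y $ 1) \<bullet> v))
        + (0 - c' y \<bullet> v) * (1 - step (m n * d y))))) (at y)"
      unfolding k_def[abs_def] by (intro has_derivative_diff has_derivative_const has_derivative_mult 1 2)
    then show ?thesis
      by (rule has_derivative_eq_rhs) (simp add: fun_eq_iff G_def J_def inner_add_left algebra_simps)
  next
    case False
    have o: "open {y. 2 < (norm (y - p))\<^sup>2 * A}" by (intro open_Collect_less continuous_intros)
    have "c' y = 0" "c y = 1" using False by (auto simp: c'_def c_def step_eq_1 step'_eq_0)
    then have "((\<lambda>y. 1) has_derivative (\<lambda>v. G n y \<bullet> v)) (at y)"
      by (simp add: G_def J_def inner_zero_left[abs_def])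
    then show ?thesis
      by (rule has_derivative_transform_within_open[OF _ o]) (use False in \<open>auto simp: k_def c_def step_eq_1\<close>)
  qed
  have comp: "\<bar>R y $ i - R z $ i\<bar> \<le> norm (y - z)" for y z i
  proof -
    have "\<bar>R (y - z) $ i\<bar> \<le> norm (y - z)" using component_le_norm_cart[of "R (y - z)" i] unfolding normR .
    then show ?thesis by (simp add: linear_diff[OF linR])
  qed
  have lipk: "\<exists>L'. L'-lipschitz_on UNIV (k n)" for n
  proof -
    have lc: "(32 / r)-lipschitz_on UNIV c"
    proof (rule lipschitz_onI)
      fix y z :: "real^2"
      have "norm (c y - c z) \<le> 32 / r * norm (y - z)"
      proof (rule differentiable_bound[of UNIV])
        fix w show "onorm (\<lambda>v. c' w \<bullet> v) \<le> 32 / r"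
          using c'b[of w] by (intro onorm_le order_trans[OF Cauchy_Schwarz_ineq2[folded real_norm_def]] mult_right_mono) auto
      qed (use dc in auto)
      then show "dist (c y) (c z) \<le> 32 / r * dist y z" by (simp add: dist_norm)
    qed (use r in simp)
    have ls: "(4 * (m n * (L + 1)))-lipschitz_on UNIV (\<lambda>y. step (m n * d y))"
    proof (rule lipschitz_onI)
      fix y z :: "real^2"
      have "\<bar>d y - d z\<bar> \<le> \<bar>g (R y $ 1) - g (R z $ 1)\<bar> + \<bar>R y $ 2 - R z $ 2\<bar>" by (simp add: d_def)
      also have "\<dots> \<le> L * norm (y - z) + norm (y - z)"
        using gl[of "R y $ 1" "R z $ 1"] mult_left_mono[OF comp[of y 1 z] L] comp[of y 2 z] by linarith
      finally have "\<bar>d y - d z\<bar> \<le> (L + 1) * norm (y - z)" by (simp add: algebra_simps)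
      then have "\<bar>m n * d y - m n * d z\<bar> \<le> m n * ((L + 1) * norm (y - z))"
        using m(1)[of n] by (simp add: abs_mult right_diff_distrib[symmetric])
      then have "4 * \<bar>m n * d y - m n * d z\<bar> \<le> 4 * (m n * ((L + 1) * norm (y - z)))" by (intro mult_left_mono) simp_all
      from order_trans[OF step_lipschitz this]
      show "dist (step (m n * d y)) (step (m n * d z)) \<le> 4 * (m n * (L + 1)) * dist y z"
        unfolding dist_norm real_norm_def mult.assoc .
    next
      show "0 \<le> 4 * (m n * (L + 1))" using L m(1)[of n] by (intro mult_nonneg_nonneg) simp_all
    qed
    have l1: "K-lipschitz_on UNIV (\<lambda>y. 1 - f y)" if "K-lipschitz_on UNIV f" for K and f :: "real^2 \<Rightarrow> real"
    proof (rule lipschitz_onI)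
      fix x y
      have "dist (1 - f x) (1 - f y) = dist (f x) (f y)" unfolding dist_real_def by linarith
      also have "\<dots> \<le> K * dist x y" using that by (rule lipschitz_onD) simp_all
      finally show "dist (1 - f x) (1 - f y) \<le> K * dist x y" .
    qed (rule lipschitz_on_nonneg[OF that])
    have "(32 / r + 4 * (m n * (L + 1)))-lipschitz_on UNIV (\<lambda>y. (1 - c y) * (1 - step (m n * d y)))"
    proof (rule lipschitz_on_mult_unit[OF l1[OF lc] _ l1[OF ls]])
      fix y show "\<bar>1 - c y\<bar> \<le> 1" "\<bar>1 - step (m n * d y)\<bar> \<le> 1"
        using cb[of y] step_bounds[of "m n * d y"] by linarith+
    qed
    from l1[OF this] show ?thesis unfolding k_def by (rule exI)
  qed
  \<comment> \<open>\<open>Q n\<close> sends an abscissa and a rescaled depth to the point at depth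
    \<open>snd z / m n\<close> below the graph; the layer becomes
    \<open>1 \<le> snd z \<le> 2\<close> for every \<open>n\<close>.\<close>
  define Q where "Q n z = S (vector [fst z, g (fst z) - snd z / m n])" for n z
  have Qm[measurable]: "Q n \<in> borel_measurable (borel \<Otimes>\<^sub>M borel)" for n
  proof -
    have "(\<lambda>z. vector [fst z, g (fst z) - snd z / m n] :: real^2) \<in> borel_measurable (borel \<Otimes>\<^sub>M borel)"
      by (rule borel_measurable_vector2) measurable
    then show ?thesis unfolding Q_def by measurable
  qed
  have RQ: "R (Q n z) $ 1 = fst z" "m n * d (Q n z) = snd z" for n z
    using m(1)[of n] by (simp_all add: Q_def S(2) d_def)
  \<comment> \<open>A common support of all rescaled layer densities: an abscissa farther than
    \<open>r\<close> from that of \<open>p\<close> belongs only to points where \<open>c\<close> is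
    1.\<close>
  define box where "box = {R p $ 1 - r..R p $ 1 + r} \<times> {1..2::real}"
  have boxm[measurable]: "box \<in> sets (lborel \<Otimes>\<^sub>M lborel)" unfolding box_def by measurable
  have boxe: "emeasure (lborel \<Otimes>\<^sub>M lborel) box = ennreal (2 * r)"
    unfolding box_def using r by (subst lborel.emeasure_pair_measure_Times) (auto simp: ennreal_mult[symmetric])
  \<comment> \<open>The Jacobian cancels the factor \<open>m n\<close> of the gradient; what remains
    is bounded independently of \<open>n\<close>.\<close>
  have JQ: "1 / m n * J n (Q n z) = (1 - c (Q n z)) * step' (snd z)" for n z
    using m(1)[of n] by (simp add: J_def RQ)
  have JQb: "1 / m n * J n (Q n z) \<le> 4 * indicator box z" for n z
  proof (cases "z \<in> box")
    case True
    have "(1 - c (Q n z)) * step' (snd z) \<le> 1 * 4"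
      using cb[of "Q n z"] step'_bounds[of "snd z"] by (intro mult_mono) auto
    then show ?thesis unfolding JQ using True by simp
  next
    case False
    have zero: "(1 - c (Q n z)) * step' (snd z) = 0"
    proof (cases "snd z \<in> {1..2}")
      case True
      then have "\<bar>fst z - R p $ 1\<bar> > r" using False by (cases z) (auto simp: box_def abs_if split: if_splits)
      moreover have "\<bar>fst z - R p $ 1\<bar> \<le> norm (Q n z - p)"
        using comp[of "Q n z" 1 p] by (simp add: RQ)
      ultimately have "norm (Q n z - p) \<ge> 3 / 4 * r" using r by linarith
      then show ?thesis using far by simp
    qed (auto intro: step'_eq_0)
    show ?thesis unfolding JQ zero by simp
  qed
  have coord: "(\<integral>\<^sup>+y. F y \<partial>lborel) = (\<integral>\<^sup>+z. ennreal (1 / m n) * F (Q n z) \<partial>(lborel \<Otimes>\<^sub>M lborel))"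
    if "F \<in> borel_measurable borel" for F n
    unfolding Q_def by (rule nn_integral_graph_coordinates[OF that S(1) gm m(1)[of n]])
  have int4: "(\<integral>\<^sup>+z. ennreal (C * indicator box z) \<partial>(lborel \<Otimes>\<^sub>M lborel)) = ennreal (C * (2 * r))" if "C \<ge> 0" for C
  proof -
    have "(\<integral>\<^sup>+z. ennreal (C * indicator box z) \<partial>(lborel \<Otimes>\<^sub>M lborel))
       = (\<integral>\<^sup>+z. ennreal C * indicator box z \<partial>(lborel \<Otimes>\<^sub>M lborel))"
      by (intro nn_integral_cong) (simp add: indicator_def)
    also have "\<dots> = ennreal C * ennreal (2 * r)"
      unfolding boxe[symmetric] by (rule nn_integral_cmult_indicator) fact
    also have "\<dots> = ennreal (C * (2 * r))" using that r by (subst ennreal_mult) simp_all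
    finally show ?thesis .
  qed
  have intJ: "(\<integral>\<^sup>+y. ennreal (J n y) \<partial>lborel) \<le> ennreal (4 * (2 * r))" for n
  proof -
    have "(\<integral>\<^sup>+y. ennreal (J n y) \<partial>lborel) = (\<integral>\<^sup>+z. ennreal (1 / m n) * ennreal (J n (Q n z)) \<partial>(lborel \<Otimes>\<^sub>M lborel))"
      by (rule coord) measurable
    also have "\<dots> \<le> (\<integral>\<^sup>+z. ennreal (4 * indicator box z) \<partial>(lborel \<Otimes>\<^sub>M lborel))"
    proof (rule nn_integral_mono)
      fix z
      have "ennreal (1 / m n) * ennreal (J n (Q n z)) = ennreal (1 / m n * J n (Q n z))"
        by (rule ennreal_mult[symmetric]) (use m(1)[of n] J0 in simp_all)
      also have "\<dots> \<le> ennreal (4 * indicator box z)" by (rule ennreal_leI[OF JQb])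
      finally show "ennreal (1 / m n) * ennreal (J n (Q n z)) \<le> ennreal (4 * indicator box z)" .
    qed
    also have "\<dots> = ennreal (4 * (2 * r))" by (rule int4) simp
    finally show ?thesis .
  qed
  have fV: "emeasure lborel V < \<infinity>" using emeasure_bounded_finite[OF bV] by simp
  have intV: "(\<integral>\<^sup>+y. ennreal (C * indicator V y) \<partial>lborel) = ennreal (C * measure lborel V)" if "C \<ge> 0" for C
  proof -
    have "(\<integral>\<^sup>+y. ennreal (C * indicator V y) \<partial>lborel) = (\<integral>\<^sup>+y. ennreal C * indicator V y \<partial>lborel)"
      by (intro nn_integral_cong) (simp add: indicator_def)
    also have "\<dots> = ennreal C * emeasure lborel V"
      by (rule nn_integral_cmult_indicator) (use Vm in simp)
    also have "emeasure lborel V = ennreal (measure lborel V)" using fV by (intro emeasure_eq_ennreal_measure) simp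
    finally show ?thesis using that by (simp add: ennreal_mult)
  qed
  have sb: "0 \<le> 1 - step s" "1 - step s \<le> 1" for s using step_bounds[of s] by auto
  have normG: "norm (G n y) \<le> 32 / r + (L + 1) * J n y" for n y
  proof -
    have "norm ((1 - step (m n * d y)) *\<^sub>R c' y) \<le> 1 * norm (c' y)"
      unfolding norm_scaleR using sb[of "m n * d y"] by (intro mult_right_mono) simp_all
    moreover have "norm (J n y *\<^sub>R nd (R y $ 1)) \<le> J n y * (L + 1)"
      unfolding norm_scaleR using J0[of n y] nd by (intro mult_mono) simp_all
    ultimately show ?thesis
      using c'b[of y] norm_triangle_ineq[of "(1 - step (m n * d y)) *\<^sub>R c' y" "J n y *\<^sub>R nd (R y $ 1)"]
      unfolding G_def by (simp add: mult.commute)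
  qed
  have inside: "d y > 0" if "y \<in> V" "y \<in> ball p r" for y
    using chart[OF that(2)] that(1) V(1) by (simp add: d_def)
  have ev2: "\<forall>\<^sub>F n in sequentially. 2 \<le> m n * d y" if "d y > 0" for y
    using order_tendstoD(2)[OF mlim that, of 2]
  proof eventually_elim
    case (elim n)
    then have "2 < d y * m n" using m(1)[of n] by (simp add: pos_divide_less_eq)
    then show ?case by (simp add: mult.commute)
  qed
  have out: "1 - c y = 0 \<and> c' y = 0" if "y \<notin> ball p r" for y
    using far[of y] that r by (simp add: dist_norm norm_minus_commute)
  have flux: "(\<lambda>n. \<integral>\<^sup>+y. ennreal \<bar>(indicator V y *\<^sub>R H y) \<bullet> G n y\<bar> \<partial>lborel) \<longlonglongrightarrow> 0"
    if H: "vanishing_flux V N H" for H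
  proof -
    define F where "F y = indicator V y *\<^sub>R H y" for y
    have Fm[measurable]: "F \<in> borel_measurable borel"
      using vanishing_flux_measurable[OF H V(2)] by (simp add: F_def[abs_def])
    obtain B where B: "\<And>y. y \<in> V \<Longrightarrow> norm (H y) \<le> B" "B \<ge> 0"
      using H unfolding vanishing_flux_def bounded_iff by (metis (no_types, lifting) imageI norm_ge_zero order_trans linear)
    have FB: "norm (F y) \<le> B" for y using B by (cases "y \<in> V") (simp_all add: F_def)
    have stepm: "(\<lambda>y. step (m n * d y)) \<in> borel_measurable borel" for n by measurable
    \<comment> \<open>\<open>A1\<close> collects the gradient of \<open>c\<close>, which is bounded
      and disappears pointwise as the layer shrinks. \<open>A2\<close> collects the gradient of the
      layer profile, which has size \<open>m n\<close> and needs the flux condition.\<close>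
    define A1 where "A1 n y = norm (F y) * norm (c' y) * (1 - step (m n * d y))" for n y
    define A2 where "A2 n y = \<bar>F y \<bullet> nd (R y $ 1)\<bar> * J n y" for n y
    have [measurable]: "A1 n \<in> borel_measurable borel" "A2 n \<in> borel_measurable borel" for n
      unfolding A1_def A2_def using stepm by measurable
    have le: "\<bar>F y \<bullet> G n y\<bar> \<le> A1 n y + A2 n y" for n y
    proof -
      have "F y \<bullet> G n y = (1 - step (m n * d y)) * (F y \<bullet> c' y) + J n y * (F y \<bullet> nd (R y $ 1))"
        by (simp add: G_def inner_add_right)
      also have "\<bar>\<dots>\<bar> \<le> (1 - step (m n * d y)) * \<bar>F y \<bullet> c' y\<bar> + J n y * \<bar>F y \<bullet> nd (R y $ 1)\<bar>"
        using sb[of "m n * d y"] J0[of n y] by (intro order_trans[OF abs_triangle_ineq]) (simp add: abs_mult)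
      also have "\<dots> \<le> (1 - step (m n * d y)) * (norm (F y) * norm (c' y)) + J n y * \<bar>F y \<bullet> nd (R y $ 1)\<bar>"
        using sb[of "m n * d y"] by (intro add_right_mono mult_left_mono Cauchy_Schwarz_ineq2) simp_all
      finally show ?thesis by (simp add: A1_def A2_def mult_ac)
    qed
    have A10: "0 \<le> A1 n y" and A20: "0 \<le> A2 n y" for n y
      unfolding A1_def A2_def using sb[of "m n * d y"] J0[of n y] by (intro mult_nonneg_nonneg; simp)+
    have lim1: "(\<lambda>n. \<integral>\<^sup>+y. ennreal (A1 n y) \<partial>lborel) \<longlonglongrightarrow> (\<integral>\<^sup>+y. 0 \<partial>(lborel :: (real^2) measure))"
    proof (rule nn_integral_dominated_convergence)
      show "AE y in lborel. ennreal (A1 n y) \<le> ennreal (B * (32 / r) * indicator V y)" for n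
      proof (rule AE_I2, rule ennreal_leI)
        fix y
        show "A1 n y \<le> B * (32 / r) * indicator V y"
        proof (cases "y \<in> V")
          case True
          have "A1 n y \<le> B * (32 / r) * 1"
            unfolding A1_def using FB[of y] c'b[of y] sb[of "m n * d y"] B(2) by (intro mult_mono mult_nonneg_nonneg) (simp_all add: r less_imp_le)
          then show ?thesis using True by simp
        qed (simp add: A1_def F_def)
      qed
      show "(\<integral>\<^sup>+y. ennreal (B * (32 / r) * indicator V y) \<partial>lborel) < \<infinity>"
        using B(2) r by (subst intV) simp_all
      show "AE y in lborel. (\<lambda>n. ennreal (A1 n y)) \<longlonglongrightarrow> 0"
      proof (rule AE_I2, rule tendsto_eventually)
        fix y
        consider "y \<in> V" "y \<in> ball p r" | "y \<notin> V" | "y \<notin> ball p r" by blast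
        then show "\<forall>\<^sub>F n in sequentially. ennreal (A1 n y) = 0"
        proof cases
          case 1
          show ?thesis using ev2[OF inside[OF 1]] by (rule eventually_mono) (simp add: A1_def step_eq_1)
        next
          case 2
          then show ?thesis by (simp add: A1_def F_def)
        next
          case 3
          then show ?thesis using out[OF 3] by (simp add: A1_def)
        qed
      qed
    qed (simp_all, measurable)
    define U where "U n z = \<bar>F (Q n z) \<bullet> nd (fst z)\<bar> * ((1 - c (Q n z)) * step' (snd z))" for n z
    have U: "(\<integral>\<^sup>+y. ennreal (A2 n y) \<partial>lborel) = (\<integral>\<^sup>+z. ennreal (U n z) \<partial>(lborel \<Otimes>\<^sub>M lborel))" for n
    proof -
      have "(\<integral>\<^sup>+y. ennreal (A2 n y) \<partial>lborel) = (\<integral>\<^sup>+z. ennreal (1 / m n) * ennreal (A2 n (Q n z)) \<partial>(lborel \<Otimes>\<^sub>M lborel))"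
        by (rule coord) measurable
      also have "\<dots> = (\<integral>\<^sup>+z. ennreal (U n z) \<partial>(lborel \<Otimes>\<^sub>M lborel))"
      proof (rule nn_integral_cong)
        fix z
        have "ennreal (1 / m n) * ennreal (A2 n (Q n z)) = ennreal (1 / m n * A2 n (Q n z))"
          by (rule ennreal_mult[symmetric]) (use m(1)[of n] A20 in simp_all)
        also have "1 / m n * A2 n (Q n z) = \<bar>F (Q n z) \<bullet> nd (fst z)\<bar> * (1 / m n * J n (Q n z))"
          unfolding A2_def RQ by (simp only: mult.left_commute)
        also have "\<dots> = U n z" unfolding JQ U_def ..
        finally show "ennreal (1 / m n) * ennreal (A2 n (Q n z)) = ennreal (U n z)" .
      qed
      finally show ?thesis .
    qed
    have T0p: "AE z in lborel \<Otimes>\<^sub>M lborel. fst z \<notin> T0"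
      using countable_imp_null_set_lborel[OF T0] by (intro AE_lborel_fst AE_not_in)
    \<comment> \<open>The points \<open>Q n z\<close> approach the graph point \<open>q\<close> with
      abscissa \<open>fst z\<close>. If \<open>q\<close> is outside the chart ball, the factor
      \<open>1 - c\<close> tends to 0; otherwise \<open>q\<close> has a normal and the flux limit at
      \<open>q\<close> applies.\<close>
    have limU: "(\<lambda>n. U n z) \<longlonglongrightarrow> 0" if z: "fst z \<notin> T0" for z
    proof -
      define q where "q = P (fst z)"
      have Ql: "(\<lambda>n. Q n z) \<longlonglongrightarrow> q"
      proof -
        have eq: "Q n z = q - (snd z / m n) *\<^sub>R S (axis 2 1)" for n
        proof -
          have "vector [fst z, g (fst z) - snd z / m n] = vector [fst z, g (fst z)] - (snd z / m n) *\<^sub>R (axis 2 1 :: real^2)"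
            by (simp add: vec_eq_iff forall_2 axis_def)
          then show ?thesis by (simp add: Q_def q_def P_def linear_diff[OF linS] linear_cmul[OF linS])
        qed
        have "(\<lambda>n. q - (snd z / m n) *\<^sub>R S (axis 2 1)) \<longlonglongrightarrow> q - 0 *\<^sub>R S (axis 2 1)"
          by (intro tendsto_intros mlim)
        then show ?thesis unfolding eq by simp
      qed
      have Ub: "U n z \<le> \<bar>F (Q n z) \<bullet> nd (fst z)\<bar> * 4" "U n z \<le> (B * (L + 1)) * ((1 - c (Q n z)) * 4)" "0 \<le> U n z" for n
      proof -
        have s4: "(1 - c (Q n z)) * step' (snd z) \<le> 1 * 4" "(1 - c (Q n z)) * step' (snd z) \<le> (1 - c (Q n z)) * 4"
            "0 \<le> (1 - c (Q n z)) * step' (snd z)"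
          using cb[of "Q n z"] step'_bounds[of "snd z"] by (intro mult_mono mult_left_mono mult_nonneg_nonneg; simp)+
        show "U n z \<le> \<bar>F (Q n z) \<bullet> nd (fst z)\<bar> * 4" unfolding U_def using s4(1) by (intro mult_left_mono) simp_all
        have "\<bar>F (Q n z) \<bullet> nd (fst z)\<bar> \<le> B * (L + 1)"
          by (rule order_trans[OF Cauchy_Schwarz_ineq2 mult_mono[OF FB nd B(2) norm_ge_zero]])
        then show "U n z \<le> (B * (L + 1)) * ((1 - c (Q n z)) * 4)"
          unfolding U_def by (rule mult_mono[OF _ s4(2) _ s4(3)]) (use B(2) L in simp)
        show "0 \<le> U n z" unfolding U_def by (rule mult_nonneg_nonneg[OF abs_ge_zero s4(3)])
      qed
      show ?thesis
      proof (cases "q \<in> ball p r")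
        case False
        have "(\<lambda>n. c (Q n z)) \<longlonglongrightarrow> c q"
          using contc[of UNIV] Ql by (rule continuous_on_tendsto_compose) simp_all
        then have "(\<lambda>n. (B * (L + 1)) * ((1 - c (Q n z)) * 4)) \<longlonglongrightarrow> (B * (L + 1)) * ((1 - c q) * 4)"
          by (intro tendsto_intros)
        then have "(\<lambda>n. (B * (L + 1)) * ((1 - c (Q n z)) * 4)) \<longlonglongrightarrow> 0" using out[OF False] by simp
        from tendsto_sandwich[OF always_eventually[OF allI[OF Ub(3)]] always_eventually[OF allI[OF Ub(2)]] tendsto_const this]
        show ?thesis .
      next
        case True
        obtain \<nu> where \<nu>: "outer_unit_normal UNIV W q \<nu>" and qX: "q \<notin> X" and qf: "q \<in> frontier W"
          using regular[OF z] True q_def by blast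
        \<comment> \<open>The flux limit at \<open>q\<close> is punctured; since \<open>q\<close> is
          outside \<open>V\<close>, no point \<open>Q n z\<close> in \<open>V\<close> can coincide
          with it.\<close>
        have qV: "q \<notin> V" using qf W(1) V(1) by (simp add: frontier_def interior_open)
        have "N q \<nu>" unfolding N using \<nu> qX qf by simp
        then have Hl: "((\<lambda>a. H a \<bullet> \<nu>) \<longlongrightarrow> 0) (at q within V)" using H unfolding vanishing_flux_def by blast
        have Rq: "R q $ 2 = g (R q $ 1)" "R q $ 1 = fst z" by (simp_all add: q_def RP)
        note on = outer_unit_normal_graph[OF R g True chart Rq(1) \<nu>]
        define w where "w = R \<nu> $ 2"
        have w: "w > 0" using on(1) by (simp add: w_def)
        \<comment> \<open>The slope of the graph at \<open>q\<close> makes \<open>(g', -1)\<close> a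
          negative multiple of the rotated normal, so pairing a field with \<open>nd\<close> is
          pairing it with \<open>\<nu>\<close> up to the factor \<open>- 1 / w\<close>.\<close>
        have "gd (fst z) = - (R \<nu> $ 1 / w)" using gd[OF on(2)] Rq(2) by (simp add: w_def)
        then have "vector [gd (fst z), -1] = (- 1 / w) *\<^sub>R R \<nu>"
          using w by (simp add: vec_eq_iff forall_2 w_def)
        then have ndq: "nd (fst z) = (- 1 / w) *\<^sub>R \<nu>"
          unfolding nd_def by (simp only: linear_cmul[OF linS] S(3))
        have Fl: "(\<lambda>n. F (Q n z) \<bullet> \<nu>) \<longlonglongrightarrow> 0"
        proof (rule tendstoI)
          fix e :: real assume e: "e > 0"
          have "\<forall>\<^sub>F a in at q within V. dist (H a \<bullet> \<nu>) 0 < e" using Hl e by (rule tendstoD)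
          then obtain \<delta> where \<delta>: "\<delta> > 0" "\<And>a. a \<in> V \<Longrightarrow> a \<noteq> q \<Longrightarrow> dist a q < \<delta> \<Longrightarrow> dist (H a \<bullet> \<nu>) 0 < e"
            unfolding eventually_at by blast
          show "\<forall>\<^sub>F n in sequentially. dist (F (Q n z) \<bullet> \<nu>) 0 < e"
            using tendstoD[OF Ql \<delta>(1)]
          proof (rule eventually_mono)
            fix n assume dq: "dist (Q n z) q < \<delta>"
            show "dist (F (Q n z) \<bullet> \<nu>) 0 < e"
            proof (cases "Q n z \<in> V")
              case True
              then have "Q n z \<noteq> q" using qV by blast
              then show ?thesis using \<delta>(2)[OF True _ dq] True by (simp add: F_def)
            qed (simp add: F_def e)
          qed
        qed
        have "(\<lambda>n. \<bar>(- 1 / w) * (F (Q n z) \<bullet> \<nu>)\<bar> * 4) \<longlonglongrightarrow> \<bar>(- 1 / w) * 0\<bar> * 4"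
          by (intro tendsto_intros Fl)
        then have "(\<lambda>n. \<bar>F (Q n z) \<bullet> nd (fst z)\<bar> * 4) \<longlonglongrightarrow> 0" by (simp add: ndq)
        from tendsto_sandwich[OF always_eventually[OF allI[OF Ub(3)]] always_eventually[OF allI[OF Ub(1)]] tendsto_const this]
        show ?thesis .
      qed
    qed
    have lim2: "(\<lambda>n. \<integral>\<^sup>+z. ennreal (U n z) \<partial>(lborel \<Otimes>\<^sub>M lborel)) \<longlonglongrightarrow> (\<integral>\<^sup>+z. 0 \<partial>((lborel \<Otimes>\<^sub>M lborel) :: (real \<times> real) measure))"
    proof (rule nn_integral_dominated_convergence)
      show "(\<lambda>z. ennreal (U n z)) \<in> borel_measurable (lborel \<Otimes>\<^sub>M lborel)" for n
      proof -
        have [measurable]: "Q n \<in> borel_measurable (lborel \<Otimes>\<^sub>M lborel)"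
          using Qm[of n] by (simp add: measurable_def space_pair_measure sets_pair_measure)
        show ?thesis unfolding U_def by measurable
      qed
      show "AE z in lborel \<Otimes>\<^sub>M lborel. ennreal (U n z) \<le> ennreal (B * (L + 1) * 4 * indicator box z)" for n
      proof (rule AE_I2, rule ennreal_leI)
        fix z
        have "\<bar>F (Q n z) \<bullet> nd (fst z)\<bar> \<le> B * (L + 1)"
          by (rule order_trans[OF Cauchy_Schwarz_ineq2 mult_mono[OF FB nd B(2) norm_ge_zero]])
        moreover have "0 \<le> 1 / m n * J n (Q n z)" using m(1)[of n] J0[of n "Q n z"] by (intro mult_nonneg_nonneg) simp_all
        ultimately have "U n z \<le> (B * (L + 1)) * (4 * indicator box z)"
          unfolding U_def JQ[symmetric] by (intro mult_mono[OF _ JQb]) (use B(2) L in simp_all)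
        then show "U n z \<le> B * (L + 1) * 4 * indicator box z" by (simp only: mult.assoc)
      qed
      show "(\<integral>\<^sup>+z. ennreal (B * (L + 1) * 4 * indicator box z) \<partial>(lborel \<Otimes>\<^sub>M lborel)) < \<infinity>"
        using B(2) L by (subst int4) simp_all
      show "AE z in lborel \<Otimes>\<^sub>M lborel. (\<lambda>n. ennreal (U n z)) \<longlonglongrightarrow> 0"
        using T0p by (rule eventually_mono) (use tendsto_ennrealI[OF limU] in simp)
    qed (simp_all)
    have int_le: "(\<integral>\<^sup>+y. ennreal \<bar>F y \<bullet> G n y\<bar> \<partial>lborel) \<le> (\<integral>\<^sup>+y. ennreal (A1 n y) \<partial>lborel) + (\<integral>\<^sup>+y. ennreal (A2 n y) \<partial>lborel)" for n
    proof -
      have "(\<integral>\<^sup>+y. ennreal \<bar>F y \<bullet> G n y\<bar> \<partial>lborel) \<le> (\<integral>\<^sup>+y. ennreal (A1 n y) + ennreal (A2 n y) \<partial>lborel)"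
      proof (rule nn_integral_mono)
        fix y
        have "ennreal \<bar>F y \<bullet> G n y\<bar> \<le> ennreal (A1 n y + A2 n y)" by (rule ennreal_leI[OF le])
        then show "ennreal \<bar>F y \<bullet> G n y\<bar> \<le> ennreal (A1 n y) + ennreal (A2 n y)"
          by (simp only: ennreal_plus[OF A10 A20])
      qed
      also have "\<dots> = (\<integral>\<^sup>+y. ennreal (A1 n y) \<partial>lborel) + (\<integral>\<^sup>+y. ennreal (A2 n y) \<partial>lborel)"
        by (rule nn_integral_add) measurable
      finally show ?thesis .
    qed
    have "(\<lambda>n. (\<integral>\<^sup>+y. ennreal (A1 n y) \<partial>lborel) + (\<integral>\<^sup>+y. ennreal (A2 n y) \<partial>lborel)) \<longlonglongrightarrow> 0 + 0"
      using lim1 lim2 unfolding U nn_integral_const mult_zero_left by (rule tendsto_add)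
    then have lim: "(\<lambda>n. (\<integral>\<^sup>+y. ennreal (A1 n y) \<partial>lborel) + (\<integral>\<^sup>+y. ennreal (A2 n y) \<partial>lborel)) \<longlonglongrightarrow> 0"
      unfolding add_0 .
    show ?thesis
      unfolding F_def[symmetric]
      by (rule tendsto_sandwich[OF always_eventually[OF allI[OF zero_le]] always_eventually[OF allI[OF int_le]] tendsto_const lim])
  qed
  have "cutoff V N k G"
    unfolding cutoff_def
  proof (intro conjI allI ballI impI)
    fix n y
    have "(1 - c y) * (1 - step (m n * d y)) \<le> 1 * 1"
      using cb[of y] sb[of "m n * d y"] by (intro mult_mono) simp_all
    moreover have "0 \<le> (1 - c y) * (1 - step (m n * d y))"
      using cb[of y] sb[of "m n * d y"] by (intro mult_nonneg_nonneg) simp_all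
    ultimately show "0 \<le> k n y" "k n y \<le> 1" unfolding k_def by linarith+
  next
    fix n
    show "\<exists>L. L-lipschitz_on UNIV (k n)" by (rule lipk)
    show "AE y in lborel. (k n has_derivative (\<lambda>v. G n y \<bullet> v)) (at y)"
      using AEd by (rule eventually_mono) (rule dk)
    show "G n \<in> borel_measurable borel" by fact
  next
    show "\<exists>C. \<forall>n. (\<integral>\<^sup>+y. ennreal (indicator V y * norm (G n y)) \<partial>lborel) \<le> ennreal C"
    proof (intro exI allI)
      fix n
      have "(\<integral>\<^sup>+y. ennreal (indicator V y * norm (G n y)) \<partial>lborel)
         \<le> (\<integral>\<^sup>+y. ennreal (32 / r * indicator V y) + ennreal (L + 1) * ennreal (J n y) \<partial>lborel)"
      proof (rule nn_integral_mono)
        fix y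
        have "indicator V y * norm (G n y) \<le> 32 / r * indicator V y + (L + 1) * J n y"
        proof (cases "y \<in> V")
          case False
          then show ?thesis using J0[of n y] L by (simp add: mult_nonneg_nonneg)
        qed (use normG[of n y] in simp)
        then have "ennreal (indicator V y * norm (G n y)) \<le> ennreal (32 / r * indicator V y + (L + 1) * J n y)"
          by (rule ennreal_leI)
        also have "\<dots> = ennreal (32 / r * indicator V y) + ennreal (L + 1) * ennreal (J n y)"
          using J0[of n y] L r by (subst ennreal_plus) (simp_all add: ennreal_mult)
        finally show "ennreal (indicator V y * norm (G n y)) \<le> ennreal (32 / r * indicator V y) + ennreal (L + 1) * ennreal (J n y)" .
      qed
      also have "\<dots> = (\<integral>\<^sup>+y. ennreal (32 / r * indicator V y) \<partial>lborel) + (\<integral>\<^sup>+y. ennreal (L + 1) * ennreal (J n y) \<partial>lborel)"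
        by (rule nn_integral_add) measurable
      also have "(\<integral>\<^sup>+y. ennreal (L + 1) * ennreal (J n y) \<partial>lborel) = ennreal (L + 1) * (\<integral>\<^sup>+y. ennreal (J n y) \<partial>lborel)"
        by (rule nn_integral_cmult) measurable
      also have "(\<integral>\<^sup>+y. ennreal (32 / r * indicator V y) \<partial>lborel) + ennreal (L + 1) * (\<integral>\<^sup>+y. ennreal (J n y) \<partial>lborel)
         \<le> ennreal (32 / r * measure lborel V) + ennreal (L + 1) * ennreal (4 * (2 * r))"
        using r by (intro add_mono mult_left_mono intJ eq_refl[OF intV]) simp_all
      also have "\<dots> = ennreal (32 / r * measure lborel V + (L + 1) * (4 * (2 * r)))"
        using r L by (subst ennreal_plus) (simp_all add: ennreal_mult)
      finally show "(\<integral>\<^sup>+y. ennreal (indicator V y * norm (G n y)) \<partial>lborel)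
         \<le> ennreal (32 / r * measure lborel V + (L + 1) * (4 * (2 * r)))" .
    qed
  next
    fix y assume y: "y \<in> V"
    show "(\<lambda>n. k n y) \<longlonglongrightarrow> 1"
    proof (cases "y \<in> ball p r")
      case True
      have "\<forall>\<^sub>F n in sequentially. k n y = 1"
        using ev2[OF inside[OF y True]] by (rule eventually_mono) (simp add: k_def step_eq_1)
      then show ?thesis by (rule tendsto_eventually)
    next
      case False
      then show ?thesis using out[OF False] by (simp add: k_def)
    qed
  next
    fix H assume "vanishing_flux V N H"
    then show "(\<lambda>n. \<integral>\<^sup>+y. ennreal \<bar>(indicator V y *\<^sub>R H y) \<bullet> G n y\<bar> \<partial>lborel) \<longlonglongrightarrow> 0" by (rule flux)
  qed
  moreover have "\<exists>Z. open Z \<and> frontier W \<inter> ball p (r / 2) \<subseteq> Z \<and> (\<forall>y\<in>Z. k n y = 0)" for n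
  proof (intro exI conjI ballI subsetI)
    \<comment> \<open>On the half-size ball \<open>c\<close> is 0, so there \<open>k n\<close>
      equals \<open>step\<close> of the rescaled depth, which vanishes on and above the graph and
      slightly below it.\<close>
    show "open (ball p (r / 2) \<inter> {y. m n * d y < 1})"
      using contd by (intro open_Int open_ball open_Collect_less continuous_intros)
  next
    fix y assume y: "y \<in> frontier W \<inter> ball p (r / 2)"
    then have "y \<notin> W" "y \<in> ball p r" using W(1) r by (auto simp: frontier_def interior_open)
    then have "d y \<le> 0" using chart[of y] by (simp add: d_def)
    then have "m n * d y \<le> 0" using m(1)[of n] by (intro mult_nonneg_nonpos) simp_all
    then have "m n * d y < 1" by linarith
    then show "y \<in> ball p (r / 2) \<inter> {y. m n * d y < 1}" using y by blast
  next
    fix y assume y: "y \<in> ball p (r / 2) \<inter> {y. m n * d y < 1}"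
    then have "norm (y - p) \<le> r / 2" by (simp add: dist_norm norm_minus_commute)
    then have "(norm (y - p))\<^sup>2 \<le> (r / 2)\<^sup>2" by (intro power_mono) simp_all
    then have "(norm (y - p))\<^sup>2 * A \<le> (r / 2)\<^sup>2 * A" using A(1) by (intro mult_right_mono) simp_all
    also have "\<dots> = 1" using r by (simp add: A_def power_divide)
    finally have "c y = 0" unfolding c_def by (rule step_eq_0)
    then show "k n y = 0" using y by (simp add: k_def step_eq_0)
  qed
  ultimately show ?thesis unfolding cutoff_near_def by blast
qed


subsection \<open>The divergence theorem on a product of two planar domains\<close>

lemma cutoff_near_mono: "cutoff_near V N B \<Longrightarrow> A \<subseteq> B \<Longrightarrow> cutoff_near V N A"
  unfolding cutoff_near_def by (meson order_trans)

text \<open>Normals refer to \<open>W\<close> although the fields live on \<open>W - X\<close>: the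
  points of \<open>X\<close> carry no flux condition and are removed by point cutoffs.\<close>

definition domain_normal :: "(real^2) set \<Rightarrow> (real^2) set \<Rightarrow> real^2 \<Rightarrow> real^2 \<Rightarrow> bool" where
  "domain_normal W X q \<nu> \<longleftrightarrow> q \<in> frontier W - X \<and> outer_unit_normal UNIV W q \<nu>"

text \<open>Compactness of the boundary leaves finitely many half-size charts, and \<open>X\<close>
  is finite; the corresponding cutoffs are multiplied.\<close>

lemma cutoff_near_regular_domain:
  assumes W: "regular_domain W" and X: "finite X"
  shows "cutoff_near (W - X) (domain_normal W X) (frontier W \<union> X)"
proof -
  have oW: "open W" and bW: "bounded W"
    and cn: "countable {p \<in> frontier W. \<nexists>\<nu>. outer_unit_normal UNIV W p \<nu>}"
    and lb: "lipschitz_boundary W" using W by (auto simp: regular_domain_def)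
  have oV: "open (W - X)" using oW X by (intro open_Diff finite_imp_closed)
  have N: "domain_normal W X = (\<lambda>q \<nu>. q \<in> frontier W - X \<and> outer_unit_normal UNIV W q \<nu>)"
    by (simp add: domain_normal_def fun_eq_iff)
  have "\<exists>r>0. cutoff_near (W - X) (domain_normal W X) (frontier W \<inter> ball p r)" if p: "p \<in> frontier W" for p
  proof -
    obtain R :: "real^2 \<Rightarrow> real^2" and g :: "real \<Rightarrow> real" and L r
      where c: "orthogonal_transformation R" "L-lipschitz_on UNIV g" "r > 0"
        "\<And>y. y \<in> ball p r \<Longrightarrow> y \<in> W \<longleftrightarrow> R y $ 2 < g (R y $ 1)"
      using bspec[OF lb[unfolded lipschitz_boundary_def] p] by metis
    have "cutoff_near (W - X) (domain_normal W X) (frontier W \<inter> ball p (r / 2))"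
      by (rule cutoff_near_chart[OF oW bW _ refl oV N c cn]) (use X in \<open>simp add: countable_finite\<close>)
    then show ?thesis using c(3) by (intro exI[of _ "r / 2"]) simp
  qed
  then obtain r where r: "\<And>p. p \<in> frontier W \<Longrightarrow> r p > 0"
      "\<And>p. p \<in> frontier W \<Longrightarrow> cutoff_near (W - X) (domain_normal W X) (frontier W \<inter> ball p (r p))"
    by metis
  have cf: "compact (frontier W)" using bW by (rule compact_frontier_bounded)
  have "frontier W \<subseteq> (\<Union>p\<in>frontier W. ball p (r p))" using r(1) by (intro subsetI UN_I) auto
  from compactE_image[OF cf open_ball this]
  obtain C where C: "C \<subseteq> frontier W" "finite C" "frontier W \<subseteq> (\<Union>p\<in>C. ball p (r p))"
    by metis
  have "cutoff_near (W - X) (domain_normal W X)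
      (\<Union> ((\<lambda>p. frontier W \<inter> ball p (r p)) ` C \<union> (\<lambda>x. {x}) ` X))"
  proof (rule cutoff_near_Union[OF oV])
    show "finite ((\<lambda>p. frontier W \<inter> ball p (r p)) ` C \<union> (\<lambda>x. {x}) ` X)" using C(2) X by simp
    fix A assume "A \<in> (\<lambda>p. frontier W \<inter> ball p (r p)) ` C \<union> (\<lambda>x. {x}) ` X"
    then consider p where "p \<in> C" "A = frontier W \<inter> ball p (r p)" | x where "x \<in> X" "A = {x}" by blast
    then show "cutoff_near (W - X) (domain_normal W X) A"
    proof cases
      case 1
      then show ?thesis using r(2) C(1) by auto
    next
      case 2
      then show ?thesis using cutoff_near_point[OF oV, of x] by simp
    qed
  qed
  then show ?thesis by (rule cutoff_near_mono) (use C(3) in auto)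
qed

text \<open>For frozen \<open>a\<close> the inner integral tends to 0 by the last clause of
  \<open>cutoff\<close>, with no uniformity in \<open>a\<close>. The bound on the field times the
  \<open>L^1\<close> bound on \<open>G\<close> is a constant majorant on the bounded set
  \<open>P\<close>.\<close>

lemma cutoff_term_tendsto_0:
  fixes H :: "'p::euclidean_space \<Rightarrow> real^2 \<Rightarrow> real^2" and P :: "'p set"
  assumes k: "cutoff V N k G" and V: "open V" and P: "open P" "bounded P"
    and H: "\<And>a. a \<in> P \<Longrightarrow> vanishing_flux V N (H a)"
    and B: "\<And>a y. a \<in> P \<Longrightarrow> y \<in> V \<Longrightarrow> norm (H a y) \<le> B"
    and m: "\<And>n. (\<lambda>a. \<integral>\<^sup>+y. ennreal \<bar>(indicator (P \<times> V) (a, y) *\<^sub>R H a y) \<bullet> G n y\<bar> \<partial>lborel) \<in> borel_measurable lborel"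
  shows "(\<lambda>n. \<integral>\<^sup>+a. \<integral>\<^sup>+y. ennreal \<bar>(indicator (P \<times> V) (a, y) *\<^sub>R H a y) \<bullet> G n y\<bar> \<partial>lborel \<partial>lborel) \<longlonglongrightarrow> 0"
proof -
  obtain C where C: "\<And>n. (\<integral>\<^sup>+y. ennreal (indicator V y * norm (G n y)) \<partial>lborel) \<le> ennreal C"
    using k unfolding cutoff_def by blast
  have Gm[measurable]: "G n \<in> borel_measurable borel" for n using k unfolding cutoff_def by blast
  have [measurable]: "V \<in> sets borel" "P \<in> sets borel" using V P by simp_all
  define B' where "B' = max B 0"
  have "(\<lambda>n. \<integral>\<^sup>+a. \<integral>\<^sup>+y. ennreal \<bar>(indicator (P \<times> V) (a, y) *\<^sub>R H a y) \<bullet> G n y\<bar> \<partial>lborel \<partial>lborel)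
      \<longlonglongrightarrow> (\<integral>\<^sup>+a. 0 \<partial>(lborel :: 'p measure))"
  proof (rule nn_integral_dominated_convergence)
    show "AE a in lborel. (\<integral>\<^sup>+y. ennreal \<bar>(indicator (P \<times> V) (a, y) *\<^sub>R H a y) \<bullet> G n y\<bar> \<partial>lborel)
        \<le> ennreal B' * ennreal C * indicator P a" for n
    proof (rule AE_I2)
      fix a
      show "(\<integral>\<^sup>+y. ennreal \<bar>(indicator (P \<times> V) (a, y) *\<^sub>R H a y) \<bullet> G n y\<bar> \<partial>lborel) \<le> ennreal B' * ennreal C * indicator P a"
      proof (cases "a \<in> P")
        case True
        have "(\<integral>\<^sup>+y. ennreal \<bar>(indicator (P \<times> V) (a, y) *\<^sub>R H a y) \<bullet> G n y\<bar> \<partial>lborel)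
          \<le> (\<integral>\<^sup>+y. ennreal B' * ennreal (indicator V y * norm (G n y)) \<partial>lborel)"
        proof (rule nn_integral_mono)
          fix y
          have "\<bar>(indicator (P \<times> V) (a, y) *\<^sub>R H a y) \<bullet> G n y\<bar> \<le> B' * (indicator V y * norm (G n y))"
          proof (cases "y \<in> V")
            case yV: True
            have "norm (H a y) * norm (G n y) \<le> B' * norm (G n y)"
              using B[OF True yV] by (intro mult_right_mono) (simp_all add: B'_def)
            then show ?thesis using Cauchy_Schwarz_ineq2[of "H a y" "G n y"] True yV by simp
          qed simp
          then have "ennreal \<bar>(indicator (P \<times> V) (a, y) *\<^sub>R H a y) \<bullet> G n y\<bar> \<le> ennreal (B' * (indicator V y * norm (G n y)))"
            by (rule ennreal_leI)
          also have "\<dots> = ennreal B' * ennreal (indicator V y * norm (G n y))"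
            by (rule ennreal_mult) (simp_all add: B'_def)
          finally show "ennreal \<bar>(indicator (P \<times> V) (a, y) *\<^sub>R H a y) \<bullet> G n y\<bar>
             \<le> ennreal B' * ennreal (indicator V y * norm (G n y))" .
        qed
        also have "\<dots> = ennreal B' * (\<integral>\<^sup>+y. ennreal (indicator V y * norm (G n y)) \<partial>lborel)"
          by (rule nn_integral_cmult) measurable
        also have "\<dots> \<le> ennreal B' * ennreal C" by (rule mult_left_mono[OF C]) simp
        finally show ?thesis using True by simp
      qed simp
    qed
    have "emeasure lborel P < \<infinity>" using emeasure_bounded_finite[OF P(2)] by simp
    then show "(\<integral>\<^sup>+a. ennreal B' * ennreal C * indicator P a \<partial>lborel) < \<infinity>"
      by (subst nn_integral_cmult_indicator) (simp_all add: ennreal_mult_less_top)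
    show "AE a in lborel. (\<lambda>n. \<integral>\<^sup>+y. ennreal \<bar>(indicator (P \<times> V) (a, y) *\<^sub>R H a y) \<bullet> G n y\<bar> \<partial>lborel) \<longlonglongrightarrow> 0"
    proof (rule AE_I2)
      fix a
      show "(\<lambda>n. \<integral>\<^sup>+y. ennreal \<bar>(indicator (P \<times> V) (a, y) *\<^sub>R H a y) \<bullet> G n y\<bar> \<partial>lborel) \<longlonglongrightarrow> 0"
      proof (cases "a \<in> P")
        case True
        have "(\<lambda>n. \<integral>\<^sup>+y. ennreal \<bar>(indicator V y *\<^sub>R H a y) \<bullet> G n y\<bar> \<partial>lborel) \<longlonglongrightarrow> 0"
          using k H[OF True] unfolding cutoff_def by blast
        moreover have "indicator (P \<times> V) (a, y) = (indicator V y :: real)" for y using True by (simp add: indicator_def)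
        ultimately show ?thesis by simp
      qed simp
    qed
  qed (use m in simp_all)
  then show ?thesis by simp
qed

text \<open>For each \<open>n\<close> the product of the two cutoffs is supported in a compact part
  of the domain, so integration by parts applies. Each partial gradient of the product meets only
  one component of \<open>H\<close>, and that component is controlled by the flux condition of its
  own factor.\<close>

theorem divergence_integral_eq_0:
  fixes U W X :: "(real^2) set" and H :: "(real^2) \<times> (real^2) \<Rightarrow> (real^2) \<times> (real^2)"
  assumes U: "regular_domain U" and W: "regular_domain W" and X: "finite X"
    and H: "c1_with (U \<times> (W - X)) H H'" and bH: "bounded (H ` (U \<times> (W - X)))"
    and bdiv: "bounded ((\<lambda>z. \<Sum>b\<in>Basis. H' z b \<bullet> b) ` (U \<times> (W - X)))"
    and fluxU: "\<And>a p \<nu>. a \<in> W - X \<Longrightarrow> p \<in> frontier U \<Longrightarrow> outer_unit_normal UNIV U p \<nu> \<Longrightarrow>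
        ((\<lambda>u. fst (H (u, a)) \<bullet> \<nu>) \<longlongrightarrow> 0) (at p within U)"
    and fluxW: "\<And>u p \<nu>. u \<in> U \<Longrightarrow> p \<in> frontier W - X \<Longrightarrow> outer_unit_normal UNIV W p \<nu> \<Longrightarrow>
        ((\<lambda>a. snd (H (u, a)) \<bullet> \<nu>) \<longlongrightarrow> 0) (at p within (W - X))"
  shows "(\<integral>z. indicator (U \<times> (W - X)) z * (\<Sum>b\<in>Basis. H' z b \<bullet> b) \<partial>lborel) = 0"
proof -
  define V where "V = W - X"
  define Om where "Om = U \<times> V"
  define dv where "dv z = (\<Sum>b\<in>Basis. H' z b \<bullet> b)" for z
  have oU: "open U" and bU: "bounded U" and oW: "open W" and bW: "bounded W"
    using U W by (auto simp: regular_domain_def)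
  have oV: "open V" using oW X unfolding V_def by (intro open_Diff finite_imp_closed)
  have bV: "bounded V" using bW unfolding V_def by (rule bounded_subset) auto
  have oO: "open Om" unfolding Om_def using oU oV by (rule open_Times)
  have H1: "c1_with Om H H'" using H by (simp add: Om_def V_def)
  have contH: "continuous_on Om H"
    using H1 unfolding c1_with_def by (meson has_derivative_continuous continuous_at_imp_continuous_on)
  obtain B where B: "\<And>z. z \<in> Om \<Longrightarrow> norm (H z) \<le> B" using bH by (auto simp: bounded_iff Om_def V_def)
  obtain Bd where Bd: "\<And>z. z \<in> Om \<Longrightarrow> \<bar>dv z\<bar> \<le> Bd" using bdiv by (auto simp: bounded_iff Om_def V_def dv_def)
  obtain k G where k: "cutoff U (domain_normal U {}) k G" and kZ: "\<And>n. \<exists>Z. open Z \<and> frontier U \<subseteq> Z \<and> (\<forall>y\<in>Z. k n y = 0)"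
    using cutoff_near_regular_domain[OF U finite.emptyI] unfolding cutoff_near_def by auto
  obtain l M where l: "cutoff V (domain_normal W X) l M" and lZ: "\<And>n. \<exists>Z. open Z \<and> frontier W \<union> X \<subseteq> Z \<and> (\<forall>y\<in>Z. l n y = 0)"
    using cutoff_near_regular_domain[OF W X] unfolding cutoff_near_def V_def by blast
  have kb: "0 \<le> k n y" "k n y \<le> 1" and lb: "0 \<le> l n y" "l n y \<le> 1" for n y
    using k l unfolding cutoff_def by blast+
  have [measurable]: "G n \<in> borel_measurable borel" "M n \<in> borel_measurable borel" for n
    using k l unfolding cutoff_def by blast+
  have kl: "\<exists>L. L-lipschitz_on UNIV (k n)" "\<exists>L. L-lipschitz_on UNIV (l n)" for n
    using k l unfolding cutoff_def by blast+
  have km[measurable]: "k n \<in> borel_measurable borel" "l n \<in> borel_measurable borel" for n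
    using kl[of n] by (auto intro!: borel_measurable_continuous_onI intro: lipschitz_on_continuous_on)
  have [measurable]: "U \<in> sets borel" "V \<in> sets borel" "Om \<in> sets borel" using oU oV oO by simp_all
  define \<Psi> where "\<Psi> n z = k n (fst z) * l n (snd z)" for n z
  define g where "g n z = (l n (snd z) *\<^sub>R G n (fst z), k n (fst z) *\<^sub>R M n (snd z))" for n z
  have ibp: "integrable lborel (\<lambda>z. indicator Om z * (\<Psi> n z * dv z + g n z \<bullet> H z)) \<and>
     (\<integral>z. indicator Om z * (\<Psi> n z * dv z + g n z \<bullet> H z) \<partial>lborel) = 0" for n
  proof -
    obtain Z1 where Z1: "open Z1" "frontier U \<subseteq> Z1" "\<And>y. y \<in> Z1 \<Longrightarrow> k n y = 0" using kZ[of n] by blast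
    obtain Z2 where Z2: "open Z2" "frontier W \<union> X \<subseteq> Z2" "\<And>y. y \<in> Z2 \<Longrightarrow> l n y = 0" using lZ[of n] by blast
    \<comment> \<open>Removing from the closures the neighbourhoods \<open>Z1\<close> and
      \<open>Z2\<close>, where the factors vanish, leaves a compact subset of the open
      product.\<close>
    define S where "S = (closure U - Z1) \<times> (closure W - Z2)"
    have cS: "compact S" unfolding S_def using bU bW Z1(1) Z2(1)
      by (intro compact_Times compact_diff) simp_all
    have sS: "S \<subseteq> Om" unfolding S_def Om_def V_def using Z1(2) Z2(2) oU oW
      by (auto simp: frontier_def interior_open)
    have zS: "\<Psi> n z = 0" if "z \<in> Om - S" for z
      using that Z1(3) Z2(3) closure_subset by (auto simp: Om_def V_def S_def \<Psi>_def)
    obtain L1 L2 where L: "L1-lipschitz_on UNIV (k n)" "L2-lipschitz_on UNIV (l n)" using kl[of n] by blast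
    have L': "L1-lipschitz_on UNIV (\<lambda>z::(real^2) \<times> (real^2). k n (fst z))" "L2-lipschitz_on UNIV (\<lambda>z::(real^2) \<times> (real^2). l n (snd z))"
    proof -
      show "L1-lipschitz_on UNIV (\<lambda>z::(real^2) \<times> (real^2). k n (fst z))"
      proof (rule lipschitz_onI)
        fix x y :: "(real^2) \<times> (real^2)"
        have "dist (k n (fst x)) (k n (fst y)) \<le> L1 * dist (fst x) (fst y)" by (rule lipschitz_onD[OF L(1)]) simp_all
        also have "\<dots> \<le> L1 * dist x y" by (intro mult_left_mono dist_fst_le lipschitz_on_nonneg[OF L(1)])
        finally show "dist (k n (fst x)) (k n (fst y)) \<le> L1 * dist x y" .
      qed (rule lipschitz_on_nonneg[OF L(1)])
      show "L2-lipschitz_on UNIV (\<lambda>z::(real^2) \<times> (real^2). l n (snd z))"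
      proof (rule lipschitz_onI)
        fix x y :: "(real^2) \<times> (real^2)"
        have "dist (l n (snd x)) (l n (snd y)) \<le> L2 * dist (snd x) (snd y)" by (rule lipschitz_onD[OF L(2)]) simp_all
        also have "\<dots> \<le> L2 * dist x y" by (intro mult_left_mono dist_snd_le lipschitz_on_nonneg[OF L(2)])
        finally show "dist (l n (snd x)) (l n (snd y)) \<le> L2 * dist x y" .
      qed (rule lipschitz_on_nonneg[OF L(2)])
    qed
    have lip: "(L1 + L2)-lipschitz_on UNIV (\<Psi> n)"
      unfolding \<Psi>_def[abs_def] by (rule lipschitz_on_mult_unit[OF L'(1) _ L'(2)]) (use kb lb in simp_all)
    have ak: "AE u in lborel. (k n has_derivative (\<lambda>v. G n u \<bullet> v)) (at u)"
      and al: "AE a in lborel. (l n has_derivative (\<lambda>v. M n a \<bullet> v)) (at a)"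
      using k l unfolding cutoff_def by blast+
    have "AE z in lborel \<Otimes>\<^sub>M lborel. (\<Psi> n has_derivative (\<lambda>v. g n z \<bullet> v)) (at z)"
      using AE_lborel_fst[OF ak] AE_lborel_snd[OF al]
    proof eventually_elim
      case (elim z)
      have f: "(fst has_derivative fst) (at z)" "(snd has_derivative snd) (at z)"
        by (auto intro!: derivative_eq_intros)
      have "(\<Psi> n has_derivative (\<lambda>v. k n (fst z) * (M n (snd z) \<bullet> snd v) + (G n (fst z) \<bullet> fst v) * l n (snd z))) (at z)"
        unfolding \<Psi>_def[abs_def]
        by (rule has_derivative_mult[OF has_derivative_compose[OF f(1) elim(1)] has_derivative_compose[OF f(2) elim(2)]])
      then show ?case by (rule has_derivative_eq_rhs) (simp add: fun_eq_iff g_def inner_prod_def algebra_simps)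
    qed
    then have ae: "AE z in lborel. (\<Psi> n has_derivative (\<lambda>v. g n z \<bullet> v)) (at z)" unfolding lborel_prod .
    have "g n \<in> borel_measurable (borel \<Otimes>\<^sub>M borel)" unfolding g_def[abs_def] by measurable
    then have gm: "g n \<in> borel_measurable borel" by (simp add: borel_prod)
    show ?thesis
      using integration_by_parts_compact[OF oO cS sS zS lip ae gm H1] by (simp add: dv_def)
  qed
  have iO: "integrable lborel (\<lambda>z. c * indicator Om z :: real)" for c
  proof -
    have "bounded Om" unfolding Om_def using bU bV by (rule bounded_Times)
    then have "emeasure lborel Om < \<infinity>" using emeasure_bounded_finite by auto
    then show ?thesis by (intro integrable_mult_right) (auto simp: integrable_indicator_iff)
  qed
  have dvm: "(\<lambda>z. indicator Om z * dv z) \<in> borel_measurable borel"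
  proof -
    have "continuous_on Om (\<lambda>z. H' z b)" for b using H1 unfolding c1_with_def by blast
    then have "continuous_on Om dv" unfolding dv_def[abs_def] by (intro continuous_intros)
    then have "(\<lambda>z. indicator Om z *\<^sub>R dv z) \<in> borel_measurable borel"
      by (intro borel_measurable_continuous_on_indicator) simp_all
    then show ?thesis by simp
  qed
  have \<Psi>m: "\<Psi> n \<in> borel_measurable borel" for n
  proof -
    have "\<Psi> n \<in> borel_measurable (borel \<Otimes>\<^sub>M borel)" unfolding \<Psi>_def[abs_def] by measurable
    then show ?thesis by (simp add: borel_prod)
  qed
  have m1: "(\<lambda>z. indicator Om z * (\<Psi> n z * dv z)) \<in> borel_measurable borel" for n
  proof -
    have "(\<lambda>z. \<Psi> n z * (indicator Om z * dv z)) \<in> borel_measurable borel" using dvm \<Psi>m by measurable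
    then show ?thesis by (simp add: mult.left_commute)
  qed
  have \<Psi>b: "0 \<le> \<Psi> n z" "\<Psi> n z \<le> 1" for n z
    unfolding \<Psi>_def using kb lb by (simp_all add: mult_le_one)
  have bnd: "AE z in lborel. norm (indicator Om z * (\<Psi> n z * dv z)) \<le> Bd * indicator Om z" for n
  proof (rule AE_I2)
    fix z show "norm (indicator Om z * (\<Psi> n z * dv z)) \<le> Bd * indicator Om z"
    proof (cases "z \<in> Om")
      case True
      have "\<bar>\<Psi> n z\<bar> * \<bar>dv z\<bar> \<le> 1 * Bd" using \<Psi>b[of n z] Bd[OF True] by (intro mult_mono) simp_all
      then show ?thesis using True by (simp add: abs_mult)
    qed simp
  qed
  have int1: "integrable lborel (\<lambda>z. indicator Om z * (\<Psi> n z * dv z))" for n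
  proof (rule Bochner_Integration.integrable_bound[OF iO[of Bd]])
    show "AE z in lborel. norm (indicator Om z * (\<Psi> n z * dv z)) \<le> norm (Bd * indicator Om z :: real)"
      using bnd[of n] by (rule eventually_mono) (unfold real_norm_def, rule order_trans[OF _ abs_ge_self])
  next
    show "(\<lambda>z. indicator Om z * (\<Psi> n z * dv z)) \<in> borel_measurable lborel" using m1[of n] by simp
  qed
  \<comment> \<open>The bound \<open>Bd\<close> on the total divergence is the majorant; the
    divergences of the two components have no such bound separately.\<close>
  have lim1: "(\<lambda>n. \<integral>z. indicator Om z * (\<Psi> n z * dv z) \<partial>lborel) \<longlonglongrightarrow> (\<integral>z. indicator Om z * dv z \<partial>lborel)"
  proof (rule integral_dominated_convergence[OF _ _ iO[of Bd] _ bnd])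
    show "AE z in lborel. (\<lambda>n. indicator Om z * (\<Psi> n z * dv z)) \<longlonglongrightarrow> indicator Om z * dv z"
    proof (rule AE_I2)
      fix z show "(\<lambda>n. indicator Om z * (\<Psi> n z * dv z)) \<longlonglongrightarrow> indicator Om z * dv z"
      proof (cases "z \<in> Om")
        case True
        then have "(\<lambda>n. k n (fst z)) \<longlonglongrightarrow> 1" "(\<lambda>n. l n (snd z)) \<longlonglongrightarrow> 1"
          using k l unfolding cutoff_def Om_def by auto
        then have "(\<lambda>n. indicator Om z * (k n (fst z) * l n (snd z) * dv z)) \<longlonglongrightarrow> indicator Om z * (1 * 1 * dv z)"
          by (intro tendsto_intros)
        then show ?thesis by (simp add: \<Psi>_def)
      qed simp
    qed
  qed (use m1 dvm in simp_all)
  have int2: "integrable lborel (\<lambda>z. indicator Om z * (g n z \<bullet> H z))" for n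
    using Bochner_Integration.integrable_diff[OF conjunct1[OF ibp[of n]] int1[of n]] by (simp add: algebra_simps)
  have eq: "(\<integral>z. indicator Om z * (\<Psi> n z * dv z) \<partial>lborel) = - (\<integral>z. indicator Om z * (g n z \<bullet> H z) \<partial>lborel)" for n
    using conjunct2[OF ibp[of n]] Bochner_Integration.integral_add[OF int1[of n] int2[of n]] by (simp add: distrib_left)
  have Hm: "(\<lambda>z. indicator Om z *\<^sub>R H z) \<in> borel_measurable borel"
    using contH by (intro borel_measurable_continuous_on_indicator) simp_all
  define H1 where "H1 z = fst (indicator Om z *\<^sub>R H z)" for z
  define H2 where "H2 z = snd (indicator Om z *\<^sub>R H z)" for z
  have mp: "(\<lambda>z. indicator Om z *\<^sub>R H z) \<in> borel_measurable (borel \<Otimes>\<^sub>M borel)" using Hm by (simp add: borel_prod)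
  have fs: "fst \<in> borel_measurable (borel :: ((real^2) \<times> (real^2)) measure)"
       "snd \<in> borel_measurable (borel :: ((real^2) \<times> (real^2)) measure)"
    by (auto intro!: borel_measurable_continuous_onI continuous_intros)
  have [measurable]: "H1 \<in> borel_measurable (borel \<Otimes>\<^sub>M borel)" "H2 \<in> borel_measurable (borel \<Otimes>\<^sub>M borel)"
    unfolding H1_def H2_def using measurable_compose[OF mp fs(1)] measurable_compose[OF mp fs(2)] by simp_all
  \<comment> \<open>In each error term the inner integral runs over the variable whose cutoff is
    differentiated, because the flux condition holds for a frozen value of the other one.\<close>
  define e1 where "e1 n = (\<integral>\<^sup>+a. \<integral>\<^sup>+u. ennreal \<bar>H1 (u, a) \<bullet> G n u\<bar> \<partial>lborel \<partial>lborel)" for n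
  define e2 where "e2 n = (\<integral>\<^sup>+u. \<integral>\<^sup>+a. ennreal \<bar>H2 (u, a) \<bullet> M n a\<bar> \<partial>lborel \<partial>lborel)" for n
  have e1: "e1 n = (\<integral>\<^sup>+z. ennreal \<bar>H1 z \<bullet> G n (fst z)\<bar> \<partial>(lborel \<Otimes>\<^sub>M lborel))" for n
    unfolding e1_def by (subst lborel_pair.nn_integral_snd[symmetric]) simp_all
  have e2: "e2 n = (\<integral>\<^sup>+z. ennreal \<bar>H2 z \<bullet> M n (snd z)\<bar> \<partial>(lborel \<Otimes>\<^sub>M lborel))" for n
    unfolding e2_def by (subst lborel.nn_integral_fst[symmetric]) simp_all
  have le: "ennreal \<bar>\<integral>z. indicator Om z * (g n z \<bullet> H z) \<partial>lborel\<bar> \<le> e1 n + e2 n" for n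
  proof -
    have "ennreal \<bar>\<integral>z. indicator Om z * (g n z \<bullet> H z) \<partial>lborel\<bar>
       \<le> (\<integral>\<^sup>+z. ennreal (norm (indicator Om z * (g n z \<bullet> H z))) \<partial>lborel)"
      using integral_norm_bound_ennreal[OF int2[of n]] by simp
    also have "\<dots> \<le> (\<integral>\<^sup>+z. ennreal \<bar>H1 z \<bullet> G n (fst z)\<bar> + ennreal \<bar>H2 z \<bullet> M n (snd z)\<bar> \<partial>lborel)"
    proof (rule nn_integral_mono)
      fix z :: "(real^2) \<times> (real^2)"
      have "indicator Om z * (g n z \<bullet> H z) = l n (snd z) * (H1 z \<bullet> G n (fst z)) + k n (fst z) * (H2 z \<bullet> M n (snd z))"
        by (simp add: H1_def H2_def g_def inner_prod_def inner_commute algebra_simps)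
      also have "\<bar>\<dots>\<bar> \<le> l n (snd z) * \<bar>H1 z \<bullet> G n (fst z)\<bar> + k n (fst z) * \<bar>H2 z \<bullet> M n (snd z)\<bar>"
        using kb lb by (intro order_trans[OF abs_triangle_ineq]) (simp add: abs_mult)
      also have "\<dots> \<le> 1 * \<bar>H1 z \<bullet> G n (fst z)\<bar> + 1 * \<bar>H2 z \<bullet> M n (snd z)\<bar>"
        using kb lb by (intro add_mono mult_right_mono) simp_all
      finally have "ennreal (norm (indicator Om z * (g n z \<bullet> H z))) \<le> ennreal (\<bar>H1 z \<bullet> G n (fst z)\<bar> + \<bar>H2 z \<bullet> M n (snd z)\<bar>)"
        by (intro ennreal_leI) (simp only: real_norm_def mult_1)
      then show "ennreal (norm (indicator Om z * (g n z \<bullet> H z))) \<le> ennreal \<bar>H1 z \<bullet> G n (fst z)\<bar> + ennreal \<bar>H2 z \<bullet> M n (snd z)\<bar>"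
        by (simp only: ennreal_plus[OF abs_ge_zero abs_ge_zero])
    qed
    also have "\<dots> = e1 n + e2 n"
      unfolding e1 e2 lborel_prod[symmetric] by (rule nn_integral_add) measurable
    finally show ?thesis .
  qed
  have l1: "e1 \<longlonglongrightarrow> 0"
  proof -
    have eq: "H1 (u, a) = indicator (V \<times> U) (a, u) *\<^sub>R fst (H (u, a))" for u a
      by (cases "a \<in> V"; cases "u \<in> U") (simp_all add: H1_def Om_def)
    have "(\<lambda>n. \<integral>\<^sup>+a. \<integral>\<^sup>+u. ennreal \<bar>(indicator (V \<times> U) (a, u) *\<^sub>R fst (H (u, a))) \<bullet> G n u\<bar> \<partial>lborel \<partial>lborel) \<longlonglongrightarrow> 0"
    proof (rule cutoff_term_tendsto_0[OF k oU oV bV])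
      fix a assume a: "a \<in> V"
      have "continuous_on U (\<lambda>u. fst (H (u, a)))"
        using a by (intro continuous_on_fst continuous_on_compose2[OF contH] continuous_intros) (auto simp: Om_def)
      moreover have nB: "norm (fst (H (u, a))) \<le> B" if "u \<in> U" for u
        using order_trans[OF norm_fst_le[of "fst (H (u, a))" "snd (H (u, a))"], of B] B[of "(u, a)"] a that by (simp add: Om_def)
      moreover have "bounded ((\<lambda>u. fst (H (u, a))) ` U)"
        unfolding bounded_iff by (intro exI[of _ B]) (simp add: nB)
      ultimately show "vanishing_flux U (domain_normal U {}) (\<lambda>u. fst (H (u, a)))"
        unfolding vanishing_flux_def domain_normal_def using fluxU a by (simp add: V_def)
      fix u assume "u \<in> U"
      then show "norm (fst (H (u, a))) \<le> B" by (rule nB)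
    next
      fix n
      show "(\<lambda>a. \<integral>\<^sup>+u. ennreal \<bar>(indicator (V \<times> U) (a, u) *\<^sub>R fst (H (u, a))) \<bullet> G n u\<bar> \<partial>lborel) \<in> borel_measurable lborel"
        unfolding eq[symmetric] by measurable
    qed
    then show ?thesis unfolding e1_def[abs_def] eq .
  qed
  have l2: "e2 \<longlonglongrightarrow> 0"
  proof -
    have eq: "H2 (u, a) = indicator (U \<times> V) (u, a) *\<^sub>R snd (H (u, a))" for u a
      by (simp add: H2_def Om_def)
    have "(\<lambda>n. \<integral>\<^sup>+u. \<integral>\<^sup>+a. ennreal \<bar>(indicator (U \<times> V) (u, a) *\<^sub>R snd (H (u, a))) \<bullet> M n a\<bar> \<partial>lborel \<partial>lborel) \<longlonglongrightarrow> 0"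
    proof (rule cutoff_term_tendsto_0[OF l oV oU bU])
      fix u assume u: "u \<in> U"
      have "continuous_on V (\<lambda>a. snd (H (u, a)))"
        using u by (intro continuous_on_snd continuous_on_compose2[OF contH] continuous_intros) (auto simp: Om_def)
      moreover have nB: "norm (snd (H (u, a))) \<le> B" if "a \<in> V" for a
        using order_trans[OF norm_snd_le[of "snd (H (u, a))" "fst (H (u, a))"], of B] B[of "(u, a)"] u that by (simp add: Om_def)
      moreover have "bounded ((\<lambda>a. snd (H (u, a))) ` V)"
        unfolding bounded_iff by (intro exI[of _ B]) (simp add: nB)
      ultimately show "vanishing_flux V (domain_normal W X) (\<lambda>a. snd (H (u, a)))"
        unfolding vanishing_flux_def domain_normal_def using fluxW u by (simp add: V_def)
      fix a assume "a \<in> V"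
      then show "norm (snd (H (u, a))) \<le> B" by (rule nB)
    next
      fix n
      show "(\<lambda>u. \<integral>\<^sup>+a. ennreal \<bar>(indicator (U \<times> V) (u, a) *\<^sub>R snd (H (u, a))) \<bullet> M n a\<bar> \<partial>lborel) \<in> borel_measurable lborel"
        unfolding eq[symmetric] by measurable
    qed
    then show ?thesis unfolding e2_def[abs_def] eq .
  qed
  have "(\<lambda>n. e1 n + e2 n) \<longlonglongrightarrow> 0" using tendsto_add[OF l1 l2] by simp
  then have "(\<lambda>n. ennreal \<bar>\<integral>z. indicator Om z * (g n z \<bullet> H z) \<partial>lborel\<bar>) \<longlonglongrightarrow> 0"
    by (rule tendsto_sandwich[OF always_eventually[OF allI[OF zero_le]] always_eventually[OF allI[OF le]] tendsto_const])
  then have "(\<lambda>n. \<bar>\<integral>z. indicator Om z * (g n z \<bullet> H z) \<partial>lborel\<bar>) \<longlonglongrightarrow> 0"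
    unfolding ennreal_0[symmetric] by (subst (asm) tendsto_ennreal_iff) simp_all
  then have "(\<lambda>n. \<integral>z. indicator Om z * (g n z \<bullet> H z) \<partial>lborel) \<longlonglongrightarrow> 0" by (rule tendsto_rabs_zero_cancel)
  then have "(\<lambda>n. \<integral>z. indicator Om z * (\<Psi> n z * dv z) \<partial>lborel) \<longlonglongrightarrow> - 0" unfolding eq by (rule tendsto_minus)
  then have "(\<integral>z. indicator Om z * dv z \<partial>lborel) = 0" using LIMSEQ_unique[OF lim1] by simp
  then show ?thesis by (simp add: Om_def V_def dv_def)
qed


subsection \<open>Continuously differentiable functions and the tangential operators\<close>

lemma c1_with_subset: "c1_with G \<phi> \<phi>' \<Longrightarrow> A \<subseteq> G \<Longrightarrow> c1_with A \<phi> \<phi>'"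
  unfolding c1_with_def by (meson continuous_on_subset subsetD)

lemma c1_with_continuous: "c1_with G \<phi> \<phi>' \<Longrightarrow> continuous_on G \<phi>"
  unfolding c1_with_def by (meson has_derivative_continuous continuous_at_imp_continuous_on)

lemma c1_with_cong:
  assumes "c1_with G \<phi> \<phi>'" "open G" "\<And>z. z \<in> G \<Longrightarrow> \<psi> z = \<phi> z"
  shows "c1_with G \<psi> \<phi>'"
  using assms unfolding c1_with_def by (metis has_derivative_transform_within_open)

text \<open>Passing from bounded linear functions to plain ones lets later derivatives be written as
  explicit terms.\<close>

lemma C1_on_imp_c1_with:
  assumes "C1_on G \<phi>" obtains \<phi>' where "c1_with G \<phi> \<phi>'"
proof -
  obtain D where D: "\<And>z. z \<in> G \<Longrightarrow> (\<phi> has_derivative blinfun_apply (D z)) (at z)" "continuous_on G D"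
    using assms unfolding C1_on_def by blast
  have "c1_with G \<phi> (\<lambda>z. blinfun_apply (D z))"
    unfolding c1_with_def using D by (auto intro!: continuous_intros)
  then show ?thesis by (rule that)
qed

lemma c1_with_const: "c1_with G (\<lambda>z. c) (\<lambda>z v. 0)"
  by (simp add: c1_with_def)

lemma c1_with_add:
  "c1_with G \<phi> \<phi>' \<Longrightarrow> c1_with G \<psi> \<psi>' \<Longrightarrow> c1_with G (\<lambda>z. \<phi> z + \<psi> z) (\<lambda>z v. \<phi>' z v + \<psi>' z v)"
  unfolding c1_with_def by (auto intro!: has_derivative_add continuous_intros)

lemma c1_with_diff:
  "c1_with G \<phi> \<phi>' \<Longrightarrow> c1_with G \<psi> \<psi>' \<Longrightarrow> c1_with G (\<lambda>z. \<phi> z - \<psi> z) (\<lambda>z v. \<phi>' z v - \<psi>' z v)"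
  unfolding c1_with_def by (auto intro!: has_derivative_diff continuous_intros)

lemma c1_with_sum:
  "(\<And>i. i \<in> I \<Longrightarrow> c1_with G (\<phi> i) (\<phi>' i)) \<Longrightarrow> c1_with G (\<lambda>z. \<Sum>i\<in>I. \<phi> i z) (\<lambda>z v. \<Sum>i\<in>I. \<phi>' i z v)"
  unfolding c1_with_def by (auto intro!: has_derivative_sum continuous_intros)

lemma c1_with_scaleR:
  assumes f: "c1_with G f f'" and F: "c1_with G F F'"
  shows "c1_with G (\<lambda>z. f z *\<^sub>R F z) (\<lambda>z v. f z *\<^sub>R F' z v + f' z v *\<^sub>R F z)"
  using f F c1_with_continuous[OF f] c1_with_continuous[OF F]
  unfolding c1_with_def by (auto intro!: has_derivative_scaleR continuous_intros)

lemma c1_with_mult: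
  fixes f g :: "'a::real_normed_vector \<Rightarrow> real"
  assumes f: "c1_with G f f'" and F: "c1_with G g g'"
  shows "c1_with G (\<lambda>z. f z * g z) (\<lambda>z v. f z * g' z v + f' z v * g z)"
  using c1_with_scaleR[OF assms] by simp

lemma c1_with_Pair:
  "c1_with G \<phi> \<phi>' \<Longrightarrow> c1_with G \<psi> \<psi>' \<Longrightarrow> c1_with G (\<lambda>z. (\<phi> z, \<psi> z)) (\<lambda>z v. (\<phi>' z v, \<psi>' z v))"
  unfolding c1_with_def by (auto intro!: has_derivative_Pair continuous_intros)

lemma c1_with_bounded_linear:
  assumes L: "bounded_linear L" and \<phi>: "c1_with G \<phi> \<phi>'"
  shows "c1_with G (\<lambda>z. L (\<phi> z)) (\<lambda>z v. L (\<phi>' z v))"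
  using \<phi> unfolding c1_with_def
  by (auto intro!: bounded_linear.has_derivative[OF L] bounded_linear.continuous_on[OF L])

lemma c1_with_compose_linear:
  assumes j: "bounded_linear j" and \<phi>: "c1_with G \<phi> \<phi>'" and A: "\<And>z. z \<in> A \<Longrightarrow> j z \<in> G"
  shows "c1_with A (\<lambda>z. \<phi> (j z)) (\<lambda>z v. \<phi>' (j z) (j v))"
  unfolding c1_with_def
proof (intro conjI ballI allI)
  fix z assume z: "z \<in> A"
  have "(\<phi> has_derivative \<phi>' (j z)) (at (j z))" using \<phi> A[OF z] by (simp add: c1_with_def)
  then show "((\<lambda>z. \<phi> (j z)) has_derivative (\<lambda>v. \<phi>' (j z) (j v))) (at z)"
    by (rule has_derivative_compose[OF bounded_linear_imp_has_derivative[OF j]])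
next
  fix v
  have "continuous_on G (\<lambda>z. \<phi>' z (j v))" using \<phi> by (simp add: c1_with_def)
  then show "continuous_on A (\<lambda>z. \<phi>' (j z) (j v))"
    by (rule continuous_on_compose2) (use A linear_continuous_on[OF j] in auto)
qed

lemma c1_with_real_compose:
  fixes h h' :: "real \<Rightarrow> real"
  assumes h: "\<And>x. x \<in> S \<Longrightarrow> (h has_real_derivative h' x) (at x)" "continuous_on S h'"
    and f: "c1_with G f f'" and fS: "\<And>z. z \<in> G \<Longrightarrow> f z \<in> S"
  shows "c1_with G (\<lambda>z. h (f z)) (\<lambda>z v. h' (f z) * f' z v)"
  unfolding c1_with_def
proof (intro conjI ballI allI)
  fix z assume z: "z \<in> G"
  have "(f has_derivative f' z) (at z)" using f z by (simp add: c1_with_def)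
  from has_derivative_compose[OF this h(1)[OF fS[OF z], unfolded has_field_derivative_def]]
  show "((\<lambda>z. h (f z)) has_derivative (\<lambda>v. h' (f z) * f' z v)) (at z)" .
next
  fix v
  have "continuous_on G (\<lambda>z. h' (f z))"
    by (rule continuous_on_compose2[OF h(2) c1_with_continuous[OF f]]) (use fS in auto)
  then show "continuous_on G (\<lambda>z. h' (f z) * f' z v)"
    using f unfolding c1_with_def by (intro continuous_intros) simp_all
qed

lemma c1_with_norm:
  fixes f :: "'a::real_normed_vector \<Rightarrow> 'b::real_inner"
  assumes f: "c1_with G f f'" and f0: "\<And>z. z \<in> G \<Longrightarrow> f z \<noteq> 0"
  shows "c1_with G (\<lambda>z. norm (f z)) (\<lambda>z v. sgn (f z) \<bullet> f' z v)"
  unfolding c1_with_def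
proof (intro conjI ballI allI)
  fix z assume z: "z \<in> G"
  have 1: "(f has_derivative f' z) (at z)" using f z by (simp add: c1_with_def)
  have "(norm has_derivative (\<lambda>v. sgn (f z) \<bullet> v)) (at (f z))"
    using has_derivative_norm[OF f0[OF z]] by (simp add: inner_commute)
  from has_derivative_compose[OF 1 this] show "((\<lambda>z. norm (f z)) has_derivative (\<lambda>v. sgn (f z) \<bullet> f' z v)) (at z)" .
next
  fix v
  show "continuous_on G (\<lambda>z. sgn (f z) \<bullet> f' z v)"
    using f f0 c1_with_continuous[OF f] unfolding sgn_div_norm c1_with_def by (intro continuous_intros) auto
qed

text \<open>Meant for the gradient of the energy in \<open>a\<close>, a combination of the unit
  vectors \<open>sgn (a - x j)\<close>. Only the existence of a continuous derivative matters, so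
  its formula is left open.\<close>

lemma c1_with_sgn:
  fixes f :: "'a::real_normed_vector \<Rightarrow> 'b::real_inner"
  assumes f: "c1_with G f f'" and f0: "\<And>z. z \<in> G \<Longrightarrow> f z \<noteq> 0"
  obtains g' where "c1_with G (\<lambda>z. sgn (f z)) g'"
proof -
  have "c1_with G (\<lambda>z. inverse (norm (f z))) (\<lambda>z v. (- (inverse (norm (f z)) ^ 2)) * (sgn (f z) \<bullet> f' z v))"
    by (rule c1_with_real_compose[where S="{0<..}" and h'="\<lambda>x. - (inverse x ^ 2)", OF _ _ c1_with_norm[OF f f0]])
      (use f0 in \<open>auto intro!: derivative_eq_intros continuous_intros simp: power2_eq_square\<close>)
  from c1_with_scaleR[OF this f] show ?thesis unfolding sgn_div_norm[symmetric] by (rule that)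
qed

section \<open>Gradients and divergences in terms of Frechet derivatives and traces\<close>

lemma partial_deriv_eq:
  assumes "(\<phi> has_derivative \<phi>') (at p)"
  shows "partial_deriv i \<phi> p = \<phi>' (axis i 1)"
proof -
  have lin: "linear \<phi>'" using assms by (rule has_derivative_linear)
  have "((\<lambda>s. p + s *\<^sub>R axis i 1) has_derivative (\<lambda>s. s *\<^sub>R axis i 1)) (at 0)"
    by (auto intro!: derivative_eq_intros)
  from has_derivative_compose[OF this, of \<phi> \<phi>'] assms
  have "((\<lambda>s. \<phi> (p + s *\<^sub>R axis i 1)) has_derivative (\<lambda>s. \<phi>' (s *\<^sub>R axis i 1))) (at 0)" by simp
  then have "((\<lambda>s. \<phi> (p + s *\<^sub>R axis i 1)) has_real_derivative \<phi>' (axis i 1)) (at 0)"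
    unfolding has_field_derivative_def
    by (rule has_derivative_eq_rhs) (simp add: fun_eq_iff linear_cmul[OF lin] mult.commute)
  then show ?thesis unfolding partial_deriv_def by (rule DERIV_imp_deriv)
qed

lemma grad_inner:
  assumes "(\<phi> has_derivative \<phi>') (at p)"
  shows "grad \<phi> p \<bullet> v = \<phi>' v"
proof -
  have lin: "linear \<phi>'" using assms by (rule has_derivative_linear)
  have "v = (\<Sum>i\<in>UNIV. v $ i *\<^sub>R axis i 1)"
    using basis_expansion[of v] by (simp add: scalar_mult_eq_scaleR)
  then have "\<phi>' v = \<phi>' (\<Sum>i\<in>UNIV. v $ i *\<^sub>R axis i 1)" by (rule arg_cong)
  also have "\<dots> = (\<Sum>i\<in>UNIV. v $ i * \<phi>' (axis i 1))"
    by (simp add: linear_sum[OF lin] linear_cmul[OF lin])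
  finally show ?thesis by (simp add: inner_vec_def grad_def partial_deriv_eq[OF assms] mult.commute)
qed

lemma grad_eqI:
  assumes "(\<phi> has_derivative (\<lambda>v. w \<bullet> v)) (at p)" shows "grad \<phi> p = w"
  using grad_inner[OF assms] by (metis vector_eq_rdot)

lemma diverg_eq:
  assumes "(F has_derivative F') (at p)"
  shows "diverg F p = (\<Sum>i\<in>UNIV. F' (axis i 1) \<bullet> axis i 1)"
proof -
  have "((\<lambda>q. F q $ i) has_derivative (\<lambda>v. F' v $ i)) (at p)" for i
    by (rule bounded_linear.has_derivative[OF bounded_linear_vec_nth assms])
  note d = this
  show ?thesis by (simp add: diverg_def grad_def partial_deriv_eq[OF d] inner_axis)
qed

lemma tgrad_nth: "tgrad \<phi> p $ i = grad \<phi> p $ i - (\<Sum>j\<in>UNIV. grad \<phi> p $ j) / 3"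
proof -
  have "tgrad \<phi> p = grad \<phi> p - ((1/3) *\<^sub>R ones_matrix) *v grad \<phi> p"
    by (simp add: tgrad_def matrix_vector_mult_diff_rdistrib)
  then show ?thesis
    by (simp add: matrix_vector_mult_def ones_matrix_def sum_divide_distrib)
qed

lemma tgrad_in_plane: "tgrad \<phi> p \<in> misor_plane"
  by (simp add: misor_plane_def tgrad_nth sum_3 field_simps)

text \<open>The matrix in \<open>tgrad\<close> is the orthogonal projection onto the plane, which is
  self-adjoint and fixes vectors of the plane.\<close>

lemma tgrad_inner_plane: "v \<in> misor_plane \<Longrightarrow> tgrad \<phi> p \<bullet> v = grad \<phi> p \<bullet> v"
proof -
  assume "v \<in> misor_plane"
  then have v: "v $ 3 = - v $ 1 - v $ 2" by (simp add: misor_plane_def)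
  show ?thesis by (simp add: inner_vec_def tgrad_nth sum_3 v) (simp add: field_simps)
qed

lemma tgrad_inner:
  assumes "(\<phi> has_derivative \<phi>') (at p)"
  shows "tgrad \<phi> p \<bullet> plane_iso u = \<phi>' (plane_iso u)"
proof -
  have "plane_iso u \<in> misor_plane" using plane_iso_range by blast
  then show ?thesis by (simp only: tgrad_inner_plane grad_inner[OF assms])
qed

lemma plane_iso_inner: "plane_iso u \<bullet> plane_iso v = u \<bullet> v"
proof -
  have "norm (plane_iso u + plane_iso v) = norm (u + v)"
    by (simp add: linear_add[OF plane_iso_linear, symmetric] plane_iso_norm)
  then show ?thesis by (simp add: dot_norm plane_iso_norm)
qed

text \<open>The adjoint of \<open>plane_iso\<close>: orthogonal projection onto the plane followed
  by the inverse isometry.\<close>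

definition plane_coord :: "real^3 \<Rightarrow> real^2" where
  "plane_coord v = (\<chi> j. v \<bullet> plane_iso (axis j 1))"

lemma plane_coord_inner: "plane_coord v \<bullet> u = v \<bullet> plane_iso u"
proof -
  have "u = (\<Sum>j\<in>UNIV. u $ j *\<^sub>R axis j 1)"
    using basis_expansion[of u] by (simp add: scalar_mult_eq_scaleR)
  then have "plane_iso u = plane_iso (\<Sum>j\<in>UNIV. u $ j *\<^sub>R axis j 1)" by (rule arg_cong)
  also have "\<dots> = (\<Sum>j\<in>UNIV. u $ j *\<^sub>R plane_iso (axis j 1))"
    by (simp add: linear_sum[OF plane_iso_linear] linear_cmul[OF plane_iso_linear])
  finally show ?thesis by (simp add: inner_sum_right plane_coord_def inner_vec_def[of "vec_lambda _"] mult.commute)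
qed

lemma plane_coord_plane_iso: "plane_coord (plane_iso u) = u"
  by (metis plane_coord_inner plane_iso_inner vector_eq_rdot)

lemma plane_iso_plane_coord: "v \<in> misor_plane \<Longrightarrow> plane_iso (plane_coord v) = v"
proof -
  assume "v \<in> misor_plane"
  then obtain u where "v = plane_iso u" unfolding plane_iso_range[symmetric] by blast
  then show ?thesis by (simp only: plane_coord_plane_iso)
qed

lemma plane_coord_linear: "linear plane_coord"
  by (rule linearI) (simp_all add: plane_coord_def vec_eq_iff inner_add_left)

lemma plane_coord_norm_le: "norm (plane_coord v) \<le> norm v"
proof -
  have "norm (plane_coord v) * norm (plane_coord v) = v \<bullet> plane_iso (plane_coord v)"
    by (simp add: plane_coord_inner[symmetric] power2_norm_eq_inner[symmetric] power2_eq_square[symmetric])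
  also have "\<dots> \<le> norm v * norm (plane_coord v)" using norm_cauchy_schwarz[of v "plane_iso (plane_coord v)"] unfolding plane_iso_norm .
  finally show ?thesis by (cases "plane_coord v = 0") auto
qed

text \<open>The tangential gradient of each component of \<open>F\<close> lies in the plane and
  expands in the orthonormal basis \<open>plane_iso (axis j 1)\<close>. Exchanging the two sums
  leaves the trace of \<open>F'\<close> along the plane, which is what the divergence becomes in
  planar coordinates.\<close>

lemma tdiverg_eq:
  assumes F: "(F has_derivative F') (at p)"
  shows "tdiverg F p = (\<Sum>j\<in>UNIV. F' (plane_iso (axis j 1)) \<bullet> plane_iso (axis j 1))"
proof -
  have d: "((\<lambda>q. F q $ i) has_derivative (\<lambda>v. F' v $ i)) (at p)" for i
    by (rule bounded_linear.has_derivative[OF bounded_linear_vec_nth F])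
  have "tgrad (\<lambda>q. F q $ i) p = (\<Sum>j\<in>UNIV. F' (plane_iso (axis j 1)) $ i *\<^sub>R plane_iso (axis j 1))" for i
  proof -
    have "tgrad (\<lambda>q. F q $ i) p = plane_iso (plane_coord (tgrad (\<lambda>q. F q $ i) p))"
      by (simp add: plane_iso_plane_coord tgrad_in_plane)
    also have "plane_coord (tgrad (\<lambda>q. F q $ i) p) = (\<Sum>j\<in>UNIV. F' (plane_iso (axis j 1)) $ i *\<^sub>R axis j 1)"
      by (simp add: plane_coord_def tgrad_inner[OF d] vec_eq_iff forall_2 sum_2 axis_def)
    also have "plane_iso \<dots> = (\<Sum>j\<in>UNIV. F' (plane_iso (axis j 1)) $ i *\<^sub>R plane_iso (axis j 1))"
      by (simp add: linear_sum[OF plane_iso_linear] linear_cmul[OF plane_iso_linear])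
    finally show ?thesis .
  qed
  then have "tdiverg F p = (\<Sum>i\<in>UNIV. \<Sum>j\<in>UNIV. F' (plane_iso (axis j 1)) $ i * plane_iso (axis j 1) $ i)"
    by (simp add: tdiverg_def)
  also have "\<dots> = (\<Sum>j\<in>UNIV. \<Sum>i\<in>UNIV. F' (plane_iso (axis j 1)) $ i * plane_iso (axis j 1) $ i)"
    by (rule sum.swap)
  finally show ?thesis by (simp add: inner_vec_def)
qed

lemma sum_Basis_vec2: "(\<Sum>b\<in>Basis. f b) = (\<Sum>i\<in>UNIV. f (axis i 1 :: real^2))"
proof -
  have B: "(Basis :: (real^2) set) = (\<lambda>i. axis i 1) ` UNIV" by (auto simp: Basis_vec_def)
  have "inj (\<lambda>i. axis i (1::real) :: real^2)" by (auto intro!: injI simp: axis_eq_axis)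
  then show ?thesis unfolding B by (simp add: sum.reindex)
qed

lemma sum_Basis_prod_vec2:
  "(\<Sum>b\<in>Basis. f b) = (\<Sum>i\<in>UNIV. f (axis i 1 :: real^2, 0)) + (\<Sum>i\<in>UNIV. f (0, axis i 1 :: real^2))"
proof -
  have "(\<Sum>b\<in>Basis. f b) = (\<Sum>u\<in>Basis. f (u :: real^2, 0)) + (\<Sum>v\<in>Basis. f (0, v :: real^2))"
    unfolding Basis_prod_def by (subst sum.union_disjoint) (auto simp: sum.reindex inj_on_def)
  then show ?thesis by (simp add: sum_Basis_vec2)
qed


subsection \<open>The misorientation domain as a planar hexagon\<close>

text \<open>The witness is the minimum of the affine functions. It presents a corner, where several
  edges meet, as one Lipschitz graph.\<close>

lemma lipschitz_min_affine:
  fixes h s :: "'i \<Rightarrow> real"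
  assumes "finite A" "A \<noteq> {}"
  shows "\<exists>g L. L-lipschitz_on UNIV g \<and> (\<forall>t y. y < g t \<longleftrightarrow> (\<forall>i\<in>A. y < h i - s i * t))"
  using assms
proof (induction rule: finite_ne_induct)
  case (singleton i)
  have "\<bar>s i\<bar>-lipschitz_on UNIV (\<lambda>t. h i - s i * t)"
    by (rule lipschitz_onI) (simp_all add: dist_real_def abs_mult[symmetric] right_diff_distrib abs_minus_commute)
  then show ?case by (intro exI[of _ "\<lambda>t. h i - s i * t"] exI[of _ "\<bar>s i\<bar>"]) simp
next
  case (insert i F)
  then obtain g L where g: "L-lipschitz_on UNIV g" "\<And>t y. y < g t \<longleftrightarrow> (\<forall>i\<in>F. y < h i - s i * t)" by blast
  have "(max L \<bar>s i\<bar>)-lipschitz_on UNIV (\<lambda>t. min (g t) (h i - s i * t))"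
  proof (rule lipschitz_onI)
    fix t u :: real
    have 1: "\<bar>g t - g u\<bar> \<le> max L \<bar>s i\<bar> * \<bar>t - u\<bar>"
      using lipschitz_onD[OF g(1), of t u] mult_right_mono[of L "max L \<bar>s i\<bar>" "\<bar>t - u\<bar>"] by (simp add: dist_real_def)
    have "\<bar>(h i - s i * t) - (h i - s i * u)\<bar> = \<bar>s i\<bar> * \<bar>t - u\<bar>"
      by (simp add: abs_mult[symmetric] right_diff_distrib abs_minus_commute)
    also have "\<dots> \<le> max L \<bar>s i\<bar> * \<bar>t - u\<bar>" by (intro mult_right_mono) simp_all
    finally have 2: "\<bar>(h i - s i * t) - (h i - s i * u)\<bar> \<le> max L \<bar>s i\<bar> * \<bar>t - u\<bar>" .
    show "dist (min (g t) (h i - s i * t)) (min (g u) (h i - s i * u)) \<le> max L \<bar>s i\<bar> * dist t u"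
      using 1 2 unfolding dist_real_def by linarith
  qed simp
  then show ?case using g(2) by (intro exI[of _ "\<lambda>t. min (g t) (h i - s i * t)"] exI[of _ "max L \<bar>s i\<bar>"]) auto
qed

text \<open>Two different common points have a difference orthogonal to both \<open>n\<close> and
  \<open>n'\<close>, so these are parallel; the common offset \<open>c > 0\<close> then makes them
  equal.\<close>

lemma two_edges_meet_at_most_once:
  fixes n n' :: "real^2"
  assumes c: "c > 0" and ne: "n \<noteq> n'" and p: "n \<bullet> p = c" "n' \<bullet> p = c" and q: "n \<bullet> q = c" "n' \<bullet> q = c"
  shows "p = q"
proof (rule ccontr)
  assume "p \<noteq> q"
  define d where "d = p - q"
  have d: "n$1 * d$1 + n$2 * d$2 = 0" "n'$1 * d$1 + n'$2 * d$2 = 0"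
    using p q by (simp_all add: d_def inner_vec_def sum_2 algebra_simps)
  have "d \<noteq> 0" using \<open>p \<noteq> q\<close> by (simp add: d_def)
  then have d0: "d$1 \<noteq> 0 \<or> d$2 \<noteq> 0" by (simp add: vec_eq_iff forall_2)
  have "(n$1 * n'$2 - n$2 * n'$1) * d$1 = n'$2 * (n$1 * d$1 + n$2 * d$2) - n$2 * (n'$1 * d$1 + n'$2 * d$2)"
       "(n$1 * n'$2 - n$2 * n'$1) * d$2 = n$1 * (n'$1 * d$1 + n'$2 * d$2) - n'$1 * (n$1 * d$1 + n$2 * d$2)"
    by (simp_all add: algebra_simps)
  then have det: "n$1 * n'$2 = n$2 * n'$1" using d d0 by auto
  have pp: "n$1 * p$1 + n$2 * p$2 = c" "n'$1 * p$1 + n'$2 * p$2 = c"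
    using p by (simp_all add: inner_vec_def sum_2)
  have "n'$1 * (n$1 * p$1 + n$2 * p$2) = n$1 * (n'$1 * p$1 + n'$2 * p$2)"
    using det by (simp add: algebra_simps)
  moreover have "n'$2 * (n$1 * p$1 + n$2 * p$2) = n$2 * (n'$1 * p$1 + n'$2 * p$2)"
    using det by (simp add: algebra_simps)
  ultimately have "n'$1 = n$1" "n'$2 = n$2" using pp c by auto
  then show False using ne by (simp add: vec_eq_iff forall_2)
qed

text \<open>Near a boundary point \<open>p\<close> only the active constraints count. After
  \<open>p\<close> is rotated onto the second axis, \<open>n \<bullet> p = c > 0\<close> makes the
  second component of every active normal positive, so each active constraint bounds the second
  coordinate by an affine function of the first. A point with a single active constraint has the
  normal of that edge; points without a normal lie on two different edges, which meet at most
  once.\<close>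

lemma regular_domain_polygon:
  fixes K :: "(real^2) set"
  assumes K: "finite K" and c: "c > 0" and b: "bounded {y. \<forall>n\<in>K. n \<bullet> y < c}"
  shows "regular_domain {y. \<forall>n\<in>K. n \<bullet> y < c}"
proof -
  define P where "P = {y. \<forall>n\<in>K. n \<bullet> y < c}"
  have P_eq: "P = (\<Inter>n\<in>K. {y. n \<bullet> y < c})" by (auto simp: P_def)
  have oP: "open P" unfolding P_eq using K by (intro open_INT) (auto simp: open_halfspace_lt)
  have cP: "convex P" unfolding P_eq by (intro convex_INT convex_halfspace_lt)
  have zP: "0 \<in> P" using c by (simp add: P_def)
  have clP: "n \<bullet> p \<le> c" if "n \<in> K" "p \<in> closure P" for n p
  proof -
    have "closure P \<subseteq> {y. n \<bullet> y \<le> c}"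
      using that(1) by (intro closure_minimal closed_halfspace_le) (auto simp: P_def less_imp_le)
    then show ?thesis using that(2) by auto
  qed
  define act where "act p = {n \<in> K. n \<bullet> p = c}" for p
  have near: "\<exists>r>0. \<forall>y\<in>ball p r. y \<in> P \<longleftrightarrow> (\<forall>n\<in>act p. n \<bullet> y < c)" if p: "p \<in> closure P" for p
  proof -
    have "open (\<Inter>n\<in>K - act p. {y. n \<bullet> y < c})" using K by (intro open_INT) (auto simp: open_halfspace_lt)
    moreover have "p \<in> (\<Inter>n\<in>K - act p. {y. n \<bullet> y < c})"
      using clP[OF _ p] by (auto simp: act_def less_le)
    ultimately obtain r where "r > 0" "ball p r \<subseteq> (\<Inter>n\<in>K - act p. {y. n \<bullet> y < c})"
      by (meson openE)
    then show ?thesis by (intro exI[of _ r]) (auto simp: P_def act_def)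
  qed
  have fr: "p \<in> closure P" "p \<notin> P" if "p \<in> frontier P" for p
    using that oP by (auto simp: frontier_def interior_open)
  have act_ne: "act p \<noteq> {}" if "p \<in> frontier P" for p
    using near[OF fr(1)[OF that]] fr(2)[OF that] by (metis centre_in_ball empty_iff)
  have lip: "lipschitz_boundary P"
    unfolding lipschitz_boundary_def
  proof
    fix p assume p: "p \<in> frontier P"
    have p0: "p \<noteq> 0" using fr(2)[OF p] zP by blast
    obtain R :: "real^2 \<Rightarrow> real^2" where R: "orthogonal_transformation R" "R p = norm p *\<^sub>R axis 2 1"
      using orthogonal_transformation_exists[of p "norm p *\<^sub>R axis 2 1"] by auto
    have inner: "n \<bullet> y = R n $ 1 * R y $ 1 + R n $ 2 * R y $ 2" for n y
    proof -
      have "n \<bullet> y = R n \<bullet> R y" using R(1) by (simp add: orthogonal_transformation_def)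
      then show ?thesis by (simp add: inner_vec_def sum_2)
    qed
    have pos: "R n $ 2 > 0" if "n \<in> act p" for n
    proof -
      have "R n $ 2 * norm p = c" using that inner[of n p] R(2) by (simp add: act_def axis_def)
      then show ?thesis using c p0 by (metis norm_ge_zero zero_less_mult_pos2 zero_less_norm_iff)
    qed
    obtain g L where g: "L-lipschitz_on UNIV g"
        "\<And>t y. y < g t \<longleftrightarrow> (\<forall>n\<in>act p. y < c / R n $ 2 - (R n $ 1 / R n $ 2) * t)"
      using lipschitz_min_affine[of "act p" "\<lambda>n. c / R n $ 2" "\<lambda>n. R n $ 1 / R n $ 2"] act_ne[OF p] K
      by (auto simp: act_def)
    obtain r where r: "r > 0" "\<And>y. y \<in> ball p r \<Longrightarrow> y \<in> P \<longleftrightarrow> (\<forall>n\<in>act p. n \<bullet> y < c)"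
      using near[OF fr(1)[OF p]] by blast
    have "n \<bullet> y < c \<longleftrightarrow> R y $ 2 < c / R n $ 2 - (R n $ 1 / R n $ 2) * R y $ 1" if "n \<in> act p" for n y
      unfolding inner using pos[OF that] by (simp add: field_simps)
    then have "\<forall>y\<in>ball p r. y \<in> P \<longleftrightarrow> R y $ 2 < g (R y $ 1)" using r(2) g(2) by simp
    then show "\<exists>(R :: real^2 \<Rightarrow> real^2) g L r. orthogonal_transformation R \<and> L-lipschitz_on UNIV g \<and> 0 < r \<and>
        (\<forall>y\<in>ball p r. (y \<in> P) = (R y $ 2 < g (R y $ 1)))"
      using R(1) g(1) r(1) by blast
  qed
  have corners: "{p \<in> frontier P. \<nexists>\<nu>. outer_unit_normal UNIV P p \<nu>} \<subseteq>
     (\<Union>n\<in>K. \<Union>n'\<in>K - {n}. {p. n \<bullet> p = c \<and> n' \<bullet> p = c})"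
  proof
    fix p assume p: "p \<in> {p \<in> frontier P. \<nexists>\<nu>. outer_unit_normal UNIV P p \<nu>}"
    then have pf: "p \<in> frontier P" by simp
    obtain n where n: "n \<in> act p" using act_ne[OF pf] by blast
    have "\<exists>n'\<in>act p. n' \<noteq> n"
    proof (rule ccontr)
      assume "\<not> (\<exists>n'\<in>act p. n' \<noteq> n)"
      then have one: "act p = {n}" using n by blast
      have np: "n \<bullet> p = c" using n by (simp add: act_def)
      then have n0: "norm n > 0" using c by auto
      obtain r where r: "r > 0" "\<And>y. y \<in> ball p r \<Longrightarrow> y \<in> P \<longleftrightarrow> n \<bullet> y < c"
        using near[OF fr(1)[OF pf]] unfolding one by auto
      have eq: "((n /\<^sub>R norm n)) \<bullet> (y - p) = (n \<bullet> y - c) / norm n" for y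
        using np by (simp add: inner_diff_right divide_inverse algebra_simps)
      have "outer_unit_normal UNIV P p ((n /\<^sub>R norm n))"
        unfolding outer_unit_normal_def
      proof (intro conjI allI impI)
        fix e :: real assume e: "e > 0"
        show "\<exists>d>0. \<forall>y\<in>UNIV. norm (y - p) < d \<longrightarrow>
            (e * norm (y - p) < (n /\<^sub>R norm n) \<bullet> (y - p) \<longrightarrow> y \<notin> P) \<and>
            ((n /\<^sub>R norm n) \<bullet> (y - p) < - e * norm (y - p) \<longrightarrow> y \<in> P)"
        proof (intro exI[of _ r] conjI ballI impI)
          fix y assume y: "norm (y - p) < r"
          then have yb: "y \<in> ball p r" by (simp add: dist_norm norm_minus_commute)
          have en: "e * norm (y - p) \<ge> 0" using e by simp
          show "y \<notin> P" if "e * norm (y - p) < (n /\<^sub>R norm n) \<bullet> (y - p)"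
          proof -
            have "(n \<bullet> y - c) / norm n > 0" using that en unfolding eq by linarith
            then have "n \<bullet> y > c" using n0 by (simp add: zero_less_divide_iff)
            then show ?thesis using r(2)[OF yb] by simp
          qed
          show "y \<in> P" if "(n /\<^sub>R norm n) \<bullet> (y - p) < - e * norm (y - p)"
          proof -
            have "(n \<bullet> y - c) / norm n < 0" using that en unfolding eq by linarith
            then have "n \<bullet> y < c" using n0 by (simp add: divide_less_0_iff)
            then show ?thesis using r(2)[OF yb] by simp
          qed
        qed (use r(1) in simp)
      qed (use n0 in simp_all)
      then show False using p by blast
    qed
    then show "p \<in> (\<Union>n\<in>K. \<Union>n'\<in>K - {n}. {p. n \<bullet> p = c \<and> n' \<bullet> p = c})"
      using n by (auto simp: act_def)
  qed
  have "countable (\<Union>n\<in>K. \<Union>n'\<in>K - {n}. {p. n \<bullet> p = c \<and> n' \<bullet> p = c})"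
  proof (intro countable_UN countable_finite[OF K] countable_finite[OF finite_Diff[OF K]])
    fix n n' assume "n' \<in> K - {n}"
    then have ne: "n \<noteq> n'" by blast
    show "countable {p. n \<bullet> p = c \<and> n' \<bullet> p = c}"
    proof (cases "{p. n \<bullet> p = c \<and> n' \<bullet> p = c} = {}")
      case False
      then obtain p where p: "n \<bullet> p = c" "n' \<bullet> p = c" by blast
      have "{p. n \<bullet> p = c \<and> n' \<bullet> p = c} \<subseteq> {p}"
        using two_edges_meet_at_most_once[OF c ne p] by auto
      then show ?thesis by (rule countable_subset) simp
    next
      case True
      then show ?thesis by (simp only: countable_empty)
    qed
  qed
  with corners have "countable {p \<in> frontier P. \<nexists>\<nu>. outer_unit_normal UNIV P p \<nu>}" by (rule countable_subset)
  then have "regular_domain P"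
    unfolding regular_domain_def using oP convex_connected[OF cP] zP b lip unfolding P_def by blast
  then show ?thesis by (simp add: P_def)
qed

section \<open>The hexagon and its transport to the misorientation plane\<close>

definition hexagon :: "(real^2) set" where "hexagon = plane_iso -` misor_domain"

lemma norm_misor_domain_le: "\<theta> \<in> misor_domain \<Longrightarrow> norm \<theta> \<le> 3 * (pi / 4)"
proof -
  assume "\<theta> \<in> misor_domain"
  then have "\<theta> $ i \<in> {- (pi / 4)<..<pi / 4}" for i unfolding misor_domain_def by blast
  then have "\<bar>\<theta> $ i\<bar> \<le> pi / 4" for i
    unfolding greaterThanLessThan_iff abs_le_iff by (meson less_imp_le minus_le_iff)
  then have "(\<Sum>i\<in>UNIV. \<bar>\<theta> $ i\<bar>) \<le> (\<Sum>i\<in>(UNIV::3 set). pi / 4)" by (intro sum_mono)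
  then show ?thesis using norm_le_l1_cart[of "\<theta>"] by simp
qed

text \<open>The normals are the rows of the matrix of \<open>plane_iso\<close> and their negatives,
  one pair for each component of \<open>\<theta>\<close>, all with offset
  \<open>pi / 4\<close>.\<close>

lemma regular_domain_hexagon: "regular_domain hexagon"
proof -
  define row :: "3 \<Rightarrow> real^2" where "row i = (\<chi> j. plane_iso (axis j 1) $ i)" for i
  have row: "row i \<bullet> u = plane_iso u $ i" for i u
  proof -
    have "u = (\<Sum>j\<in>UNIV. u $ j *\<^sub>R axis j 1)" by (simp add: vec_eq_iff forall_2 sum_2 axis_def)
    then have "plane_iso u = plane_iso (\<Sum>j\<in>UNIV. u $ j *\<^sub>R axis j 1)" by (rule arg_cong)
    also have "\<dots> = (\<Sum>j\<in>UNIV. u $ j *\<^sub>R plane_iso (axis j 1))"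
      by (simp add: linear_sum[OF plane_iso_linear] linear_cmul[OF plane_iso_linear])
    finally show ?thesis by (simp add: row_def inner_vec_def mult.commute)
  qed
  define K where "K = range row \<union> range (\<lambda>i. - row i)"
  have pl: "plane_iso u \<in> misor_plane" for u using plane_iso_range by blast
  have eq: "hexagon = {y. \<forall>n\<in>K. n \<bullet> y < pi / 4}"
  proof (rule set_eqI)
    fix u
    have "u \<in> hexagon \<longleftrightarrow> (\<forall>i. - (pi / 4) < plane_iso u $ i \<and> plane_iso u $ i < pi / 4)"
      using pl[of u] by (simp add: hexagon_def misor_domain_def misor_plane_def)
    also have "\<dots> \<longleftrightarrow> (\<forall>i. plane_iso u $ i < pi / 4) \<and> (\<forall>i. - plane_iso u $ i < pi / 4)"
      unfolding minus_less_iff[of _ "pi / 4"] by blast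
    also have "\<dots> \<longleftrightarrow> u \<in> {y. \<forall>n\<in>K. n \<bullet> y < pi / 4}"
      by (simp only: K_def mem_Collect_eq ball_Un ball_simps row inner_minus_left)
    finally show "u \<in> hexagon \<longleftrightarrow> u \<in> {y. \<forall>n\<in>K. n \<bullet> y < pi / 4}" .
  qed
  have "bounded hexagon"
    unfolding bounded_iff
  proof (intro exI ballI)
    fix u assume "u \<in> hexagon"
    then show "norm u \<le> 3 * (pi / 4)"
      using norm_misor_domain_le[of "plane_iso u"] by (simp add: hexagon_def plane_iso_norm)
  qed
  then show ?thesis unfolding eq by (intro regular_domain_polygon) (simp_all add: K_def)
qed

lemma plane_iso_dist: "norm (plane_iso u - plane_iso v) = norm (u - v)"
  by (simp add: linear_diff[OF plane_iso_linear, symmetric] plane_iso_norm)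

lemma continuous_on_plane_iso [continuous_intros]: "continuous_on A f \<Longrightarrow> continuous_on A (\<lambda>x. plane_iso (f x))"
  by (rule continuous_on_compose2[OF linear_continuous_on[of plane_iso UNIV]])
    (simp_all add: linear_conv_bounded_linear[symmetric] plane_iso_linear)

text \<open>An isometry preserves norms and inner products, and the definition relative to the plane
  quantifies only over points of \<open>misor_plane\<close>, the range of
  \<open>plane_iso\<close>.\<close>

lemma outer_unit_normal_plane_iso:
  assumes "outer_unit_normal UNIV hexagon p \<nu>"
  shows "outer_unit_normal misor_plane misor_domain (plane_iso p) (plane_iso \<nu>)"
  unfolding outer_unit_normal_def
proof (intro conjI allI impI)
  show "plane_iso p \<in> misor_plane" "plane_iso \<nu> \<in> misor_plane" using plane_iso_range by blast+
  show "norm (plane_iso \<nu>) = 1" using assms by (simp add: plane_iso_norm outer_unit_normal_def)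
  fix e :: real assume "e > 0"
  then obtain d where d: "d > 0" "\<And>y. norm (y - p) < d \<Longrightarrow>
      (\<nu> \<bullet> (y - p) > e * norm (y - p) \<longrightarrow> y \<notin> hexagon) \<and> (\<nu> \<bullet> (y - p) < - e * norm (y - p) \<longrightarrow> y \<in> hexagon)"
    using assms unfolding outer_unit_normal_def by blast
  have "plane_iso \<nu> \<bullet> (plane_iso y - plane_iso p) = \<nu> \<bullet> (y - p)" for y
    by (simp add: linear_diff[OF plane_iso_linear, symmetric] plane_iso_inner)
  then have "\<forall>y\<in>range plane_iso. norm (y - plane_iso p) < d \<longrightarrow>
      (e * norm (y - plane_iso p) < plane_iso \<nu> \<bullet> (y - plane_iso p) \<longrightarrow> y \<notin> misor_domain) \<and>
      (plane_iso \<nu> \<bullet> (y - plane_iso p) < - e * norm (y - plane_iso p) \<longrightarrow> y \<in> misor_domain)"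
    using d(2) by (simp add: plane_iso_dist hexagon_def)
  then show "\<exists>d>0. \<forall>y\<in>misor_plane. norm (y - plane_iso p) < d \<longrightarrow>
      (e * norm (y - plane_iso p) < plane_iso \<nu> \<bullet> (y - plane_iso p) \<longrightarrow> y \<notin> misor_domain) \<and>
      (plane_iso \<nu> \<bullet> (y - plane_iso p) < - e * norm (y - plane_iso p) \<longrightarrow> y \<in> misor_domain)"
    unfolding plane_iso_range using d(1) by blast
qed

lemma plane_iso_closure: "u \<in> closure hexagon \<Longrightarrow> plane_iso u \<in> closure misor_domain"
proof -
  assume u: "u \<in> closure hexagon"
  have "plane_iso ` closure hexagon \<subseteq> closure (plane_iso ` hexagon)"
    by (intro closure_bounded_linear_image_subset) (simp add: linear_conv_bounded_linear[symmetric] plane_iso_linear)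
  also have "\<dots> \<subseteq> closure misor_domain" by (intro closure_mono) (auto simp: hexagon_def)
  finally show ?thesis using u by blast
qed

text \<open>Membership in the closure is carried over. Since the hexagon is open, \<open>p\<close>
  is outside it, so its image is outside \<open>misor_domain\<close> and all the more outside the
  relative interior.\<close>

lemma plane_iso_rel_frontier: "p \<in> frontier hexagon \<Longrightarrow> plane_iso p \<in> rel_frontier misor_domain"
  using regular_domain_hexagon plane_iso_closure[of p] rel_interior_subset[of misor_domain]
  by (auto simp: rel_frontier_def frontier_def interior_open regular_domain_def hexagon_def)

text \<open>Injectivity keeps the punctured filter punctured, so boundary limits in the plane can be
  pulled back.\<close>

lemma filterlim_plane_iso: "filterlim plane_iso (at (plane_iso p) within misor_domain) (at p within hexagon)"
proof -
  have "(plane_iso \<longlongrightarrow> plane_iso p) (at p within hexagon)"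
    using continuous_on_plane_iso[OF continuous_on_id, of UNIV] by (auto simp: continuous_on_def intro: tendsto_within_subset)
  moreover have "plane_iso u = plane_iso p \<Longrightarrow> u = p" for u
    using plane_iso_dist[of u p] by simp
  ultimately show ?thesis
    by (auto simp: filterlim_at eventually_at_filter hexagon_def intro!: always_eventually)
qed


subsection \<open>Integration over the state space\<close>

text \<open>The mean value theorem bounds the difference quotients by \<open>C\<close>, and
  dominated convergence is applied along sequences tending to \<open>t\<close>.\<close>

lemma has_real_derivative_integral_bounded:
  fixes \<phi> \<phi>' :: "real \<Rightarrow> 'a \<Rightarrow> real"
  assumes \<delta>: "\<delta> > 0" and A: "A \<in> sets M" "emeasure M A < \<infinity>"
    and int: "\<And>s. s \<in> ball t \<delta> \<Longrightarrow> integrable M (\<lambda>z. indicator A z * \<phi> s z)"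
    and d: "\<And>s z. s \<in> ball t \<delta> \<Longrightarrow> z \<in> A \<Longrightarrow> ((\<lambda>s. \<phi> s z) has_real_derivative \<phi>' s z) (at s)"
    and C: "\<And>s z. s \<in> ball t \<delta> \<Longrightarrow> z \<in> A \<Longrightarrow> \<bar>\<phi>' s z\<bar> \<le> C"
    and m: "(\<lambda>z. indicator A z * \<phi>' t z) \<in> borel_measurable M"
  shows "((\<lambda>s. \<integral>z. indicator A z * \<phi> s z \<partial>M) has_real_derivative (\<integral>z. indicator A z * \<phi>' t z \<partial>M)) (at t)"
proof -
  have "((\<lambda>s. ((\<integral>z. indicator A z * \<phi> s z \<partial>M) - (\<integral>z. indicator A z * \<phi> t z \<partial>M)) / (s - t))
      \<longlongrightarrow> (\<integral>z. indicator A z * \<phi>' t z \<partial>M)) (at t)"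
    unfolding tendsto_at_iff_sequentially
  proof (intro allI impI)
    fix X assume X: "\<forall>i. X i \<in> UNIV - {t}" "X \<longlonglongrightarrow> t"
    \<comment> \<open>Finitely many terms may leave the ball, where nothing is known about
      \<open>\<phi>\<close>; replacing them by \<open>t + \<delta> / 2\<close> does not affect the
      limit.\<close>
    define Y where "Y i = (if X i \<in> ball t \<delta> then X i else t + \<delta> / 2)" for i
    have Yb: "Y i \<in> ball t \<delta>" "Y i \<noteq> t" for i using X(1) \<delta> by (auto simp: Y_def dist_real_def)
    have "\<forall>\<^sub>F i in sequentially. X i \<in> ball t \<delta>"
      using X(2) \<delta> by (intro topological_tendstoD) auto
    then have XY: "\<forall>\<^sub>F i in sequentially. X i = Y i" by (rule eventually_mono) (simp add: Y_def)
    have Y: "Y \<longlonglongrightarrow> t" using X(2) XY by (rule Lim_transform_eventually)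
    define q where "q i z = indicator A z * ((\<phi> (Y i) z - \<phi> t z) / (Y i - t))" for i z
    have t0: "t \<in> ball t \<delta>" using \<delta> by simp
    have q_eq: "q i z = (indicator A z * \<phi> (Y i) z - indicator A z * \<phi> t z) / (Y i - t)" for i z
      by (simp add: q_def right_diff_distrib diff_divide_distrib)
    have qi: "integrable M (q i)" for i
      unfolding q_eq by (intro integrable_divide Bochner_Integration.integrable_diff int Yb t0)
    have "(\<lambda>i. \<integral>z. q i z \<partial>M) \<longlonglongrightarrow> (\<integral>z. indicator A z * \<phi>' t z \<partial>M)"
    proof (rule integral_dominated_convergence[where w="\<lambda>z. \<bar>C\<bar> * indicator A z"])
      show "integrable M (\<lambda>z. \<bar>C\<bar> * indicator A z)"
        using A by (intro integrable_mult_right) (simp add: integrable_indicator_iff)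
      show "AE z in M. (\<lambda>i. q i z) \<longlonglongrightarrow> indicator A z * \<phi>' t z"
      proof (rule AE_I2)
        fix z
        show "(\<lambda>i. q i z) \<longlonglongrightarrow> indicator A z * \<phi>' t z"
        proof (cases "z \<in> A")
          case True
          have "((\<lambda>s. (\<phi> s z - \<phi> t z) / (s - t)) \<longlongrightarrow> \<phi>' t z) (at t)"
            using d[OF t0 True] by (simp add: has_field_derivative_iff)
          moreover have "filterlim Y (at t) sequentially"
            using Y Yb(2) by (simp add: filterlim_at)
          ultimately have "(\<lambda>i. (\<phi> (Y i) z - \<phi> t z) / (Y i - t)) \<longlonglongrightarrow> \<phi>' t z" by (rule filterlim_compose)
          then show ?thesis using True by (simp add: q_def)
        qed (simp add: q_def)
      qed
      show "AE z in M. norm (q i z) \<le> \<bar>C\<bar> * indicator A z" for i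
      proof (rule AE_I2)
        fix z
        show "norm (q i z) \<le> \<bar>C\<bar> * indicator A z"
        proof (cases "z \<in> A")
          case True
          have "norm (\<phi> (Y i) z - \<phi> t z) \<le> C * norm (Y i - t)"
            by (rule field_differentiable_bound[of "ball t \<delta>" "\<lambda>s. \<phi> s z" "\<lambda>s. \<phi>' s z"])
              (use d[OF _ True] C[OF _ True] Yb t0 in \<open>auto intro: has_field_derivative_at_within\<close>)
          then have "\<bar>\<phi> (Y i) z - \<phi> t z\<bar> / \<bar>Y i - t\<bar> \<le> C" using Yb(2)[of i] by (simp add: divide_le_eq)
          then show ?thesis using True by (simp add: q_def)
        qed (simp add: q_def)
      qed
    qed (use m qi in auto)
    moreover have "(\<integral>z. q i z \<partial>M) = ((\<integral>z. indicator A z * \<phi> (Y i) z \<partial>M) - (\<integral>z. indicator A z * \<phi> t z \<partial>M)) / (Y i - t)" for i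
      unfolding q_eq by (simp add: Bochner_Integration.integral_diff[OF int[OF Yb(1)] int[OF t0]])
    ultimately have lim: "(\<lambda>i. ((\<integral>z. indicator A z * \<phi> (Y i) z \<partial>M) - (\<integral>z. indicator A z * \<phi> t z \<partial>M)) / (Y i - t))
        \<longlonglongrightarrow> (\<integral>z. indicator A z * \<phi>' t z \<partial>M)" by simp
    show "((\<lambda>s. ((\<integral>z. indicator A z * \<phi> s z \<partial>M) - (\<integral>z. indicator A z * \<phi> t z \<partial>M)) / (s - t)) \<circ> X)
        \<longlonglongrightarrow> (\<integral>z. indicator A z * \<phi>' t z \<partial>M)"
      by (rule Lim_transform_eventually[OF lim]) (use XY in \<open>rule eventually_mono, simp\<close>)
  qed
  then show ?thesis by (simp add: has_field_derivative_iff)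
qed

section \<open>Transfer of integrals over the state space to planar coordinates\<close>

lemma borel_measurable_completion_AE_eq:
  fixes f g :: "'a \<Rightarrow> real"
  assumes g: "g \<in> borel_measurable M" and eq: "AE z in M. f z = g z"
  shows "f \<in> borel_measurable (completion M)"
proof (rule measurableI)
  fix B :: "real set" assume B: "B \<in> sets borel"
  obtain Z where Z: "{z \<in> space M. f z \<noteq> g z} \<subseteq> Z" "Z \<in> null_sets M"
    using eq by (auto simp: eventually_ae_filter)
  have gB: "g -` B \<inter> space M \<in> sets (completion M)"
    using measurable_sets[OF g B] by (rule sets_completionI_sets)
  have "f -` B \<inter> space M = (g -` B \<inter> space M - Z) \<union> (f -` B \<inter> Z \<inter> space M)"
    using Z(1) by auto
  moreover have "f -` B \<inter> Z \<inter> space M \<in> sets (completion M)"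
    by (rule sets_completionI_sub[of Z]) (use Z(2) in auto)
  moreover have "Z \<in> sets (completion M)" using Z(2) by (intro sets_completionI_sets) auto
  ultimately show "f -` B \<inter> space (completion M) \<in> sets (completion M)"
    using gB by auto
qed simp

lemma plane_product_measure:
  "plane_measure \<Otimes>\<^sub>M (lborel :: (real^2) measure) =
     distr (lborel \<Otimes>\<^sub>M lborel) (borel \<Otimes>\<^sub>M borel) (\<lambda>(u, a). (plane_iso u, a))"
proof -
  have id: "(lborel :: (real^2) measure) = distr lborel borel (\<lambda>x. x)" by (simp add: distr_id2)
  have m: "plane_iso \<in> borel_measurable borel"
    by (intro borel_measurable_continuous_onI continuous_on_plane_iso continuous_on_id)
  have "plane_measure \<Otimes>\<^sub>M distr (lborel :: (real^2) measure) borel (\<lambda>x. x)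
    = distr (lborel \<Otimes>\<^sub>M lborel) (borel \<Otimes>\<^sub>M borel) (\<lambda>(u, a). (plane_iso u, a))"
    unfolding plane_measure_def
    by (rule pair_measure_distr) (use m id[symmetric] in \<open>simp_all add: lborel.sigma_finite_measure_axioms\<close>)
  then show ?thesis unfolding id[symmetric] .
qed

text \<open>\<open>F\<close> is controlled only off the null set \<open>UNIV \<times> X\<close>, so
  its restriction \<open>F0\<close> is compared with a Borel function \<open>G\<close> that agrees
  with it almost everywhere, and completeness of the measure makes \<open>F0\<close> measurable. The
  integral of \<open>G\<close> is pulled back along \<open>plane_iso\<close>, since
  \<open>plane_measure\<close> is an image measure.\<close>

lemma state_integral_transfer:
  fixes F :: "real^3 \<Rightarrow> real^2 \<Rightarrow> real"
  assumes W: "open W" "bounded W" and X: "finite X"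
    and cont: "continuous_on (hexagon \<times> (W - X)) (\<lambda>(u, a). F (plane_iso u) a)"
    and bd: "\<And>u a. u \<in> hexagon \<Longrightarrow> a \<in> W - X \<Longrightarrow> \<bar>F (plane_iso u) a\<bar> \<le> C"
  shows "set_integrable state_measure (misor_domain \<times> W) (\<lambda>(\<theta>, a). F \<theta> a)"
    and "set_lebesgue_integral state_measure (misor_domain \<times> W) (\<lambda>(\<theta>, a). F \<theta> a)
       = (\<integral>z. indicator (hexagon \<times> (W - X)) z * F (plane_iso (fst z)) (snd z) \<partial>lborel)"
    and "integrable lborel (\<lambda>z. indicator (hexagon \<times> (W - X)) z * F (plane_iso (fst z)) (snd z))"
proof -
  have hex: "open hexagon" "bounded hexagon" using regular_domain_hexagon by (auto simp: regular_domain_def)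
  define V where "V = W - X"
  have oV: "open V" unfolding V_def using W(1) X by (intro open_Diff finite_imp_closed)
  have bV: "bounded V" unfolding V_def using W(2) by (rule bounded_subset) auto
  define Om where "Om = hexagon \<times> V"
  have oO: "open Om" unfolding Om_def by (intro open_Times hex oV)
  define h where "h z = indicator Om z * F (plane_iso (fst z)) (snd z)" for z
  have hm: "h \<in> borel_measurable borel"
  proof -
    have "(\<lambda>z. indicator Om z *\<^sub>R (case z of (u, a) \<Rightarrow> F (plane_iso u) a)) \<in> borel_measurable borel"
      using cont oO by (intro borel_measurable_continuous_on_indicator) (simp_all add: Om_def V_def)
    then show ?thesis by (simp add: h_def[abs_def] split_beta)
  qed
  have hb: "\<bar>h z\<bar> \<le> \<bar>C\<bar> * indicator Om z" for z
    using bd[of "fst z" "snd z"] by (cases "z \<in> Om") (auto simp: h_def Om_def V_def)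
  have "bounded Om" unfolding Om_def by (intro bounded_Times hex bV)
  then have "emeasure lborel Om < \<infinity>" using emeasure_bounded_finite by auto
  then have iO: "integrable lborel (\<lambda>z. \<bar>C\<bar> * indicator Om z :: real)"
    using oO by (intro integrable_mult_right) (simp add: integrable_indicator_iff)
  have hi: "integrable lborel h"
  proof (rule Bochner_Integration.integrable_bound[OF iO])
    show "AE z in lborel. norm (h z) \<le> norm (\<bar>C\<bar> * indicator Om z :: real)"
      using hb by (intro AE_I2) (simp add: abs_mult)
  qed (use hm in simp)
  then show "integrable lborel (\<lambda>z. indicator (hexagon \<times> (W - X)) z * F (plane_iso (fst z)) (snd z))"
    by (simp add: h_def[abs_def] Om_def V_def)
  define M where "M = plane_measure \<Otimes>\<^sub>M (lborel :: (real^2) measure)"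
  define j where "j = (\<lambda>(u, a :: real^2). (plane_iso u, a))"
  \<comment> \<open>Extends \<open>h\<close> to the ambient space through
    \<open>plane_coord\<close>, with value 0 off the plane; in this form Borel measurability is
    inherited from \<open>h\<close>.\<close>
  define G where "G z = indicator misor_plane (fst z) * h (plane_coord (fst z), snd z)" for z
  have hm2: "h \<in> borel_measurable (borel \<Otimes>\<^sub>M borel)" using hm by (simp add: borel_prod)
  have pm: "misor_plane \<in> sets borel"
    unfolding misor_plane_def by (intro borel_closed closed_Collect_eq continuous_intros)
  have cm: "plane_coord \<in> borel_measurable borel"
    by (intro borel_measurable_continuous_onI linear_continuous_on)
      (simp add: linear_conv_bounded_linear[symmetric] plane_coord_linear)
  have im: "plane_iso \<in> borel_measurable borel"
    by (intro borel_measurable_continuous_onI continuous_on_plane_iso continuous_on_id)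
  have Gm': "G \<in> borel_measurable (borel \<Otimes>\<^sub>M borel)"
  proof -
    note [measurable] = hm2 pm cm
    show ?thesis unfolding G_def[abs_def] by measurable
  qed
  have jm: "j \<in> (lborel \<Otimes>\<^sub>M lborel) \<rightarrow>\<^sub>M (borel \<Otimes>\<^sub>M borel)"
  proof -
    note [measurable] = im
    show ?thesis unfolding j_def by measurable
  qed
  have Mj: "M = distr (lborel \<Otimes>\<^sub>M lborel) (borel \<Otimes>\<^sub>M borel) j" by (simp add: M_def j_def plane_product_measure)
  have Gm: "G \<in> borel_measurable M" using Gm' by (simp add: Mj)
  have Gj: "G (j z) = h z" for z
  proof -
    have "plane_iso (fst z) \<in> misor_plane" using plane_iso_range by blast
    then show ?thesis by (cases z) (simp add: G_def j_def plane_coord_plane_iso)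
  qed
  have Gi: "integrable M G" "(\<integral>z. G z \<partial>M) = (\<integral>z. h z \<partial>lborel)"
    using hi unfolding Mj integrable_distr_eq[OF jm Gm'] integral_distr[OF jm Gm'] Gj
    unfolding lborel_prod by auto
  have "emeasure M (UNIV \<times> X) = emeasure plane_measure UNIV * emeasure lborel X"
    unfolding M_def using X
    by (intro lborel.emeasure_pair_measure_Times) (simp_all add: plane_measure_def finite_imp_closed borel_closed)
  also have "emeasure lborel X = 0"
    using countable_imp_null_set_lborel[OF countable_finite[OF X]] by auto
  finally have "emeasure M (UNIV \<times> X) = 0" by simp
  moreover have "UNIV \<times> X \<in> sets M"
    unfolding M_def using X by (intro pair_measureI) (simp_all add: plane_measure_def finite_imp_closed borel_closed)
  ultimately have N: "UNIV \<times> X \<in> null_sets M" by (simp add: null_setsI)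
  define F0 where "F0 z = indicator (misor_domain \<times> W) z *\<^sub>R (case z of (\<theta>, a) \<Rightarrow> F \<theta> a)" for z
  have AE: "AE z in M. F0 z = G z"
    using AE_not_in[OF N]
  proof (rule eventually_mono)
    fix z :: "(real^3) \<times> (real^2)" assume z: "z \<notin> UNIV \<times> X"
    obtain \<theta> a where za: "z = (\<theta>, a)" by force
    show "F0 z = G z"
    proof (cases "\<theta> \<in> misor_plane")
      case True
      then obtain u where u: "\<theta> = plane_iso u" unfolding plane_iso_range[symmetric] by blast
      have "\<theta> \<in> misor_domain \<longleftrightarrow> u \<in> hexagon" by (simp add: u hexagon_def)
      then show ?thesis using z True
        by (simp add: F0_def G_def za h_def Om_def V_def indicator_def u plane_coord_plane_iso)
    next
      case False
      then have "\<theta> \<notin> misor_domain" by (auto simp: misor_domain_def misor_plane_def)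
      then show ?thesis using False by (simp add: F0_def G_def za)
    qed
  qed
  have AEc: "AE z in completion M. F0 z = G z" using AE by (rule AE_completion)
  have F0m: "F0 \<in> borel_measurable (completion M)" using borel_measurable_completion_AE_eq[OF Gm AE] .
  have Gc: "G \<in> borel_measurable (completion M)" using Gm by (rule measurable_completion)
  have Gci: "integrable (completion M) G" using Gi(1) Gm by (simp add: integrable_completion)
  show "set_integrable state_measure (misor_domain \<times> W) (\<lambda>(\<theta>, a). F \<theta> a)"
    unfolding set_integrable_def state_measure_def M_def[symmetric] F0_def[symmetric]
    using integrable_cong_AE[OF F0m Gc AEc] Gci by simp
  show "set_lebesgue_integral state_measure (misor_domain \<times> W) (\<lambda>(\<theta>, a). F \<theta> a)
       = (\<integral>z. indicator (hexagon \<times> (W - X)) z * F (plane_iso (fst z)) (snd z) \<partial>lborel)"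
    unfolding set_lebesgue_integral_def state_measure_def M_def[symmetric] F0_def[symmetric]
    using integral_cong_AE[OF F0m Gc AEc] integral_completion[OF Gm] Gi(2)
    by (simp add: h_def Om_def V_def)
qed


lemma compact_closure_misor_domain: "compact (closure misor_domain)"
proof -
  have "bounded misor_domain" unfolding bounded_iff using norm_misor_domain_le by blast
  then show ?thesis by simp
qed

text \<open>Continuity on the compact closure supplies the bound required by
  \<open>state_integral_transfer\<close>.\<close>

lemma state_integral_transfer_closure:
  fixes F :: "real^3 \<Rightarrow> real^2 \<Rightarrow> real"
  assumes W: "open W" "bounded W" and X: "finite X"
    and cont: "continuous_on (closure misor_domain \<times> closure W) (\<lambda>(\<theta>, a). F \<theta> a)"
  shows "set_integrable state_measure (misor_domain \<times> W) (\<lambda>(\<theta>, a). F \<theta> a)"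
    and "set_lebesgue_integral state_measure (misor_domain \<times> W) (\<lambda>(\<theta>, a). F \<theta> a)
       = (\<integral>z. indicator (hexagon \<times> (W - X)) z * F (plane_iso (fst z)) (snd z) \<partial>lborel)"
    and "integrable lborel (\<lambda>z. indicator (hexagon \<times> (W - X)) z * F (plane_iso (fst z)) (snd z))"
proof -
  have sub: "plane_iso u \<in> closure misor_domain" if "u \<in> hexagon" for u
    using that closure_subset by (auto simp: hexagon_def)
  have cl: "a \<in> closure W" if "a \<in> W - X" for a using that closure_subset by auto
  have "compact (closure misor_domain \<times> closure W)"
    using W(2) by (intro compact_Times compact_closure_misor_domain) simp
  then have "bounded ((\<lambda>(\<theta>, a). F \<theta> a) ` (closure misor_domain \<times> closure W))"
    by (intro compact_imp_bounded compact_continuous_image cont)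
  then obtain C where C: "\<And>\<theta> a. \<theta> \<in> closure misor_domain \<Longrightarrow> a \<in> closure W \<Longrightarrow> \<bar>F \<theta> a\<bar> \<le> C"
    by (force simp: bounded_iff)
  have "continuous_on (hexagon \<times> (W - X)) (\<lambda>z. case (plane_iso (fst z), snd z) of (\<theta>, a) \<Rightarrow> F \<theta> a)"
    by (rule continuous_on_compose2[OF cont]) (use sub cl in \<open>auto intro!: continuous_intros\<close>)
  then have c: "continuous_on (hexagon \<times> (W - X)) (\<lambda>(u, a). F (plane_iso u) a)"
    by (simp add: split_beta)
  note tr = state_integral_transfer[of W X F C, OF W X c C[OF sub cl]]
  show "set_integrable state_measure (misor_domain \<times> W) (\<lambda>(\<theta>, a). F \<theta> a)" by (rule tr(1))
  show "set_lebesgue_integral state_measure (misor_domain \<times> W) (\<lambda>(\<theta>, a). F \<theta> a)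
       = (\<integral>z. indicator (hexagon \<times> (W - X)) z * F (plane_iso (fst z)) (snd z) \<partial>lborel)" by (rule tr(2))
  show "integrable lborel (\<lambda>z. indicator (hexagon \<times> (W - X)) z * F (plane_iso (fst z)) (snd z))" by (rule tr(3))
qed


subsection \<open>The energy\<close>

lemma c1_with_linear: "bounded_linear L \<Longrightarrow> c1_with G L (\<lambda>z. L)"
  unfolding c1_with_def by (auto intro: bounded_linear_imp_has_derivative)

lemma continuous_on_Icc_bound:
  fixes f :: "real \<Rightarrow> real"
  assumes "continuous_on {a..b} f"
  shows "\<exists>B. \<forall>s\<in>{a..b}. \<bar>f s\<bar> \<le> B"
proof -
  have "bounded (f ` {a..b})" by (rule compact_imp_bounded[OF compact_continuous_image[OF assms compact_Icc]])
  then show ?thesis unfolding bounded_iff by simp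
qed

lemma c1_with_partials:
  assumes "c1_with G (\<lambda>(\<theta>, a). \<phi> \<theta> a) \<phi>'" "(\<theta>, a) \<in> G"
  shows "((\<lambda>\<theta>. \<phi> \<theta> a) has_derivative (\<lambda>v. \<phi>' (\<theta>, a) (v, 0))) (at \<theta>)"
    and "((\<lambda>a. \<phi> \<theta> a) has_derivative (\<lambda>v. \<phi>' (\<theta>, a) (0, v))) (at a)"
proof -
  have d: "((\<lambda>(\<theta>, a). \<phi> \<theta> a) has_derivative \<phi>' (\<theta>, a)) (at (\<theta>, a))"
    using assms unfolding c1_with_def by blast
  have "((\<lambda>\<theta>. (\<theta>, a)) has_derivative (\<lambda>v. (v, 0))) (at \<theta>)" by (auto intro!: derivative_eq_intros)
  from has_derivative_compose[OF this d]
  show "((\<lambda>\<theta>. \<phi> \<theta> a) has_derivative (\<lambda>v. \<phi>' (\<theta>, a) (v, 0))) (at \<theta>)" by simp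
  have "((\<lambda>a. (\<theta>, a)) has_derivative (\<lambda>v. (0, v))) (at a)" by (auto intro!: derivative_eq_intros)
  from has_derivative_compose[OF this d]
  show "((\<lambda>a. \<phi> \<theta> a) has_derivative (\<lambda>v. \<phi>' (\<theta>, a) (0, v))) (at a)" by simp
qed

lemma grad_norm_le:
  assumes d: "(\<phi> has_derivative \<phi>') (at p)" and B: "\<And>v. \<bar>\<phi>' v\<bar> \<le> B * norm v"
  shows "norm (grad \<phi> p) \<le> B"
proof -
  have "norm (grad \<phi> p) * norm (grad \<phi> p) = \<phi>' (grad \<phi> p)"
    by (simp add: grad_inner[OF d, symmetric] power2_norm_eq_inner[symmetric] power2_eq_square)
  also have "\<dots> \<le> B * norm (grad \<phi> p)" using B[of "grad \<phi> p"] by linarith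
  \<comment> \<open>For a vanishing gradient the claim is \<open>B \<ge> 0\<close>, which the
    hypothesis provides at any unit vector; the index of the axis is arbitrary.\<close>
  finally show ?thesis
    using B[of "axis undefined 1"] by (cases "grad \<phi> p = 0") auto
qed

lemma tgrad_norm_le:
  assumes d: "(\<phi> has_derivative \<phi>') (at p)" and B: "\<And>v. \<bar>\<phi>' v\<bar> \<le> B * norm v"
  shows "norm (tgrad \<phi> p) \<le> B"
proof -
  have "norm (tgrad \<phi> p) * norm (tgrad \<phi> p) = tgrad \<phi> p \<bullet> tgrad \<phi> p"
    by (simp add: power2_norm_eq_inner[symmetric] power2_eq_square)
  also have "\<dots> = \<phi>' (tgrad \<phi> p)"
    using tgrad_inner[OF d, of "plane_coord (tgrad \<phi> p)"] unfolding plane_iso_plane_coord[OF tgrad_in_plane] .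
  also have "\<dots> \<le> B * norm (tgrad \<phi> p)" using B[of "tgrad \<phi> p"] by linarith
  finally show ?thesis
    using B[of "axis undefined 1"] by (cases "tgrad \<phi> p = 0") auto
qed

lemma in_plane_eqI:
  assumes "v \<in> misor_plane" "w \<in> misor_plane" "\<And>u. v \<bullet> plane_iso u = w \<bullet> plane_iso u"
  shows "v = w"
proof -
  have "plane_coord v = plane_coord w" by (simp add: plane_coord_def assms(3))
  then show ?thesis using assms(1,2) plane_iso_plane_coord by metis
qed

lemma misor_plane_lincomb: "v \<in> misor_plane \<Longrightarrow> w \<in> misor_plane \<Longrightarrow> b *\<^sub>R v + c *\<^sub>R w \<in> misor_plane"
proof -
  assume vw: "v \<in> misor_plane" "w \<in> misor_plane"
  have "(b *\<^sub>R v + c *\<^sub>R w) $ 1 + (b *\<^sub>R v + c *\<^sub>R w) $ 2 + (b *\<^sub>R v + c *\<^sub>R w) $ 3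
     = b * (v $ 1 + v $ 2 + v $ 3) + c * (w $ 1 + w $ 2 + w $ 3)" by (simp add: algebra_simps)
  then show ?thesis using vw by (simp add: misor_plane_def)
qed

text \<open>The total derivative of the energy off the points \<open>x j\<close>, with the terms in
  the order in which \<open>c1_with_mult\<close> produces them.\<close>

definition energy_deriv ::
    "(real \<Rightarrow> real) \<Rightarrow> (real \<Rightarrow> real) \<Rightarrow> (3 \<Rightarrow> real^2) \<Rightarrow> (real^3) \<times> (real^2) \<Rightarrow> (real^3) \<times> (real^2) \<Rightarrow> real" where
  "energy_deriv \<sigma> \<sigma>' x z v = (\<Sum>j\<in>UNIV. \<sigma> (fst z $ j) * (sgn (snd z - x j) \<bullet> snd v)
      + (\<sigma>' (fst z $ j) * fst v $ j) * norm (snd z - x j))"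

lemma c1_with_energy:
  assumes \<sigma>: "\<And>s. (\<sigma> has_real_derivative \<sigma>' s) (at s)" "continuous_on UNIV \<sigma>'"
  shows "c1_with (UNIV \<times> (UNIV - range x)) (\<lambda>(\<theta>, a). energy \<sigma> x \<theta> a) (energy_deriv \<sigma> \<sigma>' x)"
proof -
  define G where "G = (UNIV :: (real^3) set) \<times> (UNIV - range x)"
  have 1: "c1_with G (\<lambda>z. fst z $ j) (\<lambda>z v. fst v $ j)" for j
    by (rule c1_with_linear[OF bounded_linear_compose[OF bounded_linear_vec_nth bounded_linear_fst]])
  have 2: "c1_with G (\<lambda>z. snd z - x j) (\<lambda>z v. snd v)" for j
    using c1_with_diff[OF c1_with_linear[OF bounded_linear_snd] c1_with_const[of _ "x j"]] by simp
  have 3: "snd z - x j \<noteq> 0" if "z \<in> G" for z j using that by (auto simp: G_def)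
  have "c1_with G (\<lambda>z. \<Sum>j\<in>UNIV. \<sigma> (fst z $ j) * norm (snd z - x j)) (\<lambda>z v. \<Sum>j\<in>UNIV.
      \<sigma> (fst z $ j) * (sgn (snd z - x j) \<bullet> snd v) + (\<sigma>' (fst z $ j) * fst v $ j) * norm (snd z - x j))"
    by (intro c1_with_sum c1_with_mult c1_with_norm[OF 2 3] c1_with_real_compose[of UNIV, OF \<sigma> 1]) simp_all
  then show ?thesis
    by (simp add: G_def energy_def energy_deriv_def[abs_def] case_prod_unfold)
qed

lemma grad_energy:
  assumes \<sigma>: "\<And>s. (\<sigma> has_real_derivative \<sigma>' s) (at s)" "continuous_on UNIV \<sigma>'" and a: "a \<notin> range x"
  shows "grad (energy \<sigma> x \<theta>) a = (\<Sum>j\<in>UNIV. \<sigma> (\<theta> $ j) *\<^sub>R sgn (a - x j))"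
proof (rule grad_eqI)
  have "(energy \<sigma> x \<theta> has_derivative (\<lambda>v. energy_deriv \<sigma> \<sigma>' x (\<theta>, a) (0, v))) (at a)"
    using c1_with_partials(2)[OF c1_with_energy[OF \<sigma>]] a by auto
  then show "(energy \<sigma> x \<theta> has_derivative (\<lambda>v. (\<Sum>j\<in>UNIV. \<sigma> (\<theta> $ j) *\<^sub>R sgn (a - x j)) \<bullet> v)) (at a)"
    by (rule has_derivative_eq_rhs) (simp add: energy_deriv_def inner_sum_left fun_eq_iff)
qed

text \<open>The gradient in \<open>a\<close> contains \<open>\<sigma>\<close> but not its
  derivative, so a C1 density makes it C1 off the points \<open>x j\<close>. The gradient in
  \<open>\<theta>\<close> contains \<open>\<sigma>'\<close>, which is merely continuous, so there
  differentiability of the drift is a hypothesis.\<close>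

lemma c1_with_grad_energy:
  assumes \<sigma>: "\<And>s. (\<sigma> has_real_derivative \<sigma>' s) (at s)" "continuous_on UNIV \<sigma>'"
  obtains V' where "c1_with (UNIV \<times> (UNIV - range x)) (\<lambda>(\<theta>, a). grad (energy \<sigma> x \<theta>) a) V'"
proof -
  define G where "G = (UNIV :: (real^3) set) \<times> (UNIV - range x)"
  have oG: "open G" unfolding G_def by (intro open_Times open_Diff finite_imp_closed) simp_all
  have 1: "c1_with G (\<lambda>z. fst z $ j) (\<lambda>z v. fst v $ j)" for j
    by (rule c1_with_linear[OF bounded_linear_compose[OF bounded_linear_vec_nth bounded_linear_fst]])
  have 2: "c1_with G (\<lambda>z. snd z - x j) (\<lambda>z v. snd v)" for j
    using c1_with_diff[OF c1_with_linear[OF bounded_linear_snd] c1_with_const[of _ "x j"]] by simp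
  have 3: "snd z - x j \<noteq> 0" if "z \<in> G" for z j using that by (auto simp: G_def)
  have "\<exists>g'. c1_with G (\<lambda>z. sgn (snd z - x j)) g'" for j
    by (rule c1_with_sgn[OF 2[of j] 3]) (assumption, rule exI)
  then obtain g' where g': "\<And>j. c1_with G (\<lambda>z. sgn (snd z - x j)) (g' j)" by metis
  have 4: "c1_with G (\<lambda>z. \<sigma> (fst z $ j)) (\<lambda>z v. \<sigma>' (fst z $ j) * fst v $ j)" for j
    by (rule c1_with_real_compose[of UNIV, OF \<sigma> 1]) simp_all
  have "c1_with G (\<lambda>z. \<Sum>j\<in>UNIV. \<sigma> (fst z $ j) *\<^sub>R sgn (snd z - x j))
     (\<lambda>z v. \<Sum>j\<in>UNIV. \<sigma> (fst z $ j) *\<^sub>R g' j z v + (\<sigma>' (fst z $ j) * fst v $ j) *\<^sub>R sgn (snd z - x j))"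
    by (rule c1_with_sum[OF c1_with_scaleR[OF 4 g']])
  then have "c1_with G (\<lambda>(\<theta>, a). grad (energy \<sigma> x \<theta>) a)
     (\<lambda>z v. \<Sum>j\<in>UNIV. \<sigma> (fst z $ j) *\<^sub>R g' j z v + (\<sigma>' (fst z $ j) * fst v $ j) *\<^sub>R sgn (snd z - x j))"
  proof (rule c1_with_cong[OF _ oG])
    fix z assume "z \<in> G"
    then have "snd z \<notin> range x" by (auto simp: G_def)
    then show "(case z of (\<theta>, a) \<Rightarrow> grad (energy \<sigma> x \<theta>) a) = (\<Sum>j\<in>UNIV. \<sigma> (fst z $ j) *\<^sub>R sgn (snd z - x j))"
      by (simp add: grad_energy[OF \<sigma>] case_prod_unfold)
  qed
  then show ?thesis unfolding G_def by (rule that)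
qed

text \<open>The vectors \<open>sgn (a - x j)\<close> have norm at most 1, so the derivative stays
  bounded near the points \<open>x j\<close>, although it need not have a limit there;
  \<open>\<sigma>\<close> and \<open>\<sigma>'\<close> are evaluated only on a compact
  interval.\<close>

lemma energy_deriv_bound:
  assumes \<sigma>: "\<And>s. (\<sigma> has_real_derivative \<sigma>' s) (at s)" "continuous_on UNIV \<sigma>'" and W: "bounded W"
  shows "\<exists>B. \<forall>\<theta>\<in>misor_domain. \<forall>a\<in>W. \<forall>v. \<bar>energy_deriv \<sigma> \<sigma>' x (\<theta>, a) v\<bar> \<le> B * norm v"
proof -
  have c\<sigma>: "continuous_on {- (pi/4)..pi/4} \<sigma>"
    using \<sigma>(1) by (meson DERIV_isCont continuous_at_imp_continuous_on)
  have c\<sigma>': "continuous_on {- (pi/4)..pi/4} \<sigma>'" using \<sigma>(2) by (rule continuous_on_subset) simp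
  obtain S1 where S1: "\<And>s. s \<in> {- (pi/4)..pi/4} \<Longrightarrow> \<bar>\<sigma> s\<bar> \<le> S1"
    using continuous_on_Icc_bound[OF c\<sigma>] by blast
  obtain S2 where S2: "\<And>s. s \<in> {- (pi/4)..pi/4} \<Longrightarrow> \<bar>\<sigma>' s\<bar> \<le> S2"
    using continuous_on_Icc_bound[OF c\<sigma>'] by blast
  obtain \<rho> where \<rho>: "\<And>a. a \<in> W \<Longrightarrow> norm a \<le> \<rho>" using W unfolding bounded_iff by blast
  have "\<bar>energy_deriv \<sigma> \<sigma>' x (\<theta>, a) v\<bar> \<le> (\<Sum>j\<in>(UNIV :: 3 set). S1 + S2 * (\<rho> + norm (x j))) * norm v"
    if \<theta>: "\<theta> \<in> misor_domain" and a: "a \<in> W" for \<theta> a v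
  proof -
    have th: "\<theta> $ j \<in> {- (pi/4)..pi/4}" for j
    proof -
      have "\<theta> $ j \<in> {- (pi/4)<..<pi/4}" using \<theta> unfolding misor_domain_def by blast
      then show ?thesis by (simp add: less_imp_le)
    qed
    have S0: "0 \<le> S1" "0 \<le> S2" using S1[OF th[of 1]] S2[OF th[of 1]] by linarith+
    have "\<bar>\<sigma> (\<theta> $ j) * (sgn (a - x j) \<bullet> snd v) + (\<sigma>' (\<theta> $ j) * fst v $ j) * norm (a - x j)\<bar>
       \<le> (S1 + S2 * (\<rho> + norm (x j))) * norm v" for j
    proof -
      have "\<bar>sgn (a - x j) \<bullet> snd v\<bar> \<le> norm (sgn (a - x j)) * norm (snd v)" by (rule Cauchy_Schwarz_ineq2)
      also have "\<dots> \<le> 1 * norm v"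
        using norm_snd_le[of "snd v" "fst v"] by (intro mult_mono) (simp_all add: norm_sgn)
      finally have 1: "\<bar>\<sigma> (\<theta> $ j)\<bar> * \<bar>sgn (a - x j) \<bullet> snd v\<bar> \<le> S1 * norm v"
        using S1[OF th] S0 by (intro mult_mono) simp_all
      have f: "\<bar>fst v $ j\<bar> \<le> norm v"
        using component_le_norm_cart[of "fst v" j] norm_fst_le[of "fst v" "snd v"] by simp
      have n: "norm (a - x j) \<le> \<rho> + norm (x j)" using norm_triangle_ineq4[of a "x j"] \<rho>[OF a] by linarith
      have 2: "\<bar>\<sigma>' (\<theta> $ j)\<bar> * \<bar>fst v $ j\<bar> * norm (a - x j) \<le> (S2 * norm v) * (\<rho> + norm (x j))"
        by (rule mult_mono[OF mult_mono[OF S2[OF th] f S0(2) abs_ge_zero] n]) (use S0 in simp_all)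
      have "\<bar>\<sigma> (\<theta> $ j) * (sgn (a - x j) \<bullet> snd v) + (\<sigma>' (\<theta> $ j) * fst v $ j) * norm (a - x j)\<bar>
        \<le> \<bar>\<sigma> (\<theta> $ j)\<bar> * \<bar>sgn (a - x j) \<bullet> snd v\<bar> + \<bar>\<sigma>' (\<theta> $ j)\<bar> * \<bar>fst v $ j\<bar> * norm (a - x j)"
        by (rule order_trans[OF abs_triangle_ineq]) (simp add: abs_mult)
      also have "\<dots> \<le> (S1 + S2 * (\<rho> + norm (x j))) * norm v" using 1 2 by (simp add: algebra_simps)
      finally show ?thesis .
    qed
    then have "(\<Sum>j\<in>UNIV. \<bar>\<sigma> (\<theta> $ j) * (sgn (a - x j) \<bullet> snd v) + (\<sigma>' (\<theta> $ j) * fst v $ j) * norm (a - x j)\<bar>)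
        \<le> (\<Sum>j\<in>UNIV. (S1 + S2 * (\<rho> + norm (x j))) * norm v)" by (rule sum_mono)
    then show ?thesis
      unfolding energy_deriv_def fst_conv snd_conv sum_distrib_right by (rule order_trans[OF sum_abs])
  qed
  then show ?thesis by blast
qed


subsection \<open>The energy law\<close>

lemma linear_eq_sum_Basis:
  fixes L :: "'a::euclidean_space \<Rightarrow> real"
  assumes L: "linear L" shows "L w = (\<Sum>b\<in>Basis. (w \<bullet> b) * L b)"
proof -
  have "L w = L (\<Sum>b\<in>Basis. (w \<bullet> b) *\<^sub>R b)" by (simp add: euclidean_representation)
  also have "\<dots> = (\<Sum>b\<in>Basis. (w \<bullet> b) * L b)" by (simp add: linear_sum[OF L] linear_cmul[OF L])
  finally show ?thesis .
qed

lemma closure_bound: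
  fixes F :: "real^3 \<Rightarrow> real^2 \<Rightarrow> real"
  assumes "bounded W" "continuous_on (closure misor_domain \<times> closure W) (\<lambda>(\<theta>, a). F \<theta> a)"
  shows "\<exists>C\<ge>0. \<forall>\<theta>\<in>misor_domain. \<forall>a\<in>W. \<bar>F \<theta> a\<bar> \<le> C"
proof -
  have "compact (closure misor_domain \<times> closure W)"
    using assms(1) by (intro compact_Times compact_closure_misor_domain) simp
  then have "bounded ((\<lambda>(\<theta>, a). F \<theta> a) ` (closure misor_domain \<times> closure W))"
    by (intro compact_imp_bounded compact_continuous_image assms(2))
  then obtain C where C: "\<And>\<theta> a. \<theta> \<in> closure misor_domain \<Longrightarrow> a \<in> closure W \<Longrightarrow> \<bar>F \<theta> a\<bar> \<le> C"
    by (force simp: bounded_iff)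
  have "\<bar>F \<theta> a\<bar> \<le> max C 0" if "\<theta> \<in> misor_domain" "a \<in> W" for \<theta> a
    using C[of \<theta> a] that closure_subset[of misor_domain] closure_subset[of W] by (simp add: max.coboundedI1 subset_iff)
  then show ?thesis by (intro exI[of _ "max C 0"]) simp
qed

lemma continuous_on_energy:
  assumes "continuous_on UNIV \<sigma>"
  shows "continuous_on A (\<lambda>(\<theta>, a). energy \<sigma> x \<theta> a)"
  unfolding energy_def case_prod_unfold
  by (intro continuous_intros continuous_on_compose2[OF assms]) simp

text \<open>Here \<open>g\<close> is the density at a fixed time and \<open>r\<close> its time
  derivative. The relations in \<open>par\<close> turn the diffusion coefficients into
  \<open>D\<close> times the mobilities \<open>3 * \<gamma>\<close> and \<open>\<eta>\<close> of the
  drift, so both flux components are mobility times \<open>g\<close> times a gradient of the single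
  potential \<open>\<mu>\<close>. The product rule for \<open>\<mu> + D\<close> times the flux then
  yields the two dissipation terms.\<close>

lemma dissipation_identity:
  fixes \<gamma> \<eta> \<beta>\<theta> \<beta>a D :: real and \<sigma> \<sigma>' :: "real \<Rightarrow> real" and x :: "3 \<Rightarrow> real^2"
    and W :: "(real^2) set" and g r :: "real^3 \<Rightarrow> real^2 \<Rightarrow> real"
  defines "E \<equiv> energy \<sigma> x"
  assumes par: "\<gamma> > 0" "\<eta> > 0" "D > 0" "\<beta>\<theta>\<^sup>2 = 6 * \<gamma> * D" "\<beta>a\<^sup>2 = 2 * \<eta> * D"
    and \<sigma>: "\<And>s. (\<sigma> has_real_derivative \<sigma>' s) (at s)" "continuous_on UNIV \<sigma>'"
    and W: "regular_domain W"
    and gpos: "\<And>\<theta> a. \<theta> \<in> closure misor_domain \<Longrightarrow> a \<in> closure W \<Longrightarrow> g \<theta> a > 0"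
    and gcont: "continuous_on (closure misor_domain \<times> closure W) (\<lambda>(\<theta>, a). g \<theta> a)"
    and rcont: "continuous_on (closure misor_domain \<times> closure W) (\<lambda>(\<theta>, a). r \<theta> a)"
    and G: "open G" "misor_domain \<times> (W - range x) \<subseteq> G"
    and g1: "C1_on G (\<lambda>(\<theta>, a). g \<theta> a)"
    and g2: "C1_on G (\<lambda>(\<theta>, a). tgrad (\<lambda>\<theta>'. g \<theta>' a) \<theta>)"
    and g3: "C1_on G (\<lambda>(\<theta>, a). grad (\<lambda>a'. g \<theta> a') a)"
    and g4: "C1_on G (\<lambda>(\<theta>, a). g \<theta> a *\<^sub>R vel_misor \<gamma> E \<theta> a)"
    and b2: "bounded ((\<lambda>(\<theta>, a). tgrad (\<lambda>\<theta>'. g \<theta>' a) \<theta>) ` (misor_domain \<times> (W - range x)))"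
    and b3: "bounded ((\<lambda>(\<theta>, a). grad (\<lambda>a'. g \<theta> a') a) ` (misor_domain \<times> (W - range x)))"
    and fp: "\<And>\<theta> a. \<theta> \<in> misor_domain \<Longrightarrow> a \<in> W - range x \<Longrightarrow>
        r \<theta> a + tdiverg (\<lambda>\<theta>'. g \<theta>' a *\<^sub>R vel_misor \<gamma> E \<theta>' a) \<theta>
          + diverg (\<lambda>a'. g \<theta> a' *\<^sub>R vel_junction \<eta> E \<theta> a') a
        = \<beta>\<theta>\<^sup>2 / 2 * tlaplace (\<lambda>\<theta>'. g \<theta>' a) \<theta> + \<beta>a\<^sup>2 / 2 * laplace (\<lambda>a'. g \<theta> a') a"
    and bc1: "\<And>a \<theta>0 \<nu>. a \<in> W - range x \<Longrightarrow> \<theta>0 \<in> rel_frontier misor_domain \<Longrightarrow>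
        outer_unit_normal misor_plane misor_domain \<theta>0 \<nu> \<Longrightarrow>
        ((\<lambda>\<theta>. g \<theta> a * (tgrad (\<lambda>\<theta>'. ln (g \<theta>' a) + 6 * \<gamma> / \<beta>\<theta>\<^sup>2 * E \<theta>' a) \<theta> \<bullet> \<nu>)) \<longlongrightarrow> 0)
          (at \<theta>0 within misor_domain)"
    and bc2: "\<And>\<theta> a0 \<nu>. \<theta> \<in> misor_domain \<Longrightarrow> a0 \<in> frontier W - range x \<Longrightarrow>
        outer_unit_normal UNIV W a0 \<nu> \<Longrightarrow>
        ((\<lambda>a. g \<theta> a * (grad (\<lambda>a'. ln (g \<theta> a') + 2 * \<eta> / \<beta>a\<^sup>2 * E \<theta> a') a \<bullet> \<nu>)) \<longlongrightarrow> 0) (at a0 within W)"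
  shows "set_integrable state_measure (misor_domain \<times> W)
        (\<lambda>(\<theta>, a). g \<theta> a * (norm (tgrad (\<lambda>\<theta>'. D * ln (g \<theta>' a) + E \<theta>' a) \<theta>))\<^sup>2)" (is ?int1)
    and "set_integrable state_measure (misor_domain \<times> W)
        (\<lambda>(\<theta>, a). g \<theta> a * (norm (grad (\<lambda>a'. D * ln (g \<theta> a') + E \<theta> a') a))\<^sup>2)" (is ?int2)
    and "(\<integral>z. indicator (hexagon \<times> (W - range x)) z *
          (r (plane_iso (fst z)) (snd z) * (D * ln (g (plane_iso (fst z)) (snd z)) + E (plane_iso (fst z)) (snd z) + D)) \<partial>lborel)
      = - (3 * \<gamma>) * set_lebesgue_integral state_measure (misor_domain \<times> W)
          (\<lambda>(\<theta>, a). g \<theta> a * (norm (tgrad (\<lambda>\<theta>'. D * ln (g \<theta>' a) + E \<theta>' a) \<theta>))\<^sup>2)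
        - \<eta> * set_lebesgue_integral state_measure (misor_domain \<times> W)
          (\<lambda>(\<theta>, a). g \<theta> a * (norm (grad (\<lambda>a'. D * ln (g \<theta> a') + E \<theta> a') a))\<^sup>2)" (is "?L = - (3 * \<gamma>) * ?S1 - \<eta> * ?S2")
proof -
  define V where "V = W - range x"
  define \<mu> where "\<mu> \<theta> a = D * ln (g \<theta> a) + E \<theta> a" for \<theta> a
  define I1 where "I1 \<theta> a = g \<theta> a * (norm (tgrad (\<lambda>\<theta>'. \<mu> \<theta>' a) \<theta>))\<^sup>2" for \<theta> a
  define I2 where "I2 \<theta> a = g \<theta> a * (norm (grad (\<lambda>a'. \<mu> \<theta> a') a))\<^sup>2" for \<theta> a
  have fX: "finite (range x)" by simp
  have oW: "open W" and bW: "bounded W" using W by (auto simp: regular_domain_def)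
  have oX: "open (UNIV - range x)" using fX by (intro open_Diff finite_imp_closed) simp_all
  have clD: "\<theta> \<in> closure misor_domain" if "\<theta> \<in> misor_domain" for \<theta> using that closure_subset by blast
  have clW: "a \<in> closure W" if "a \<in> V" for a using that closure_subset[of W] by (auto simp: V_def)
  have c\<sigma>: "continuous_on UNIV \<sigma>" using \<sigma>(1) by (meson DERIV_isCont continuous_at_imp_continuous_on)

  obtain g' where g': "c1_with G (\<lambda>(\<theta>, a). g \<theta> a) g'" by (rule C1_on_imp_c1_with[OF g1])
  obtain F1' where F1': "c1_with G (\<lambda>(\<theta>, a). tgrad (\<lambda>\<theta>'. g \<theta>' a) \<theta>) F1'" by (rule C1_on_imp_c1_with[OF g2])
  obtain F2' where F2': "c1_with G (\<lambda>(\<theta>, a). g \<theta> a *\<^sub>R vel_misor \<gamma> E \<theta> a) F2'" by (rule C1_on_imp_c1_with[OF g4])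
  obtain F3' where F3': "c1_with G (\<lambda>(\<theta>, a). grad (\<lambda>a'. g \<theta> a') a) F3'" by (rule C1_on_imp_c1_with[OF g3])
  obtain V' where V': "c1_with (UNIV \<times> (UNIV - range x)) (\<lambda>(\<theta>, a). grad (E \<theta>) a) V'"
    unfolding E_def by (rule c1_with_grad_energy[OF \<sigma>])
  \<comment> \<open>On this open part of \<open>G\<close> the density is positive and
    \<open>a\<close> avoids the points \<open>x j\<close>, so \<open>\<mu>\<close> is continuously
    differentiable.\<close>
  define G1 where "G1 = (G \<inter> (\<lambda>(\<theta>, a). g \<theta> a) -` {0<..}) \<inter> (UNIV \<times> (UNIV - range x))"
  have oG1: "open G1" unfolding G1_def
    by (intro open_Int continuous_open_preimage c1_with_continuous[OF g'] G open_greaterThan open_Times open_UNIV oX)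
  have sub: "(\<theta>, a) \<in> G1" if "\<theta> \<in> misor_domain" "a \<in> V" for \<theta> a
    using that G(2) gpos[OF clD clW] by (auto simp: G1_def V_def)
  have G1G: "G1 \<subseteq> G" "G1 \<subseteq> UNIV \<times> (UNIV - range x)" by (auto simp: G1_def)
  define E' where "E' = energy_deriv \<sigma> \<sigma>' x"
  have cE: "c1_with G1 (\<lambda>(\<theta>, a). E \<theta> a) E'"
    unfolding E_def E'_def by (rule c1_with_subset[OF c1_with_energy[OF \<sigma>] G1G(2)])
  have cg: "c1_with G1 (\<lambda>(\<theta>, a). g \<theta> a) g'" by (rule c1_with_subset[OF g' G1G(1)])
  define \<mu>' where "\<mu>' z v = D * (inverse (case z of (\<theta>, a) \<Rightarrow> g \<theta> a) * g' z v) + E' z v" for z v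
  have c\<mu>: "c1_with G1 (\<lambda>(\<theta>, a). \<mu> \<theta> a) \<mu>'"
  proof -
    have "c1_with G1 (\<lambda>z. ln (case z of (\<theta>, a) \<Rightarrow> g \<theta> a)) (\<lambda>z v. inverse (case z of (\<theta>, a) \<Rightarrow> g \<theta> a) * g' z v)"
    proof (rule c1_with_real_compose[where S="{0<..}", OF _ _ cg])
      show "(ln has_real_derivative inverse x) (at x)" if "x \<in> {0<..}" for x :: real
        using that by (intro DERIV_ln) simp
      show "continuous_on {0<..} (inverse :: real \<Rightarrow> real)" by (intro continuous_intros) auto
    qed (auto simp: G1_def)
    from c1_with_add[OF c1_with_bounded_linear[OF bounded_linear_mult_right[of D] this] cE]
    have "c1_with G1 (\<lambda>z. D * ln (case z of (\<theta>, a) \<Rightarrow> g \<theta> a) + (case z of (\<theta>, a) \<Rightarrow> E \<theta> a)) \<mu>'"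
      unfolding \<mu>'_def[abs_def] .
    then show ?thesis by (simp add: \<mu>_def[abs_def] case_prod_unfold)
  qed
  \<comment> \<open>The fluxes are introduced as the equation writes them, diffusion minus drift,
    since differentiability is available for exactly these terms; \<open>G0_eq\<close> and
    \<open>Ga_eq\<close> then give the gradient form.\<close>
  define G0 where "G0 \<theta> a = (\<beta>\<theta>\<^sup>2 / 2) *\<^sub>R tgrad (\<lambda>\<theta>'. g \<theta>' a) \<theta> - g \<theta> a *\<^sub>R vel_misor \<gamma> E \<theta> a" for \<theta> a
  define Ga where "Ga \<theta> a = (\<beta>a\<^sup>2 / 2) *\<^sub>R grad (\<lambda>a'. g \<theta> a') a - g \<theta> a *\<^sub>R vel_junction \<eta> E \<theta> a" for \<theta> a
  define G0' where "G0' z v = (\<beta>\<theta>\<^sup>2 / 2) *\<^sub>R F1' z v - F2' z v" for z v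
  have cG0: "c1_with G1 (\<lambda>(\<theta>, a). G0 \<theta> a) G0'"
  proof -
    have "c1_with G1 (\<lambda>z. (\<beta>\<theta>\<^sup>2 / 2) *\<^sub>R (case z of (\<theta>, a) \<Rightarrow> tgrad (\<lambda>\<theta>'. g \<theta>' a) \<theta>)
        - (case z of (\<theta>, a) \<Rightarrow> g \<theta> a *\<^sub>R vel_misor \<gamma> E \<theta> a)) G0'"
      unfolding G0'_def[abs_def]
      by (rule c1_with_diff[OF c1_with_bounded_linear[OF bounded_linear_scaleR_right c1_with_subset[OF F1' G1G(1)]]
          c1_with_subset[OF F2' G1G(1)]])
    then show ?thesis by (simp add: G0_def[abs_def] case_prod_unfold)
  qed
  have "\<exists>F4'. c1_with G1 (\<lambda>(\<theta>, a). g \<theta> a *\<^sub>R vel_junction \<eta> E \<theta> a) F4'"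
    using c1_with_scaleR[OF cg c1_with_bounded_linear[OF bounded_linear_scaleR_right[of "- \<eta>"] c1_with_subset[OF V' G1G(2)]]]
    by (auto simp: vel_junction_def case_prod_unfold)
  then obtain F4' where F4': "c1_with G1 (\<lambda>(\<theta>, a). g \<theta> a *\<^sub>R vel_junction \<eta> E \<theta> a) F4'" by blast
  define Ga' where "Ga' z v = (\<beta>a\<^sup>2 / 2) *\<^sub>R F3' z v - F4' z v" for z v
  have cGa: "c1_with G1 (\<lambda>(\<theta>, a). Ga \<theta> a) Ga'"
  proof -
    have "c1_with G1 (\<lambda>z. (\<beta>a\<^sup>2 / 2) *\<^sub>R (case z of (\<theta>, a) \<Rightarrow> grad (\<lambda>a'. g \<theta> a') a)
        - (case z of (\<theta>, a) \<Rightarrow> g \<theta> a *\<^sub>R vel_junction \<eta> E \<theta> a)) Ga'"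
      unfolding Ga'_def[abs_def]
      by (rule c1_with_diff[OF c1_with_bounded_linear[OF bounded_linear_scaleR_right c1_with_subset[OF F3' G1G(1)]] F4'])
    then show ?thesis by (simp add: Ga_def[abs_def] case_prod_unfold)
  qed

  \<comment> \<open>The fluxes as multiples of the gradients of \<open>\<mu>\<close>\<close>
  have G0_sum: "G0 \<theta> a = (\<beta>\<theta>\<^sup>2 / 2) *\<^sub>R tgrad (\<lambda>\<theta>'. g \<theta>' a) \<theta> + (3 * \<gamma> * g \<theta> a) *\<^sub>R tgrad (\<lambda>\<theta>'. E \<theta>' a) \<theta>" for \<theta> a
    by (simp add: G0_def vel_misor_def mult.commute)
  have Ga_sum: "Ga \<theta> a = (\<beta>a\<^sup>2 / 2) *\<^sub>R grad (\<lambda>a'. g \<theta> a') a + (\<eta> * g \<theta> a) *\<^sub>R grad (\<lambda>a'. E \<theta> a') a" for \<theta> a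
    by (simp add: Ga_def vel_junction_def mult.commute)
  \<comment> \<open>Both sides are tangent to the plane, so pairing with plane directions suffices;
    there the diffusion term matches because
    \<open>\<beta>\<theta>\<^sup>2 / 2 = 3 * \<gamma> * D\<close>.\<close>
  have G0_eq: "G0 \<theta> a = (3 * \<gamma> * g \<theta> a) *\<^sub>R tgrad (\<lambda>\<theta>'. \<mu> \<theta>' a) \<theta>" if z: "(\<theta>, a) \<in> G1" for \<theta> a
  proof (rule in_plane_eqI)
    show "G0 \<theta> a \<in> misor_plane" unfolding G0_sum by (intro misor_plane_lincomb tgrad_in_plane)
    show "(3 * \<gamma> * g \<theta> a) *\<^sub>R tgrad (\<lambda>\<theta>'. \<mu> \<theta>' a) \<theta> \<in> misor_plane"
      using misor_plane_lincomb[OF tgrad_in_plane tgrad_in_plane, of "3 * \<gamma> * g \<theta> a" _ _ 0] by simp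
    fix u
    have gp: "g \<theta> a > 0" using z by (simp add: G1_def)
    show "G0 \<theta> a \<bullet> plane_iso u = (3 * \<gamma> * g \<theta> a) *\<^sub>R tgrad (\<lambda>\<theta>'. \<mu> \<theta>' a) \<theta> \<bullet> plane_iso u"
      unfolding G0_sum inner_add_left inner_scaleR_left tgrad_inner[OF c1_with_partials(1)[OF cg z]]
        tgrad_inner[OF c1_with_partials(1)[OF cE z]] tgrad_inner[OF c1_with_partials(1)[OF c\<mu> z]]
      using gp by (simp add: \<mu>'_def par(4) field_simps)
  qed
  have Ga_eq: "Ga \<theta> a = (\<eta> * g \<theta> a) *\<^sub>R grad (\<lambda>a'. \<mu> \<theta> a') a" if z: "(\<theta>, a) \<in> G1" for \<theta> a
  proof -
    have gp: "g \<theta> a > 0" using z by (simp add: G1_def)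
    have "Ga \<theta> a \<bullet> w = (\<eta> * g \<theta> a) *\<^sub>R grad (\<lambda>a'. \<mu> \<theta> a') a \<bullet> w" for w
      unfolding Ga_sum inner_add_left inner_scaleR_left grad_inner[OF c1_with_partials(2)[OF cg z]]
        grad_inner[OF c1_with_partials(2)[OF cE z]] grad_inner[OF c1_with_partials(2)[OF c\<mu> z]]
      using gp by (simp add: \<mu>'_def par(5) field_simps)
    then show ?thesis using vector_eq_rdot by blast
  qed

  define j where "j z = (plane_iso (fst z), snd z)" for z :: "(real^2) \<times> (real^2)"
  have jl: "bounded_linear j"
    unfolding j_def linear_conv_bounded_linear[symmetric]
    by (rule linearI) (simp_all add: linear_add[OF plane_iso_linear] linear_cmul[OF plane_iso_linear])
  define Om where "Om = hexagon \<times> V"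
  have jO: "plane_iso (fst z) \<in> misor_domain" "snd z \<in> V" "j z \<in> G1" if "z \<in> Om" for z
    using that sub[of "plane_iso (fst z)" "snd z"] by (auto simp: Om_def hexagon_def j_def)
  \<comment> \<open>The flux in planar coordinates; \<open>plane_coord\<close> loses nothing because
    \<open>G0\<close> is tangent to the plane.\<close>
  define K where "K z = (plane_coord (G0 (plane_iso (fst z)) (snd z)), Ga (plane_iso (fst z)) (snd z))" for z
  define K' where "K' z v = (plane_coord (G0' (j z) (j v)), Ga' (j z) (j v))" for z v
  define M where "M z = \<mu> (plane_iso (fst z)) (snd z) + D" for z :: "(real^2) \<times> (real^2)"
  have pcl: "bounded_linear plane_coord" by (simp add: linear_conv_bounded_linear[symmetric] plane_coord_linear)
  have cK: "c1_with Om K K'"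
  proof -
    have 1: "c1_with Om (\<lambda>z. plane_coord (case j z of (\<theta>, a) \<Rightarrow> G0 \<theta> a)) (\<lambda>z v. plane_coord (G0' (j z) (j v)))"
      by (rule c1_with_bounded_linear[OF pcl c1_with_compose_linear[OF jl cG0 jO(3)]])
    have 2: "c1_with Om (\<lambda>z. case j z of (\<theta>, a) \<Rightarrow> Ga \<theta> a) (\<lambda>z v. Ga' (j z) (j v))"
      by (rule c1_with_compose_linear[OF jl cGa jO(3)])
    from c1_with_Pair[OF 1 2] show ?thesis unfolding K_def[abs_def] K'_def[abs_def] by (simp add: j_def)
  qed
  have cM: "c1_with Om M (\<lambda>z v. \<mu>' (j z) (j v))"
  proof -
    have "c1_with Om (\<lambda>z. (case j z of (\<theta>, a) \<Rightarrow> \<mu> \<theta> a) + D) (\<lambda>z v. \<mu>' (j z) (j v) + 0)"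
      by (rule c1_with_add[OF c1_with_compose_linear[OF jl c\<mu> jO(3)] c1_with_const])
    then show ?thesis unfolding M_def[abs_def] by (simp add: j_def)
  qed
  define H where "H z = M z *\<^sub>R K z" for z
  define H' where "H' z v = M z *\<^sub>R K' z v + \<mu>' (j z) (j v) *\<^sub>R K z" for z v
  have cH: "c1_with Om H H'" unfolding H_def[abs_def] H'_def[abs_def] by (rule c1_with_scaleR[OF cM cK])
  \<comment> \<open>Product rule for \<open>M\<close> times \<open>K\<close>: the divergence of
    \<open>K\<close> is \<open>r\<close> by the equation, and the derivative of \<open>M\<close>
    along \<open>K\<close> splits into the two squared gradients. No second derivative remains on
    the right, which is what makes it bounded.\<close>
  have div_eq: "(\<Sum>b\<in>Basis. H' z b \<bullet> b) = M z * r (plane_iso (fst z)) (snd z)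
      + 3 * \<gamma> * I1 (plane_iso (fst z)) (snd z) + \<eta> * I2 (plane_iso (fst z)) (snd z)" if z: "z \<in> Om" for z
  proof -
    define \<theta> where "\<theta> = plane_iso (fst z)"
    define a where "a = snd z"
    have zG: "(\<theta>, a) \<in> G1" using jO(3)[OF z] by (simp add: j_def \<theta>_def a_def)
    have zG': "(\<theta>, a) \<in> G" using zG G1G by blast
    have \<theta>: "\<theta> \<in> misor_domain" "a \<in> W - range x" using jO[OF z] by (simp_all add: \<theta>_def a_def V_def)
    have jz: "j z = (\<theta>, a)" by (simp add: j_def \<theta>_def a_def)
    have "(\<Sum>b\<in>Basis. H' z b \<bullet> b) = M z * (\<Sum>b\<in>Basis. K' z b \<bullet> b) + (\<Sum>b\<in>Basis. (K z \<bullet> b) * \<mu>' (j z) (j b))"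
      by (simp add: H'_def inner_add_left sum.distrib sum_distrib_left mult.commute)
    also have "(\<Sum>b\<in>Basis. K' z b \<bullet> b) = r \<theta> a"
    proof -
      have "(\<Sum>b\<in>Basis. K' z b \<bullet> b) = (\<Sum>i\<in>UNIV. G0' (\<theta>, a) (plane_iso (axis i 1), 0) \<bullet> plane_iso (axis i 1))
          + (\<Sum>i\<in>UNIV. Ga' (\<theta>, a) (0, axis i 1) \<bullet> axis i 1)"
        unfolding sum_Basis_prod_vec2 K'_def jz
        by (simp add: j_def plane_coord_inner linear_0[OF plane_iso_linear])
      also have "(\<Sum>i\<in>UNIV. G0' (\<theta>, a) (plane_iso (axis i 1), 0) \<bullet> plane_iso (axis i 1))
          = \<beta>\<theta>\<^sup>2 / 2 * tlaplace (\<lambda>\<theta>'. g \<theta>' a) \<theta> - tdiverg (\<lambda>\<theta>'. g \<theta>' a *\<^sub>R vel_misor \<gamma> E \<theta>' a) \<theta>"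
        unfolding tlaplace_def tdiverg_eq[OF c1_with_partials(1)[OF F1' zG']] tdiverg_eq[OF c1_with_partials(1)[OF F2' zG']]
        by (simp add: G0'_def inner_diff_left sum_subtractf sum_distrib_left)
      also have "(\<Sum>i\<in>UNIV. Ga' (\<theta>, a) (0, axis i 1) \<bullet> axis i 1)
          = \<beta>a\<^sup>2 / 2 * laplace (\<lambda>a'. g \<theta> a') a - diverg (\<lambda>a'. g \<theta> a' *\<^sub>R vel_junction \<eta> E \<theta> a') a"
        unfolding laplace_def diverg_eq[OF c1_with_partials(2)[OF F3' zG']] diverg_eq[OF c1_with_partials(2)[OF F4' zG]]
        by (simp add: Ga'_def inner_diff_left sum_subtractf sum_distrib_left)
      finally show ?thesis using fp[OF \<theta>] by linarith
    qed
    also have "(\<Sum>b\<in>Basis. (K z \<bullet> b) * \<mu>' (j z) (j b)) = \<mu>' (j z) (j (K z))"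
    proof -
      have dM: "(M has_derivative (\<lambda>v. \<mu>' (j z) (j v))) (at z)" using cM z by (simp add: c1_with_def)
      show ?thesis by (rule linear_eq_sum_Basis[OF has_derivative_linear[OF dM], symmetric])
    qed
    also have "\<dots> = \<mu>' (\<theta>, a) (G0 \<theta> a, 0) + \<mu>' (\<theta>, a) (0, Ga \<theta> a)"
    proof -
      have "((\<lambda>(\<theta>, a). \<mu> \<theta> a) has_derivative \<mu>' (\<theta>, a)) (at (\<theta>, a))" using c\<mu> zG by (simp add: c1_with_def)
      then have l: "linear (\<mu>' (\<theta>, a))" by (rule has_derivative_linear)
      have G0p: "G0 \<theta> a \<in> misor_plane"
        unfolding G0_eq[OF zG] using misor_plane_lincomb[OF tgrad_in_plane tgrad_in_plane, of "3 * \<gamma> * g \<theta> a" _ _ 0] by simp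
      have "j (K z) = (G0 \<theta> a, 0) + (0, Ga \<theta> a)"
        by (simp add: j_def K_def \<theta>_def[symmetric] a_def[symmetric] plane_iso_plane_coord[OF G0p])
      then show ?thesis unfolding jz by (simp only: linear_add[OF l])
    qed
    also have "\<mu>' (\<theta>, a) (G0 \<theta> a, 0) = 3 * \<gamma> * I1 \<theta> a"
    proof -
      define T where "T = tgrad (\<lambda>\<theta>'. \<mu> \<theta>' a) \<theta>"
      have Tp: "plane_iso (plane_coord T) = T" unfolding T_def by (rule plane_iso_plane_coord[OF tgrad_in_plane])
      have d: "((\<lambda>\<theta>. \<mu> \<theta> a) has_derivative (\<lambda>v. \<mu>' (\<theta>, a) (v, 0))) (at \<theta>)" by (rule c1_with_partials(1)[OF c\<mu> zG])
      have "\<mu>' (\<theta>, a) (G0 \<theta> a, 0) = (3 * \<gamma> * g \<theta> a) * \<mu>' (\<theta>, a) (T, 0)"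
        using linear_cmul[OF has_derivative_linear[OF d], of "3 * \<gamma> * g \<theta> a" T] by (simp add: G0_eq[OF zG] T_def)
      also have "\<mu>' (\<theta>, a) (T, 0) = T \<bullet> T" using tgrad_inner[OF d, of "plane_coord T"] unfolding Tp T_def[symmetric] by simp
      finally show ?thesis by (simp add: I1_def T_def[symmetric] power2_norm_eq_inner)
    qed
    also have "\<mu>' (\<theta>, a) (0, Ga \<theta> a) = \<eta> * I2 \<theta> a"
    proof -
      define T where "T = grad (\<lambda>a'. \<mu> \<theta> a') a"
      have d: "((\<lambda>a. \<mu> \<theta> a) has_derivative (\<lambda>v. \<mu>' (\<theta>, a) (0, v))) (at a)" by (rule c1_with_partials(2)[OF c\<mu> zG])
      have "\<mu>' (\<theta>, a) (0, Ga \<theta> a) = (\<eta> * g \<theta> a) * \<mu>' (\<theta>, a) (0, T)"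
        using linear_cmul[OF has_derivative_linear[OF d], of "\<eta> * g \<theta> a" T] by (simp add: Ga_eq[OF zG] T_def)
      also have "\<mu>' (\<theta>, a) (0, T) = T \<bullet> T" using grad_inner[OF d, of T] by (simp add: T_def)
      finally show ?thesis by (simp add: I2_def T_def[symmetric] power2_norm_eq_inner)
    qed
    finally show ?thesis by (simp add: \<theta>_def a_def)
  qed

  \<comment> \<open>Bounds and continuity of the fluxes and dissipation densities\<close>
  have lncont: "continuous_on (closure misor_domain \<times> closure W) (\<lambda>z. ln (case z of (\<theta>, a) \<Rightarrow> g \<theta> a))"
    by (intro continuous_on_ln gcont) (use gpos in force)
  have icont: "continuous_on (closure misor_domain \<times> closure W) (\<lambda>(\<theta>, a). inverse (g \<theta> a))"
  proof -
    have "continuous_on (closure misor_domain \<times> closure W) (\<lambda>z. inverse (case z of (\<theta>, a) \<Rightarrow> g \<theta> a))"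
      by (intro continuous_on_inverse gcont) (use gpos in force)
    then show ?thesis by (simp add: case_prod_unfold)
  qed
  have econt: "continuous_on (closure misor_domain \<times> closure W) (\<lambda>(\<theta>, a). E \<theta> a)"
    unfolding E_def by (rule continuous_on_energy[OF c\<sigma>])
  have \<mu>cont: "continuous_on (closure misor_domain \<times> closure W) (\<lambda>(\<theta>, a). \<mu> \<theta> a + D)"
  proof -
    have "continuous_on (closure misor_domain \<times> closure W)
        (\<lambda>z. D * ln (case z of (\<theta>, a) \<Rightarrow> g \<theta> a) + (case z of (\<theta>, a) \<Rightarrow> E \<theta> a) + D)"
      by (intro continuous_on_add continuous_on_mult_left continuous_on_const lncont econt)
    then show ?thesis by (simp add: \<mu>_def case_prod_unfold)
  qed
  obtain Cg where Cg: "Cg \<ge> 0" "\<And>\<theta> a. \<theta> \<in> misor_domain \<Longrightarrow> a \<in> W \<Longrightarrow> \<bar>g \<theta> a\<bar> \<le> Cg" using closure_bound[OF bW gcont] by blast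
  \<comment> \<open>\<open>g\<close> is positive and continuous on a compact set, so its reciprocal
    is bounded; this controls the dissipation densities, which are squared fluxes divided by
    \<open>g\<close> up to constants.\<close>
  obtain Ci where Ci: "Ci \<ge> 0" "\<And>\<theta> a. \<theta> \<in> misor_domain \<Longrightarrow> a \<in> W \<Longrightarrow> \<bar>inverse (g \<theta> a)\<bar> \<le> Ci" using closure_bound[OF bW icont] by blast
  obtain Cr where Cr: "Cr \<ge> 0" "\<And>\<theta> a. \<theta> \<in> misor_domain \<Longrightarrow> a \<in> W \<Longrightarrow> \<bar>r \<theta> a\<bar> \<le> Cr" using closure_bound[OF bW rcont] by blast
  obtain CM where CM: "CM \<ge> 0" "\<And>\<theta> a. \<theta> \<in> misor_domain \<Longrightarrow> a \<in> W \<Longrightarrow> \<bar>\<mu> \<theta> a + D\<bar> \<le> CM" using closure_bound[OF bW \<mu>cont] by blast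
  obtain C1 where C1: "\<And>\<theta> a. \<theta> \<in> misor_domain \<Longrightarrow> a \<in> V \<Longrightarrow> norm (tgrad (\<lambda>\<theta>'. g \<theta>' a) \<theta>) \<le> C1"
    using b2 unfolding bounded_iff V_def by force
  obtain C2 where C2: "\<And>\<theta> a. \<theta> \<in> misor_domain \<Longrightarrow> a \<in> V \<Longrightarrow> norm (grad (\<lambda>a'. g \<theta> a') a) \<le> C2"
    using b3 unfolding bounded_iff V_def by force
  obtain B where B: "\<And>\<theta> a v. \<theta> \<in> misor_domain \<Longrightarrow> a \<in> W \<Longrightarrow> \<bar>E' (\<theta>, a) v\<bar> \<le> B * norm v"
    unfolding E'_def using energy_deriv_bound[OF \<sigma> bW] by blast
  have VW: "a \<in> W" if "a \<in> V" for a using that by (simp add: V_def)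
  have tE: "norm (tgrad (\<lambda>\<theta>'. E \<theta>' a) \<theta>) \<le> B" if "\<theta> \<in> misor_domain" "a \<in> V" for \<theta> a
    by (rule tgrad_norm_le[OF c1_with_partials(1)[OF cE sub[OF that]]]) (use B[OF that(1) VW[OF that(2)], of "(_, 0)"] in simp)
  have gE: "norm (grad (\<lambda>a'. E \<theta> a') a) \<le> B" if "\<theta> \<in> misor_domain" "a \<in> V" for \<theta> a
    by (rule grad_norm_le[OF c1_with_partials(2)[OF cE sub[OF that]]]) (use B[OF that(1) VW[OF that(2)], of "(0, _)"] in simp)
  define C0 where "C0 = \<beta>\<theta>\<^sup>2 / 2 * C1 + 3 * \<gamma> * Cg * B"
  define Ca where "Ca = \<beta>a\<^sup>2 / 2 * C2 + \<eta> * Cg * B"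
  have G0b: "norm (G0 \<theta> a) \<le> C0" if z: "\<theta> \<in> misor_domain" "a \<in> V" for \<theta> a
  proof -
    have "norm ((\<beta>\<theta>\<^sup>2 / 2) *\<^sub>R tgrad (\<lambda>\<theta>'. g \<theta>' a) \<theta>) \<le> \<beta>\<theta>\<^sup>2 / 2 * C1"
      unfolding norm_scaleR using C1[OF z] by (simp add: mult_left_mono)
    moreover have "norm ((3 * \<gamma> * g \<theta> a) *\<^sub>R tgrad (\<lambda>\<theta>'. E \<theta>' a) \<theta>) \<le> (3 * \<gamma> * Cg) * B"
      unfolding norm_scaleR
      by (rule mult_mono[OF _ tE[OF z]]) (use Cg(2)[OF z(1) VW[OF z(2)]] Cg(1) par in \<open>simp_all add: abs_mult\<close>)
    ultimately show ?thesis unfolding G0_sum C0_def by (rule norm_triangle_le[OF add_mono])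
  qed
  have Gab: "norm (Ga \<theta> a) \<le> Ca" if z: "\<theta> \<in> misor_domain" "a \<in> V" for \<theta> a
  proof -
    have "norm ((\<beta>a\<^sup>2 / 2) *\<^sub>R grad (\<lambda>a'. g \<theta> a') a) \<le> \<beta>a\<^sup>2 / 2 * C2"
      unfolding norm_scaleR using C2[OF z] by (simp add: mult_left_mono)
    moreover have "norm ((\<eta> * g \<theta> a) *\<^sub>R grad (\<lambda>a'. E \<theta> a') a) \<le> (\<eta> * Cg) * B"
      unfolding norm_scaleR
      by (rule mult_mono[OF _ gE[OF z]]) (use Cg(2)[OF z(1) VW[OF z(2)]] Cg(1) par in \<open>simp_all add: abs_mult\<close>)
    ultimately show ?thesis unfolding Ga_sum Ca_def by (rule norm_triangle_le[OF add_mono])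
  qed
  \<comment> \<open>Written through the flux, the dissipation density inherits continuity and bounds
    from \<open>G0\<close> and \<open>g\<close>, for which both are already known.\<close>
  have I1_eq: "I1 \<theta> a = (norm (G0 \<theta> a))\<^sup>2 * inverse (g \<theta> a) / (9 * \<gamma>\<^sup>2)" if z: "\<theta> \<in> misor_domain" "a \<in> V" for \<theta> a
  proof -
    have gp: "g \<theta> a > 0" using sub[OF z] by (simp add: G1_def)
    show ?thesis unfolding G0_eq[OF sub[OF z]] I1_def norm_scaleR power_mult_distrib
      using gp par by (simp add: power2_eq_square field_simps)
  qed
  have I2_eq: "I2 \<theta> a = (norm (Ga \<theta> a))\<^sup>2 * inverse (g \<theta> a) / \<eta>\<^sup>2" if z: "\<theta> \<in> misor_domain" "a \<in> V" for \<theta> a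
  proof -
    have gp: "g \<theta> a > 0" using sub[OF z] by (simp add: G1_def)
    show ?thesis unfolding Ga_eq[OF sub[OF z]] I2_def norm_scaleR power_mult_distrib
      using gp par by (simp add: power2_eq_square field_simps)
  qed
  have I1b: "\<bar>I1 \<theta> a\<bar> \<le> C0\<^sup>2 * Ci / (9 * \<gamma>\<^sup>2)" if z: "\<theta> \<in> misor_domain" "a \<in> V" for \<theta> a
  proof -
    have "\<bar>(norm (G0 \<theta> a))\<^sup>2\<bar> * \<bar>inverse (g \<theta> a)\<bar> \<le> C0\<^sup>2 * Ci"
      by (rule mult_mono[OF _ Ci(2)[OF z(1) VW[OF z(2)]]]) (use G0b[OF z] in \<open>simp_all add: power_mono\<close>)
    then show ?thesis unfolding I1_eq[OF z] using par by (simp add: abs_mult divide_right_mono)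
  qed
  have I2b: "\<bar>I2 \<theta> a\<bar> \<le> Ca\<^sup>2 * Ci / \<eta>\<^sup>2" if z: "\<theta> \<in> misor_domain" "a \<in> V" for \<theta> a
  proof -
    have "\<bar>(norm (Ga \<theta> a))\<^sup>2\<bar> * \<bar>inverse (g \<theta> a)\<bar> \<le> Ca\<^sup>2 * Ci"
      by (rule mult_mono[OF _ Ci(2)[OF z(1) VW[OF z(2)]]]) (use Gab[OF z] in \<open>simp_all add: power_mono\<close>)
    then show ?thesis unfolding I2_eq[OF z] using par by (simp add: abs_mult divide_right_mono)
  qed
  have hD: "plane_iso u \<in> misor_domain" if "u \<in> hexagon" for u using that by (simp add: hexagon_def)
  have comp: "continuous_on Om (\<lambda>z. case j z of (\<theta>, a) \<Rightarrow> \<phi> \<theta> a)"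
    if "c1_with G1 (\<lambda>(\<theta>, a). \<phi> \<theta> a) \<phi>'" for \<phi> :: "real^3 \<Rightarrow> real^2 \<Rightarrow> 'c::real_normed_vector" and \<phi>'
    by (rule c1_with_continuous[OF c1_with_compose_linear[OF jl that jO(3)]])
  have gj: "(case j z of (\<theta>, a) \<Rightarrow> g \<theta> a) \<noteq> 0" if "z \<in> Om" for z
    using jO(3)[OF that] by (auto simp: G1_def)
  have I1c: "continuous_on (hexagon \<times> (W - range x)) (\<lambda>(u, a). I1 (plane_iso u) a)"
  proof -
    have "continuous_on Om (\<lambda>z. (norm (case j z of (\<theta>, a) \<Rightarrow> G0 \<theta> a))\<^sup>2 * inverse (case j z of (\<theta>, a) \<Rightarrow> g \<theta> a) / (9 * \<gamma>\<^sup>2))"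
      using gj par by (intro continuous_intros comp[OF cG0] comp[OF cg]) auto
    then have "continuous_on Om (\<lambda>(u, a). I1 (plane_iso u) a)"
      by (rule continuous_on_eq) (use hD in \<open>auto simp: j_def I1_eq Om_def\<close>)
    then show ?thesis by (simp add: Om_def V_def)
  qed
  have I2c: "continuous_on (hexagon \<times> (W - range x)) (\<lambda>(u, a). I2 (plane_iso u) a)"
  proof -
    have "continuous_on Om (\<lambda>z. (norm (case j z of (\<theta>, a) \<Rightarrow> Ga \<theta> a))\<^sup>2 * inverse (case j z of (\<theta>, a) \<Rightarrow> g \<theta> a) / \<eta>\<^sup>2)"
      using gj par by (intro continuous_intros comp[OF cGa] comp[OF cg]) auto
    then have "continuous_on Om (\<lambda>(u, a). I2 (plane_iso u) a)"
      by (rule continuous_on_eq) (use hD in \<open>auto simp: j_def I2_eq Om_def\<close>)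
    then show ?thesis by (simp add: Om_def V_def)
  qed
  note tr1 = state_integral_transfer[of W "range x" I1, OF oW bW fX I1c I1b[OF hD, unfolded V_def]]
  note tr2 = state_integral_transfer[of W "range x" I2, OF oW bW fX I2c I2b[OF hD, unfolded V_def]]
  have rMcont: "continuous_on (closure misor_domain \<times> closure W) (\<lambda>(\<theta>, a). (\<mu> \<theta> a + D) * r \<theta> a)"
  proof -
    have "continuous_on (closure misor_domain \<times> closure W)
       (\<lambda>z. (case z of (\<theta>, a) \<Rightarrow> \<mu> \<theta> a + D) * (case z of (\<theta>, a) \<Rightarrow> r \<theta> a))"
      by (intro continuous_on_mult \<mu>cont rcont)
    then show ?thesis by (simp add: case_prod_unfold)
  qed
  note tr3 = state_integral_transfer_closure[OF oW bW fX rMcont]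

  \<comment> \<open>Application of the divergence theorem\<close>
  have "(\<integral>z. indicator (hexagon \<times> (W - range x)) z * (\<Sum>b\<in>Basis. H' z b \<bullet> b) \<partial>lborel) = 0"
  proof (rule divergence_integral_eq_0[OF regular_domain_hexagon W fX])
    show "c1_with (hexagon \<times> (W - range x)) H H'" using cH by (simp add: Om_def V_def)
    show "bounded (H ` (hexagon \<times> (W - range x)))"
      unfolding bounded_iff
    proof (intro exI ballI)
      fix y assume "y \<in> H ` (hexagon \<times> (W - range x))"
      then obtain z where z: "z \<in> Om" "y = H z" unfolding Om_def V_def by blast
      note zz = jO(1,2)[OF z(1)]
      have "norm (K z) \<le> C0 + Ca"
        unfolding K_def
        by (rule order_trans[OF norm_Pair_le add_mono[OF order_trans[OF plane_coord_norm_le G0b[OF zz]] Gab[OF zz]]])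
      then show "norm y \<le> CM * (C0 + Ca)"
        unfolding z(2) H_def norm_scaleR M_def real_norm_def
        by (intro mult_mono) (use CM(1) CM(2)[OF zz(1) VW[OF zz(2)]] in simp_all)
    qed
    show "bounded ((\<lambda>z. \<Sum>b\<in>Basis. H' z b \<bullet> b) ` (hexagon \<times> (W - range x)))"
      unfolding bounded_iff
    proof (intro exI ballI)
      fix y assume "y \<in> (\<lambda>z. \<Sum>b\<in>Basis. H' z b \<bullet> b) ` (hexagon \<times> (W - range x))"
      then obtain z where z: "z \<in> Om" "y = (\<Sum>b\<in>Basis. H' z b \<bullet> b)" unfolding Om_def V_def by blast
      note zz = jO(1,2)[OF z(1)]
      have 1: "\<bar>M z * r (plane_iso (fst z)) (snd z)\<bar> \<le> CM * Cr"
        unfolding abs_mult M_def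
        by (intro mult_mono) (use CM(1) CM(2)[OF zz(1) VW[OF zz(2)]] Cr(2)[OF zz(1) VW[OF zz(2)]] in simp_all)
      have 2: "\<bar>3 * \<gamma> * I1 (plane_iso (fst z)) (snd z)\<bar> \<le> 3 * \<gamma> * (C0\<^sup>2 * Ci / (9 * \<gamma>\<^sup>2))"
        using mult_left_mono[OF I1b[OF zz], of "3 * \<gamma>"] par by (simp only: abs_mult) simp
      have 3: "\<bar>\<eta> * I2 (plane_iso (fst z)) (snd z)\<bar> \<le> \<eta> * (Ca\<^sup>2 * Ci / \<eta>\<^sup>2)"
        using mult_left_mono[OF I2b[OF zz], of "\<eta>"] par by (simp only: abs_mult) simp
      show "norm y \<le> CM * Cr + 3 * \<gamma> * (C0\<^sup>2 * Ci / (9 * \<gamma>\<^sup>2)) + \<eta> * (Ca\<^sup>2 * Ci / \<eta>\<^sup>2)"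
        unfolding z(2) div_eq[OF z(1)] real_norm_def using 1 2 3 by linarith
    qed
  next
    fix a p \<nu> assume a: "a \<in> W - range x" and p: "p \<in> frontier hexagon" and \<nu>: "outer_unit_normal UNIV hexagon p \<nu>"
    \<comment> \<open>The boundary condition concerns \<open>\<psi> = \<mu> / D\<close>, because
      \<open>6 * \<gamma> / \<beta>\<theta>\<^sup>2 = 1 / D\<close>; the bounded factor
      \<open>M\<close> and the constant \<open>3 * \<gamma> * D\<close> turn it into the flux of
      \<open>H\<close>.\<close>
    define \<psi> where "\<psi> \<theta> = ln (g \<theta> a) + 6 * \<gamma> / \<beta>\<theta>\<^sup>2 * E \<theta> a" for \<theta>
    have aV: "a \<in> V" using a by (simp add: V_def)
    have "((\<lambda>\<theta>. g \<theta> a * (tgrad \<psi> \<theta> \<bullet> plane_iso \<nu>)) \<longlongrightarrow> 0) (at (plane_iso p) within misor_domain)"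
      unfolding \<psi>_def[abs_def]
      by (rule bc1[OF a plane_iso_rel_frontier[OF p] outer_unit_normal_plane_iso[OF \<nu>]])
    from filterlim_compose[OF this filterlim_plane_iso]
    have lim: "((\<lambda>u. g (plane_iso u) a * (tgrad \<psi> (plane_iso u) \<bullet> plane_iso \<nu>)) \<longlongrightarrow> 0) (at p within hexagon)" .
    have eq: "fst (H (u, a)) \<bullet> \<nu> = M (u, a) * (3 * \<gamma> * D) * (g (plane_iso u) a * (tgrad \<psi> (plane_iso u) \<bullet> plane_iso \<nu>))"
      if u: "u \<in> hexagon" for u
    proof -
      define \<theta> where "\<theta> = plane_iso u"
      have z: "(\<theta>, a) \<in> G1" using sub[OF hD[OF u] aV] by (simp add: \<theta>_def)
      have d: "((\<lambda>\<theta>. \<mu> \<theta> a) has_derivative (\<lambda>v. \<mu>' (\<theta>, a) (v, 0))) (at \<theta>)" by (rule c1_with_partials(1)[OF c\<mu> z])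
      have "\<psi> = (\<lambda>\<theta>. \<mu> \<theta> a / D)" unfolding \<psi>_def[abs_def] \<mu>_def using par by (simp add: field_simps)
      then have d\<psi>: "(\<psi> has_derivative (\<lambda>v. \<mu>' (\<theta>, a) (v, 0) / D)) (at \<theta>)"
        using bounded_linear.has_derivative[OF bounded_linear_divide[of D] d] by simp
      have "tgrad (\<lambda>\<theta>. \<mu> \<theta> a) \<theta> \<bullet> plane_iso \<nu> = D * (tgrad \<psi> \<theta> \<bullet> plane_iso \<nu>)"
        unfolding tgrad_inner[OF d] tgrad_inner[OF d\<psi>] using par by simp
      then have "G0 \<theta> a \<bullet> plane_iso \<nu> = 3 * \<gamma> * g \<theta> a * (D * (tgrad \<psi> \<theta> \<bullet> plane_iso \<nu>))"
        unfolding G0_eq[OF z] by simp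
      then show ?thesis by (simp add: H_def K_def plane_coord_inner \<theta>_def[symmetric])
    qed
    show "((\<lambda>u. fst (H (u, a)) \<bullet> \<nu>) \<longlongrightarrow> 0) (at p within hexagon)"
    proof (rule Lim_null_comparison)
      show "((\<lambda>u. CM * (3 * \<gamma> * D) * \<bar>g (plane_iso u) a * (tgrad \<psi> (plane_iso u) \<bullet> plane_iso \<nu>)\<bar>) \<longlongrightarrow> 0) (at p within hexagon)"
        by (intro tendsto_mult_right_zero tendsto_rabs_zero lim)
      have "norm (fst (H (u, a)) \<bullet> \<nu>) \<le> CM * (3 * \<gamma> * D) * \<bar>g (plane_iso u) a * (tgrad \<psi> (plane_iso u) \<bullet> plane_iso \<nu>)\<bar>"
        if u: "u \<in> hexagon" for u
        unfolding eq[OF u] real_norm_def abs_mult[of "M (u, a) * (3 * \<gamma> * D)"]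
        by (rule mult_right_mono[OF _ abs_ge_zero])
          (use CM(2)[OF hD[OF u] VW[OF aV]] par in \<open>simp add: abs_mult M_def\<close>)
      then show "\<forall>\<^sub>F u in at p within hexagon. norm (fst (H (u, a)) \<bullet> \<nu>)
          \<le> CM * (3 * \<gamma> * D) * \<bar>g (plane_iso u) a * (tgrad \<psi> (plane_iso u) \<bullet> plane_iso \<nu>)\<bar>"
        unfolding eventually_at_filter by (intro always_eventually) simp
    qed
  next
    fix u p \<nu> assume u: "u \<in> hexagon" and p: "p \<in> frontier W - range x" and \<nu>: "outer_unit_normal UNIV W p \<nu>"
    define \<theta> where "\<theta> = plane_iso u"
    define \<psi> where "\<psi> a = ln (g \<theta> a) + 2 * \<eta> / \<beta>a\<^sup>2 * E \<theta> a" for a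
    have \<theta>: "\<theta> \<in> misor_domain" using hD[OF u] by (simp add: \<theta>_def)
    have "((\<lambda>a. g \<theta> a * (grad \<psi> a \<bullet> \<nu>)) \<longlongrightarrow> 0) (at p within W)"
      unfolding \<psi>_def[abs_def] by (rule bc2[OF \<theta> p \<nu>])
    \<comment> \<open>The condition is given along \<open>W\<close>; the divergence theorem asks for
      it only along the smaller set off the points \<open>x j\<close>.\<close>
    then have lim: "((\<lambda>a. g \<theta> a * (grad \<psi> a \<bullet> \<nu>)) \<longlongrightarrow> 0) (at p within (W - range x))"
      by (rule tendsto_within_subset) blast
    have eq: "snd (H (u, a)) \<bullet> \<nu> = M (u, a) * (\<eta> * D) * (g \<theta> a * (grad \<psi> a \<bullet> \<nu>))"
      if a: "a \<in> V" for a
    proof -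
      have z: "(\<theta>, a) \<in> G1" by (rule sub[OF \<theta> a])
      have d: "((\<lambda>a. \<mu> \<theta> a) has_derivative (\<lambda>v. \<mu>' (\<theta>, a) (0, v))) (at a)" by (rule c1_with_partials(2)[OF c\<mu> z])
      have "\<psi> = (\<lambda>a. \<mu> \<theta> a / D)" unfolding \<psi>_def[abs_def] \<mu>_def using par by (simp add: field_simps)
      then have d\<psi>: "(\<psi> has_derivative (\<lambda>v. \<mu>' (\<theta>, a) (0, v) / D)) (at a)"
        using bounded_linear.has_derivative[OF bounded_linear_divide[of D] d] by simp
      have "grad (\<lambda>a. \<mu> \<theta> a) a \<bullet> \<nu> = D * (grad \<psi> a \<bullet> \<nu>)"
        unfolding grad_inner[OF d] grad_inner[OF d\<psi>] using par by simp
      then have "Ga \<theta> a \<bullet> \<nu> = \<eta> * g \<theta> a * (D * (grad \<psi> a \<bullet> \<nu>))"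
        unfolding Ga_eq[OF z] by simp
      then show ?thesis by (simp add: H_def K_def \<theta>_def[symmetric])
    qed
    show "((\<lambda>a. snd (H (u, a)) \<bullet> \<nu>) \<longlongrightarrow> 0) (at p within (W - range x))"
    proof (rule Lim_null_comparison)
      show "((\<lambda>a. CM * (\<eta> * D) * \<bar>g \<theta> a * (grad \<psi> a \<bullet> \<nu>)\<bar>) \<longlongrightarrow> 0) (at p within (W - range x))"
        by (intro tendsto_mult_right_zero tendsto_rabs_zero lim)
      have "norm (snd (H (u, a)) \<bullet> \<nu>) \<le> CM * (\<eta> * D) * \<bar>g \<theta> a * (grad \<psi> a \<bullet> \<nu>)\<bar>"
        if a: "a \<in> V" for a
        unfolding eq[OF a] real_norm_def abs_mult[of "M (u, a) * (\<eta> * D)"]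
        by (rule mult_right_mono[OF _ abs_ge_zero])
          (use CM(2)[OF \<theta> VW[OF a]] par in \<open>simp add: abs_mult M_def \<theta>_def\<close>)
      then show "\<forall>\<^sub>F a in at p within (W - range x). norm (snd (H (u, a)) \<bullet> \<nu>)
          \<le> CM * (\<eta> * D) * \<bar>g \<theta> a * (grad \<psi> a \<bullet> \<nu>)\<bar>"
        unfolding eventually_at_filter V_def by (intro always_eventually) simp
    qed
  qed
  moreover have "(\<integral>z. indicator (hexagon \<times> (W - range x)) z * (\<Sum>b\<in>Basis. H' z b \<bullet> b) \<partial>lborel)
     = (\<integral>z. indicator (hexagon \<times> (W - range x)) z * ((\<mu> (plane_iso (fst z)) (snd z) + D) * r (plane_iso (fst z)) (snd z))
        + 3 * \<gamma> * (indicator (hexagon \<times> (W - range x)) z * I1 (plane_iso (fst z)) (snd z))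
        + \<eta> * (indicator (hexagon \<times> (W - range x)) z * I2 (plane_iso (fst z)) (snd z)) \<partial>lborel)"
  proof (rule Bochner_Integration.integral_cong[OF refl])
    fix z :: "(real^2) \<times> (real^2)"
    show "indicator (hexagon \<times> (W - range x)) z * (\<Sum>b\<in>Basis. H' z b \<bullet> b)
     = indicator (hexagon \<times> (W - range x)) z * ((\<mu> (plane_iso (fst z)) (snd z) + D) * r (plane_iso (fst z)) (snd z))
        + 3 * \<gamma> * (indicator (hexagon \<times> (W - range x)) z * I1 (plane_iso (fst z)) (snd z))
        + \<eta> * (indicator (hexagon \<times> (W - range x)) z * I2 (plane_iso (fst z)) (snd z))"
    proof (cases "z \<in> hexagon \<times> (W - range x)")
      case True
      then show ?thesis using div_eq[of z] by (simp add: Om_def V_def M_def)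
    qed simp
  qed
  \<comment> \<open>Each of the three densities is integrable by its own transfer lemma, so the
    vanishing integral of the divergence may be split.\<close>
  ultimately have sum0: "(\<integral>z. indicator (hexagon \<times> (W - range x)) z * ((\<mu> (plane_iso (fst z)) (snd z) + D) * r (plane_iso (fst z)) (snd z)) \<partial>lborel)
        + 3 * \<gamma> * (\<integral>z. indicator (hexagon \<times> (W - range x)) z * I1 (plane_iso (fst z)) (snd z) \<partial>lborel)
        + \<eta> * (\<integral>z. indicator (hexagon \<times> (W - range x)) z * I2 (plane_iso (fst z)) (snd z) \<partial>lborel) = 0"
    using tr1(3) tr2(3) tr3(3) by simp
  have I1f: "(\<lambda>(\<theta>, a). g \<theta> a * (norm (tgrad (\<lambda>\<theta>'. D * ln (g \<theta>' a) + E \<theta>' a) \<theta>))\<^sup>2) = (\<lambda>(\<theta>, a). I1 \<theta> a)"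
    by (simp add: I1_def \<mu>_def)
  have I2f: "(\<lambda>(\<theta>, a). g \<theta> a * (norm (grad (\<lambda>a'. D * ln (g \<theta> a') + E \<theta> a') a))\<^sup>2) = (\<lambda>(\<theta>, a). I2 \<theta> a)"
    by (simp add: I2_def \<mu>_def)
  show ?int1
    unfolding I1f by (rule tr1(1))
  show ?int2
    unfolding I2f by (rule tr2(1))
  have J1: "?S1 = (\<integral>z. indicator (hexagon \<times> (W - range x)) z * I1 (plane_iso (fst z)) (snd z) \<partial>lborel)"
    unfolding I1f by (rule tr1(2))
  have J2: "?S2 = (\<integral>z. indicator (hexagon \<times> (W - range x)) z * I2 (plane_iso (fst z)) (snd z) \<partial>lborel)"
    unfolding I2f by (rule tr2(2))
  have "?L = (\<integral>z. indicator (hexagon \<times> (W - range x)) z * ((\<mu> (plane_iso (fst z)) (snd z) + D) * r (plane_iso (fst z)) (snd z)) \<partial>lborel)"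
    unfolding \<mu>_def by (simp only: mult.commute[of "r _ _"])
  then show "?L = - (3 * \<gamma>) * ?S1 - \<eta> * ?S2"
    unfolding J1 J2 using sum0 by simp
qed

text \<open>In planar coordinates the free energy is an integral over a fixed bounded open set whose
  density is differentiable in time with a locally uniform bound. Differentiating under the integral
  gives the left-hand side of \<open>dissipation_identity\<close>.\<close>

theorem theorem2p3:
  fixes \<gamma> \<eta> \<beta>\<theta> \<beta>a D :: real
    and \<sigma> :: "real \<Rightarrow> real" and x :: "3 \<Rightarrow> real^2"
    and E :: "real^3 \<Rightarrow> real^2 \<Rightarrow> real"
    and W :: "(real^2) set" and T :: "real set"
    and f :: "real^3 \<Rightarrow> real^2 \<Rightarrow> real \<Rightarrow> real"
  assumes "\<gamma> > 0" "\<eta> > 0" "\<beta>\<theta> > 0" "\<beta>a > 0"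
    and "\<sigma> C1_differentiable_on UNIV"
    and "E = energy \<sigma> x"
    and "regular_domain W" and "open T"
    and "positive_classical \<gamma> E (range x) W T f"
    and "\<And>\<theta> a t. \<theta> \<in> misor_domain \<Longrightarrow> a \<in> W - range x \<Longrightarrow> t \<in> T \<Longrightarrow>
           fokker_planck_eq \<gamma> \<eta> \<beta>\<theta> \<beta>a E f \<theta> a t"
    and "\<And>a t. a \<in> W - range x \<Longrightarrow> t \<in> T \<Longrightarrow> natural_bc_misor \<gamma> \<beta>\<theta> E f a t"
    and "\<And>\<theta> t. \<theta> \<in> misor_domain \<Longrightarrow> t \<in> T \<Longrightarrow> natural_bc_junction \<eta> \<beta>a E (range x) W f \<theta> t"
    and "6 * \<gamma> / \<beta>\<theta>\<^sup>2 = 2 * \<eta> / \<beta>a\<^sup>2"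
    and "D = \<beta>\<theta>\<^sup>2 / (6 * \<gamma>)"
  shows "D = \<beta>a\<^sup>2 / (2 * \<eta>) \<and> (\<forall>t\<in>T.
      set_integrable state_measure (misor_domain \<times> W)
        (\<lambda>(\<theta>, a). D * f \<theta> a t * ln (f \<theta> a t) + f \<theta> a t * E \<theta> a) \<and>
      set_integrable state_measure (misor_domain \<times> W)
        (\<lambda>(\<theta>, a). f \<theta> a t * (norm (tgrad (\<lambda>\<theta>'. D * ln (f \<theta>' a t) + E \<theta>' a) \<theta>))\<^sup>2) \<and>
      set_integrable state_measure (misor_domain \<times> W)
        (\<lambda>(\<theta>, a). f \<theta> a t * (norm (grad (\<lambda>a'. D * ln (f \<theta> a' t) + E \<theta> a') a))\<^sup>2) \<and>
      ((\<lambda>s. set_lebesgue_integral state_measure (misor_domain \<times> W)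
              (\<lambda>(\<theta>, a). D * f \<theta> a s * ln (f \<theta> a s) + f \<theta> a s * E \<theta> a))
        has_real_derivative
          - (\<beta>\<theta>\<^sup>2 / (2 * D)) * set_lebesgue_integral state_measure (misor_domain \<times> W)
              (\<lambda>(\<theta>, a). f \<theta> a t * (norm (tgrad (\<lambda>\<theta>'. D * ln (f \<theta>' a t) + E \<theta>' a) \<theta>))\<^sup>2)
          - (\<beta>a\<^sup>2 / (2 * D)) * set_lebesgue_integral state_measure (misor_domain \<times> W)
              (\<lambda>(\<theta>, a). f \<theta> a t * (norm (grad (\<lambda>a'. D * ln (f \<theta> a' t) + E \<theta> a') a))\<^sup>2))
        (at t))"
proof -
  note asm = assms
  have E: "E = energy \<sigma> x" by fact
  have Dpos: "D > 0" using asm(1,3,14) by simp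
  have b1: "\<beta>\<theta>\<^sup>2 = 6 * \<gamma> * D" using asm(1,14) by simp
  have Da: "D = \<beta>a\<^sup>2 / (2 * \<eta>)"
  proof -
    \<comment> \<open>The relation between the parameters says exactly that both ratios equal
      \<open>1 / D\<close>.\<close>
    have "1 / D = 2 * \<eta> / \<beta>a\<^sup>2" using asm(13,14) by simp
    moreover have "D = 1 / (1 / D)" by simp
    ultimately show ?thesis by simp
  qed
  have b2: "\<beta>a\<^sup>2 = 2 * \<eta> * D" using asm(2) by (simp add: Da)
  obtain \<sigma>' where \<sigma>: "\<And>s. (\<sigma> has_real_derivative \<sigma>' s) (at s)" "continuous_on UNIV \<sigma>'"
    using asm(5) unfolding C1_differentiable_on_def has_real_derivative_iff_has_vector_derivative by blast
  have oW: "open W" and bW: "bounded W" using asm(7) by (auto simp: regular_domain_def)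
  have fX: "finite (range x)" by simp
  define cD where "cD = closure misor_domain"
  define cW where "cW = closure W"
  have pos: "f \<theta> a s > 0" and diff: "(\<lambda>s. f \<theta> a s) differentiable (at s)"
    if "\<theta> \<in> cD" "a \<in> cW" "s \<in> T" for \<theta> a s
    using asm(9) that unfolding positive_classical_def cD_def cW_def by blast+
  have fcont: "continuous_on (cD \<times> cW \<times> T) (\<lambda>(\<theta>, a, t). f \<theta> a t)"
    and fdcont: "continuous_on (cD \<times> cW \<times> T) (\<lambda>(\<theta>, a, t). deriv (\<lambda>s. f \<theta> a s) t)"
    using asm(9) unfolding positive_classical_def cD_def cW_def by blast+
  have c\<sigma>: "continuous_on UNIV \<sigma>" using \<sigma>(1) by (meson DERIV_isCont continuous_at_imp_continuous_on)
  have slice: "continuous_on (cD \<times> cW) (\<lambda>(\<theta>, a). h \<theta> a s)"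
    if "continuous_on (cD \<times> cW \<times> T) (\<lambda>(\<theta>, a, t). h \<theta> a t)" "s \<in> T" for h :: "real^3 \<Rightarrow> real^2 \<Rightarrow> real \<Rightarrow> real" and s
  proof -
    have "continuous_on (cD \<times> cW) (\<lambda>z. case (fst z, snd z, s) of (\<theta>, a, t) \<Rightarrow> h \<theta> a t)"
      by (rule continuous_on_compose2[OF that(1)]) (use that(2) in \<open>auto intro!: continuous_intros\<close>)
    then show ?thesis by (simp add: case_prod_unfold)
  qed
  define \<phi> where "\<phi> s \<theta> a = D * f \<theta> a s * ln (f \<theta> a s) + f \<theta> a s * E \<theta> a" for s \<theta> a
  \<comment> \<open>Differentiating \<open>f * ln f\<close> produces \<open>ln f + 1\<close>; the 1
    becomes the last summand \<open>D\<close>.\<close>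
  define \<phi>' where "\<phi>' s \<theta> a = deriv (\<lambda>s. f \<theta> a s) s * (D * ln (f \<theta> a s) + E \<theta> a + D)" for s \<theta> a
  have econt: "continuous_on (cD \<times> cW \<times> T) (\<lambda>(\<theta>, a, t). E \<theta> a)"
  proof -
    have "continuous_on (cD \<times> cW \<times> T) (\<lambda>z. case (fst z, fst (snd z)) of (\<theta>, a) \<Rightarrow> energy \<sigma> x \<theta> a)"
      by (rule continuous_on_compose2[OF continuous_on_energy[OF c\<sigma>, of UNIV]]) (auto intro!: continuous_intros)
    then show ?thesis unfolding E by (simp add: case_prod_unfold)
  qed
  have lcont: "continuous_on (cD \<times> cW \<times> T) (\<lambda>z. ln (case z of (\<theta>, a, t) \<Rightarrow> f \<theta> a t))"
    by (intro continuous_on_ln fcont) (use pos in force)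
  have \<phi>cont: "continuous_on (cD \<times> cW \<times> T) (\<lambda>(\<theta>, a, s). \<phi> s \<theta> a)"
  proof -
    have "continuous_on (cD \<times> cW \<times> T) (\<lambda>z. D * (case z of (\<theta>, a, t) \<Rightarrow> f \<theta> a t) * ln (case z of (\<theta>, a, t) \<Rightarrow> f \<theta> a t)
        + (case z of (\<theta>, a, t) \<Rightarrow> f \<theta> a t) * (case z of (\<theta>, a, t) \<Rightarrow> E \<theta> a))"
      by (intro continuous_on_add continuous_on_mult continuous_on_const fcont lcont econt)
    then show ?thesis by (simp add: \<phi>_def case_prod_unfold)
  qed
  have \<phi>'cont: "continuous_on (cD \<times> cW \<times> T) (\<lambda>(\<theta>, a, s). \<phi>' s \<theta> a)"
  proof -
    have "continuous_on (cD \<times> cW \<times> T) (\<lambda>z. (case z of (\<theta>, a, t) \<Rightarrow> deriv (\<lambda>s. f \<theta> a s) t) *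
        (D * ln (case z of (\<theta>, a, t) \<Rightarrow> f \<theta> a t) + (case z of (\<theta>, a, t) \<Rightarrow> E \<theta> a) + D))"
      by (intro continuous_on_add continuous_on_mult continuous_on_const fdcont lcont econt)
    then show ?thesis by (simp add: \<phi>'_def case_prod_unfold)
  qed
  note tr\<phi> = state_integral_transfer_closure[of W "range x", OF oW bW fX slice[OF \<phi>cont, unfolded cD_def cW_def]]
  note tr\<phi>' = state_integral_transfer_closure(3)[of W "range x", OF oW bW fX slice[OF \<phi>'cont, unfolded cD_def cW_def]]
  define A where "A = hexagon \<times> (W - range x)"
  have Ao: "open A" and Ab: "bounded A"
    using regular_domain_hexagon oW bW fX unfolding A_def regular_domain_def
    by (auto intro!: open_Times open_Diff finite_imp_closed bounded_Times intro: bounded_subset)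
  have Acl: "plane_iso (fst z) \<in> cD" "snd z \<in> cW" if "z \<in> A" for z
    using that closure_subset[of misor_domain] closure_subset[of W] by (auto simp: A_def cD_def cW_def hexagon_def)
  show ?thesis
  proof (intro conjI ballI)
    show "D = \<beta>a\<^sup>2 / (2 * \<eta>)" by (rule Da)
  next
    fix t assume t: "t \<in> T"
    show "set_integrable state_measure (misor_domain \<times> W)
        (\<lambda>(\<theta>, a). D * f \<theta> a t * ln (f \<theta> a t) + f \<theta> a t * E \<theta> a)"
      using tr\<phi>(1)[OF t] unfolding \<phi>_def .
    have pc: "(\<exists>G. open G \<and> misor_domain \<times> (W - range x) \<subseteq> G \<and>
           C1_on G (\<lambda>(\<theta>, a). f \<theta> a t) \<and>
           C1_on G (\<lambda>(\<theta>, a). tgrad (\<lambda>\<theta>'. f \<theta>' a t) \<theta>) \<and>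
           C1_on G (\<lambda>(\<theta>, a). grad (\<lambda>a'. f \<theta> a' t) a) \<and>
           C1_on G (\<lambda>(\<theta>, a). f \<theta> a t *\<^sub>R vel_misor \<gamma> E \<theta> a)) \<and>
        bounded ((\<lambda>(\<theta>, a). tgrad (\<lambda>\<theta>'. f \<theta>' a t) \<theta>) ` (misor_domain \<times> (W - range x))) \<and>
        bounded ((\<lambda>(\<theta>, a). grad (\<lambda>a'. f \<theta> a' t) a) ` (misor_domain \<times> (W - range x)))"
      using asm(9) t unfolding positive_classical_def by blast
    then obtain G where G: "open G" "misor_domain \<times> (W - range x) \<subseteq> G"
        "C1_on G (\<lambda>(\<theta>, a). f \<theta> a t)"
        "C1_on G (\<lambda>(\<theta>, a). tgrad (\<lambda>\<theta>'. f \<theta>' a t) \<theta>)"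
        "C1_on G (\<lambda>(\<theta>, a). grad (\<lambda>a'. f \<theta> a' t) a)"
        "C1_on G (\<lambda>(\<theta>, a). f \<theta> a t *\<^sub>R vel_misor \<gamma> (energy \<sigma> x) \<theta> a)" unfolding E by blast
    note bd = conjunct1[OF conjunct2[OF pc]] conjunct2[OF conjunct2[OF pc]]
    note di = dissipation_identity[where g="\<lambda>\<theta> a. f \<theta> a t" and r="\<lambda>\<theta> a. deriv (\<lambda>s. f \<theta> a s) t" and W=W and x=x and \<sigma>=\<sigma>,
        OF asm(1,2) Dpos b1 b2 \<sigma> asm(7) _ slice[OF fcont t, unfolded cD_def cW_def] slice[OF fdcont t, unfolded cD_def cW_def] G bd]
      have gp: "\<And>\<theta> a. \<theta> \<in> closure misor_domain \<Longrightarrow> a \<in> closure W \<Longrightarrow> 0 < f \<theta> a t"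
        using pos t unfolding cD_def cW_def by blast
      have fp: "\<And>\<theta> a. \<theta> \<in> misor_domain \<Longrightarrow> a \<in> W - range x \<Longrightarrow>
        deriv (\<lambda>s. f \<theta> a s) t + tdiverg (\<lambda>\<theta>'. f \<theta>' a t *\<^sub>R vel_misor \<gamma> (energy \<sigma> x) \<theta>' a) \<theta>
          + diverg (\<lambda>a'. f \<theta> a' t *\<^sub>R vel_junction \<eta> (energy \<sigma> x) \<theta> a') a
        = \<beta>\<theta>\<^sup>2 / 2 * tlaplace (\<lambda>\<theta>'. f \<theta>' a t) \<theta> + \<beta>a\<^sup>2 / 2 * laplace (\<lambda>a'. f \<theta> a' t) a"
        using asm(10)[OF _ _ t] unfolding fokker_planck_eq_def E by blast
      have n1: "\<And>a \<theta>0 \<nu>. a \<in> W - range x \<Longrightarrow> \<theta>0 \<in> rel_frontier misor_domain \<Longrightarrow>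
        outer_unit_normal misor_plane misor_domain \<theta>0 \<nu> \<Longrightarrow>
        ((\<lambda>\<theta>. f \<theta> a t * (tgrad (\<lambda>\<theta>'. ln (f \<theta>' a t) + 6 * \<gamma> / \<beta>\<theta>\<^sup>2 * energy \<sigma> x \<theta>' a) \<theta> \<bullet> \<nu>)) \<longlongrightarrow> 0)
          (at \<theta>0 within misor_domain)"
        using asm(11)[OF _ t] unfolding natural_bc_misor_def E by blast
      have n2: "\<And>\<theta> a0 \<nu>. \<theta> \<in> misor_domain \<Longrightarrow> a0 \<in> frontier W - range x \<Longrightarrow>
        outer_unit_normal UNIV W a0 \<nu> \<Longrightarrow>
        ((\<lambda>a. f \<theta> a t * (grad (\<lambda>a'. ln (f \<theta> a' t) + 2 * \<eta> / \<beta>a\<^sup>2 * energy \<sigma> x \<theta> a') a \<bullet> \<nu>)) \<longlongrightarrow> 0) (at a0 within W)"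
        using asm(12)[OF _ t] unfolding natural_bc_junction_def E by blast
    note diss = di[OF gp fp n1 n2]
    show "set_integrable state_measure (misor_domain \<times> W)
        (\<lambda>(\<theta>, a). f \<theta> a t * (norm (tgrad (\<lambda>\<theta>'. D * ln (f \<theta>' a t) + E \<theta>' a) \<theta>))\<^sup>2)"
      unfolding E by (rule diss(1))
    show "set_integrable state_measure (misor_domain \<times> W)
        (\<lambda>(\<theta>, a). f \<theta> a t * (norm (grad (\<lambda>a'. D * ln (f \<theta> a' t) + E \<theta> a') a))\<^sup>2)"
      unfolding E by (rule diss(2))
    \<comment> \<open>A closed interval of times gives a compact set on which \<open>\<phi>'\<close>
      is continuous, hence one bound \<open>C\<close> for all nearby times.\<close>
    obtain \<delta> where \<delta>: "\<delta> > 0" "cball t \<delta> \<subseteq> T" using asm(8) t open_contains_cball by blast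
    have bT: "s \<in> T" if "s \<in> ball t \<delta>" for s using that \<delta>(2) ball_subset_cball by blast
    have "compact (cD \<times> cW \<times> cball t \<delta>)"
      unfolding cD_def cW_def using bW by (intro compact_Times compact_closure_misor_domain compact_cball) simp
    moreover have "continuous_on (cD \<times> cW \<times> cball t \<delta>) (\<lambda>(\<theta>, a, s). \<phi>' s \<theta> a)"
      using \<delta>(2) by (intro continuous_on_subset[OF \<phi>'cont]) auto
    ultimately have "bounded ((\<lambda>(\<theta>, a, s). \<phi>' s \<theta> a) ` (cD \<times> cW \<times> cball t \<delta>))"
      by (intro compact_imp_bounded compact_continuous_image)
    then obtain C where C: "\<And>\<theta> a s. \<theta> \<in> cD \<Longrightarrow> a \<in> cW \<Longrightarrow> s \<in> cball t \<delta> \<Longrightarrow> \<bar>\<phi>' s \<theta> a\<bar> \<le> C"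
      unfolding bounded_iff by force
    have d\<phi>: "((\<lambda>s. \<phi> s \<theta> a) has_real_derivative \<phi>' s \<theta> a) (at s)" if z: "\<theta> \<in> cD" "a \<in> cW" "s \<in> T" for \<theta> a s
    proof -
      have df: "((\<lambda>s. f \<theta> a s) has_real_derivative deriv (\<lambda>s. f \<theta> a s) s) (at s)"
        using diff[OF z] by (simp add: DERIV_deriv_iff_real_differentiable)
      show ?thesis unfolding \<phi>_def \<phi>'_def
        by (rule derivative_eq_intros df refl pos[OF z])+ (use pos[OF z] in \<open>simp add: field_simps\<close>)
    qed
    have "((\<lambda>s. \<integral>z. indicator A z * \<phi> s (plane_iso (fst z)) (snd z) \<partial>lborel) has_real_derivative
        (\<integral>z. indicator A z * \<phi>' t (plane_iso (fst z)) (snd z) \<partial>lborel)) (at t)"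
    proof (rule has_real_derivative_integral_bounded[OF \<delta>(1), where C=C and \<phi>'="\<lambda>s z. \<phi>' s (plane_iso (fst z)) (snd z)"])
      show "A \<in> sets lborel" using Ao by simp
      show "emeasure lborel A < \<infinity>" using emeasure_bounded_finite[OF Ab] by simp
      show "integrable lborel (\<lambda>z. indicator A z * \<phi> s (plane_iso (fst z)) (snd z))" if "s \<in> ball t \<delta>" for s
        unfolding A_def by (rule tr\<phi>(3)[OF bT[OF that]])
      show "((\<lambda>s. \<phi> s (plane_iso (fst z)) (snd z)) has_real_derivative \<phi>' s (plane_iso (fst z)) (snd z)) (at s)"
        if "s \<in> ball t \<delta>" "z \<in> A" for s z
        by (rule d\<phi>[OF Acl[OF that(2)] bT[OF that(1)]])
      show "\<bar>\<phi>' s (plane_iso (fst z)) (snd z)\<bar> \<le> C" if "s \<in> ball t \<delta>" "z \<in> A" for s z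
        using C[OF Acl[OF that(2)]] that(1) by simp
      show "(\<lambda>z. indicator A z * \<phi>' t (plane_iso (fst z)) (snd z)) \<in> borel_measurable lborel"
        unfolding A_def by (rule borel_measurable_integrable[OF tr\<phi>'[OF t]])
    qed
    \<comment> \<open>The original and the transferred integrals are known to agree only for times
      in \<open>T\<close>, so the derivative is carried over on a ball around
      \<open>t\<close>.\<close>
    then have "((\<lambda>s. set_lebesgue_integral state_measure (misor_domain \<times> W) (\<lambda>(\<theta>, a). \<phi> s \<theta> a)) has_real_derivative
        (\<integral>z. indicator A z * \<phi>' t (plane_iso (fst z)) (snd z) \<partial>lborel)) (at t)"
    proof (rule has_field_derivative_transform_within_open[where S="ball t \<delta>"])
      show "(\<integral>z. indicator A z * \<phi> s (plane_iso (fst z)) (snd z) \<partial>lborel)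
         = set_lebesgue_integral state_measure (misor_domain \<times> W) (\<lambda>(\<theta>, a). \<phi> s \<theta> a)" if "s \<in> ball t \<delta>" for s
        unfolding A_def by (rule tr\<phi>(2)[OF bT[OF that], symmetric])
    qed (use \<delta>(1) in simp_all)
    moreover have "(\<integral>z. indicator A z * \<phi>' t (plane_iso (fst z)) (snd z) \<partial>lborel)
       = - (\<beta>\<theta>\<^sup>2 / (2 * D)) * set_lebesgue_integral state_measure (misor_domain \<times> W)
              (\<lambda>(\<theta>, a). f \<theta> a t * (norm (tgrad (\<lambda>\<theta>'. D * ln (f \<theta>' a t) + E \<theta>' a) \<theta>))\<^sup>2)
          - (\<beta>a\<^sup>2 / (2 * D)) * set_lebesgue_integral state_measure (misor_domain \<times> W)
              (\<lambda>(\<theta>, a). f \<theta> a t * (norm (grad (\<lambda>a'. D * ln (f \<theta> a' t) + E \<theta> a') a))\<^sup>2)"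
    proof -
      \<comment> \<open>The coefficients in the statement are the mobilities of the two flux
        components.\<close>
      have k: "\<beta>\<theta>\<^sup>2 / (2 * D) = 3 * \<gamma>" "\<beta>a\<^sup>2 / (2 * D) = \<eta>" using b1 b2 Dpos by simp_all
      show ?thesis unfolding k \<phi>'_def A_def E by (rule diss(3))
    qed
    ultimately show "((\<lambda>s. set_lebesgue_integral state_measure (misor_domain \<times> W)
              (\<lambda>(\<theta>, a). D * f \<theta> a s * ln (f \<theta> a s) + f \<theta> a s * E \<theta> a))
        has_real_derivative
          - (\<beta>\<theta>\<^sup>2 / (2 * D)) * set_lebesgue_integral state_measure (misor_domain \<times> W)
              (\<lambda>(\<theta>, a). f \<theta> a t * (norm (tgrad (\<lambda>\<theta>'. D * ln (f \<theta>' a t) + E \<theta>' a) \<theta>))\<^sup>2)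
          - (\<beta>a\<^sup>2 / (2 * D)) * set_lebesgue_integral state_measure (misor_domain \<times> W)
              (\<lambda>(\<theta>, a). f \<theta> a t * (norm (grad (\<lambda>a'. D * ln (f \<theta> a' t) + E \<theta> a') a))\<^sup>2))
        (at t)"
      unfolding \<phi>_def by simp
  qed
qed

end
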